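(* Let $n_2\ge n_1\ge 1$ be integers, let $\Sigma$ be an annulus with stops $\Lambda$ of type $\widetilde{\mathbb A}_{n_1,n_2}$, and let $\widetilde{\mathcal A}_{n_1,n_2}$ be its symmetric square dg algebra, with cohomology algebra $\mathcal A_{n_1,n_2}=H^*(\widetilde{\mathcal A}_{n_1,n_2})$. Then: (1) If $n_1=1$, the dg algebra $\widetilde{\mathcal A}_{1,n_2}$ is formal. (2) If $n_1>1$, the dg algebra $\widetilde{\mathcal A}_{n_1,n_2}$ is not formal, and it admits a minimal $A_\infty$-model $(\mathcal A_{n_1,n_2},m_2,m_3,\dots)$ with $m_i=0$ for all $i>3$.
   Context: $\Bbbk$ is an algebraically closed field of characteristic zero; put $N=n_1+n_2$. "Type $\widetilde{\mathbb A}_{n_1,n_2}$" means $n_1$ stops on one boundary component of the annulus and $n_2$ on the other. Let $L_1,\dots,L_N$ be the full formal arc system on $(\Sigma,\Lambda)$ whose endomorphism algebra is the gentle algebra with arrows $\alpha_i:L_i\to L_{i+1}$ ($1\le i\le N-1$), $\beta:L_1\to L_{n_1+1}$ and the single relation $\beta\alpha_{n_1+1}=0$. The symmetric square dg algebra $\widetilde{\mathcal A}_{n_1,n_2}$ is the dg endomorphism algebra of the generators $L_{i,j}:=L_i\times L_j$ ($1\le i<j\le N$) of the partially wrapped Fukaya category $\mathcal W(\mathrm{Sym}^2(\Sigma),\Lambda^{(2)})$. Explicitly, it is the following dg algebra $\Bbbk\widetilde Q/\widetilde I$, and this description may be used as the definition. Paths are written from left to right. Vertices of $\widetilde Q$: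 $L_{i,j}$, $1\le i<j\le N$, with the convention $L_{a,b}=L_{b,a}$. Arrows: - $x_{i,j}:L_{i,j}\to L_{i,j+1}$ for $1\le i<j\le N-1$; - $y_{i,j}:L_{i,j}\to L_{i+1,j}$ for $1\le i\le N-2$, $i+2\le j\le N$; - $u_{1,i}:L_{1,i}\to L_{i,n_1+1}$ for $2\le i\le N$, $i\ne n_1+1$; - $z_{i,i+1}:L_{i,i+1}\to L_{i+1,i+2}$ for $1\le i\le N-2$. Relations generating $\widetilde I$ (each imposed only when all arrows appearing in it are defined): - $x_{i,j}y_{i,j+1}=y_{i,j}x_{i+1,j}$ for $1\le i<j-1\le N-2$; - $u_{1,i}x_{n_1+1,i}=x_{1,i}u_{1,i+1}$ for $n_1+2\le i\le N-1$; - $u_{1,i}y_{i,n_1+1}=x_{1,i}u_{1,i+1}$ for $1<i<n_1$; - $u_{1,n_1}z_{n_1,n_1+1}=x_{1,n_1}x_{1,n_1+1}u_{1,n_1+2}$; - $z_{i,i+1}x_{i+1,i+2}y_{i+1,i+3}=x_{i,i+1}y_{i,i+2}z_{i+1,i+2}$ for $1\le i\le N-3$; - $u_{1,i}x_{i,n_1+1}=0$ for $1<i\le n_1$; $u_{1,n_1+i}y_{n_1+1,n_1+i}=0$ for $3\le i\le n_2$; $u_{1,n_1+2}z_{n_1+1,n_1+2}=0$; $z_{i,i+1}z_{i+1,i+2}=0$ for $1\le i\le N-3$. Differential: $d(x_{i,j})=d(y_{i,j})=d(u_{1,i})=0$ and $d(z_{i,i+1})=x_{i,i+1}y_{i,i+2}$,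 extended by $d(ab)=d(a)b+(-1)^{|a|}a\,d(b)$. Grading: $\widetilde{\mathcal A}_{n_1,n_2}$ carries any $\mathbb Z$-grading given by assigning integer degrees to the arrows so that the relations are homogeneous and $d$ is a well-defined differential of degree $+1$. (For example $|x_{i,j}|=|y_{i,j}|=0$, $|z_{i,i+1}|=-1$, $|u_{1,k}|=m+1$ for $2\le k\le n_1$ and $|u_{1,k}|=m$ for $n_1+2\le k\le N$, for any $m\in\mathbb Z$.) A dg algebra $A$ is formal if $A$ and $H^*(A)$ (with induced product and zero differential) are connected by a zig-zag of dg algebra quasi-isomorphisms. A minimal $A_\infty$-model of $A$ is an $A_\infty$-structure on $H^*(A)$ with $m_1=0$ and $m_2$ the induced product, together with an $A_\infty$-quasi-isomorphism to $A$; here $m_r$ has degree $2-r$. *)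

theory Defs
  imports
    "HOL-Algebra.QuotRing"
    "HOL-Algebra.Module"
    "HOL-Library.Poly_Mapping"
    "HOL-Computational_Algebra.Polynomial"
    "Graph_Theory.Arc_Walk"
begin

section \<open>Graded vector spaces and differential graded algebras\<close>

text \<open>The ground field is a type of class \<^class>\<open>field\<close>; all other structures are records with
  explicit carriers. The following record lets the module theory of HOL-Algebra speak about
  vector spaces over such a field.\<close>

definition field_ring :: "'k::field ring" where
  "field_ring = \<lparr>carrier = UNIV, monoid.mult = (*), one = 1, zero = 0, add = (+)\<rparr>"

record ('k, 'a) graded = "('k, 'a) module" +
  homog :: "int \<Rightarrow> 'a set"

record ('k, 'a) dg_alg = "('k, 'a) graded" +
  dif :: "'a \<Rightarrow> 'a"

text \<open>The multiplicative fields of the record play no role in the next definition. The last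
  assumption says that the space is the direct sum of its homogeneous parts.\<close>

locale graded_space =
  fixes V :: "('k::field, 'a, 'm) graded_scheme" (structure)
  assumes module: "Module.module field_ring V"
    and homog_submodule: "\<And>n. submodule (homog V n) field_ring V"
    and decomposition: "\<And>x. x \<in> carrier V \<Longrightarrow>
      \<exists>!h :: int \<Rightarrow> 'a. (\<forall>n. h n \<in> homog V n) \<and> finite {n. h n \<noteq> \<zero>} \<and>
        x = (\<Oplus>n\<in>{n. h n \<noteq> \<zero>}. h n)"

locale dg_algebra = graded_space A
  for A :: "('k::field, 'a) dg_alg" (structure) +
  assumes ring: "ring A"
    and smult_mult_left: "\<And>c x y. x \<in> carrier A \<Longrightarrow> y \<in> carrier A \<Longrightarrow>
      (c \<odot> x) \<otimes> y = c \<odot> (x \<otimes> y)"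
    and smult_mult_right: "\<And>c x y. x \<in> carrier A \<Longrightarrow> y \<in> carrier A \<Longrightarrow>
      x \<otimes> (c \<odot> y) = c \<odot> (x \<otimes> y)"
    and one_homog: "\<one> \<in> homog A 0"
    and mult_homog: "\<And>m n x y. x \<in> homog A m \<Longrightarrow> y \<in> homog A n \<Longrightarrow> x \<otimes> y \<in> homog A (m + n)"
    and dif_add: "\<And>x y. x \<in> carrier A \<Longrightarrow> y \<in> carrier A \<Longrightarrow>
      dif A (x \<oplus> y) = dif A x \<oplus> dif A y"
    and dif_smult: "\<And>c x. x \<in> carrier A \<Longrightarrow> dif A (c \<odot> x) = c \<odot> dif A x"
    and dif_homog: "\<And>n x. x \<in> homog A n \<Longrightarrow> dif A x \<in> homog A (n + 1)"
    and dif_dif: "\<And>x. x \<in> carrier A \<Longrightarrow> dif A (dif A x) = \<zero>"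
    and leibniz: "\<And>n x y. x \<in> homog A n \<Longrightarrow> y \<in> carrier A \<Longrightarrow>
      dif A (x \<otimes> y) = (dif A x \<otimes> y) \<oplus> ((-1) powi n \<odot> (x \<otimes> dif A y))"

text \<open>The quotient by a two-sided ideal that is stable under the differential; operations on
  cosets are written as unions over representatives, as in \<^const>\<open>rcoset_mult\<close>.\<close>

definition quot_dga :: "('k, 'a) dg_alg \<Rightarrow> 'a set \<Rightarrow> ('k, 'a set) dg_alg" where
  "quot_dga A I = \<lparr>
     carrier = carrier (A Quot I),
     monoid.mult = monoid.mult (A Quot I),
     one = one (A Quot I),
     zero = zero (A Quot I),
     add = add (A Quot I),
     module.smult = (\<lambda>c X. \<Union>x\<in>X. I +>\<^bsub>A\<^esub> (c \<odot>\<^bsub>A\<^esub> x)),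
     homog = (\<lambda>n. (\<lambda>x. I +>\<^bsub>A\<^esub> x) ` homog A n),
     dif = (\<lambda>X. \<Union>x\<in>X. I +>\<^bsub>A\<^esub> dif A x)\<rparr>"

definition cocycles :: "('a, 'm) ring_scheme \<Rightarrow> ('a \<Rightarrow> 'a) \<Rightarrow> 'a set" where
  "cocycles V d = {x \<in> carrier V. d x = \<zero>\<^bsub>V\<^esub>}"

definition coboundaries :: "('a, 'm) ring_scheme \<Rightarrow> ('a \<Rightarrow> 'a) \<Rightarrow> 'a set" where
  "coboundaries V d = d ` carrier V"

text \<open>The graded algebra of cocycles modulo coboundaries, with the induced product. Its
  differential, induced by that of \<open>A\<close>, vanishes on all classes of cocycles.\<close>

definition cohomology :: "('k, 'a) dg_alg \<Rightarrow> ('k, 'a set) dg_alg" where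
  "cohomology A =
     quot_dga (A\<lparr>carrier := cocycles A (dif A), homog := (\<lambda>n. homog A n \<inter> cocycles A (dif A))\<rparr>)
       (coboundaries A (dif A))"

text \<open>\<open>induces_coh_iso V d W e \<phi>\<close>: the chain map \<open>\<phi>\<close> from \<open>(V, d)\<close> to \<open>(W, e)\<close> induces
  a bijection on cohomology.\<close>

definition coh_class :: "('a, 'm) ring_scheme \<Rightarrow> ('a \<Rightarrow> 'a) \<Rightarrow> 'a \<Rightarrow> 'a set" where
  "coh_class V d x = coboundaries V d +>\<^bsub>V\<^esub> x"

definition induces_coh_iso ::
  "('a, 'm) ring_scheme \<Rightarrow> ('a \<Rightarrow> 'a) \<Rightarrow> ('b, 'n) ring_scheme \<Rightarrow> ('b \<Rightarrow> 'b) \<Rightarrow> ('a \<Rightarrow> 'b) \<Rightarrow> bool" where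
  "induces_coh_iso V d W e \<phi> \<longleftrightarrow>
     bij_betw (\<lambda>X. \<Union>x\<in>X. coh_class W e (\<phi> x))
       (coh_class V d ` cocycles V d) (coh_class W e ` cocycles W e)"


section \<open>Formality\<close>

definition dga_hom :: "('k::field, 'a) dg_alg \<Rightarrow> ('k, 'b) dg_alg \<Rightarrow> ('a \<Rightarrow> 'b) \<Rightarrow> bool" where
  "dga_hom A B \<phi> \<longleftrightarrow>
     \<phi> \<in> ring_hom A B \<and>
     (\<forall>c. \<forall>x\<in>carrier A. \<phi> (c \<odot>\<^bsub>A\<^esub> x) = c \<odot>\<^bsub>B\<^esub> \<phi> x) \<and>
     (\<forall>n. \<phi> ` homog A n \<subseteq> homog B n) \<and>
     (\<forall>x\<in>carrier A. \<phi> (dif A x) = dif B (\<phi> x))"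

definition dga_quasi_iso :: "('k::field, 'a) dg_alg \<Rightarrow> ('k, 'b) dg_alg \<Rightarrow> ('a \<Rightarrow> 'b) \<Rightarrow> bool" where
  "dga_quasi_iso A B \<phi> \<longleftrightarrow>
     dg_algebra A \<and> dg_algebra B \<and> dga_hom A B \<phi> \<and> induces_coh_iso A (dif A) B (dif B) \<phi>"

definition qis_adjacent :: "('k::field, 'a) dg_alg \<Rightarrow> ('k, 'b) dg_alg \<Rightarrow> bool" where
  "qis_adjacent A B \<longleftrightarrow> (\<exists>\<phi>. dga_quasi_iso A B \<phi>) \<or> (\<exists>\<phi>. dga_quasi_iso B A \<phi>)"

text \<open>A formula of HOL cannot quantify over types, so formality is relative to the type \<open>'u\<close>
  in which the carriers of the intermediate algebras of a zig-zag live. A larger type admits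
  more zig-zags.\<close>

definition formal_in :: "'u itself \<Rightarrow> ('k::field, 'a) dg_alg \<Rightarrow> bool" where
  "formal_in U A \<longleftrightarrow>
     (\<exists>B C :: ('k, 'u) dg_alg.
        qis_adjacent A B \<and> qis_adjacent\<^sup>*\<^sup>* B C \<and> qis_adjacent C (cohomology A))"


section \<open>A-infinity algebras and minimal models\<close>

text \<open>The operations \<open>m\<^sub>1, m\<^sub>2, \<dots>\<close> are encoded as a single function on nonempty lists: \<open>m xs\<close>
  is the operation of arity \<open>length xs\<close> applied to \<open>xs\<close>. In \<open>multilinear V W e m\<close>, the
  operation of arity \<open>n\<close> has degree \<open>e - n\<close>.\<close>

definition has_degrees :: "('k, 'a, 'm) graded_scheme \<Rightarrow> 'a list \<Rightarrow> int list \<Rightarrow> bool" where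
  "has_degrees V xs ds \<longleftrightarrow> list_all2 (\<lambda>x n. x \<in> homog V n) xs ds"

definition multilinear ::
  "('k::field, 'a, 'm) graded_scheme \<Rightarrow> ('k, 'b, 'n) graded_scheme \<Rightarrow> int \<Rightarrow> ('a list \<Rightarrow> 'b) \<Rightarrow> bool" where
  "multilinear V W e m \<longleftrightarrow>
     (\<forall>xs. xs \<noteq> [] \<and> set xs \<subseteq> carrier V \<longrightarrow> m xs \<in> carrier W) \<and>
     (\<forall>xs x y zs. set xs \<subseteq> carrier V \<and> x \<in> carrier V \<and> y \<in> carrier V \<and> set zs \<subseteq> carrier V \<longrightarrow>
        m (xs @ [x \<oplus>\<^bsub>V\<^esub> y] @ zs) = m (xs @ [x] @ zs) \<oplus>\<^bsub>W\<^esub> m (xs @ [y] @ zs)) \<and>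
     (\<forall>xs c x zs. set xs \<subseteq> carrier V \<and> x \<in> carrier V \<and> set zs \<subseteq> carrier V \<longrightarrow>
        m (xs @ [c \<odot>\<^bsub>V\<^esub> x] @ zs) = c \<odot>\<^bsub>W\<^esub> m (xs @ [x] @ zs)) \<and>
     (\<forall>xs ds. xs \<noteq> [] \<and> has_degrees V xs ds \<longrightarrow> m xs \<in> homog W (sum_list ds + e - int (length xs)))"

text \<open>\<open>insertions W m g xs ds\<close> is the value on \<open>xs\<close> (homogeneous of degrees \<open>ds\<close>) of
  \<open>\<Sum> (-1)\<^sup>(\<^sup>r\<^sup>+\<^sup>s\<^sup>t\<^sup>) g (id\<^sup>r \<otimes> m\<^sub>s \<otimes> id\<^sup>t)\<close>, summed over \<open>r + s + t = length xs\<close> with \<open>s \<ge> 1\<close>.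
  The summand \<open>(2 - s) (d\<^sub>1 + \<dots> + d\<^sub>r)\<close> of the exponent is the Koszul sign of moving \<open>m\<^sub>s\<close>,
  of degree \<open>2 - s\<close>, past the first \<open>r\<close> arguments.\<close>

definition insertions ::
  "('k::field, 'b, 'n) graded_scheme \<Rightarrow> ('a list \<Rightarrow> 'a) \<Rightarrow> ('a list \<Rightarrow> 'b) \<Rightarrow> 'a list \<Rightarrow> int list \<Rightarrow> 'b" where
  "insertions W m g xs ds =
     finsum W (\<lambda>(r, s).
        (-1) powi (int r + int s * int (length xs - r - s) + (2 - int s) * sum_list (take r ds)) \<odot>\<^bsub>W\<^esub>
        g (take r xs @ [m (take s (drop r xs))] @ drop (r + s) xs))
       {(r, s). 1 \<le> s \<and> r + s \<le> length xs}"

definition a_infinity_algebra :: "('k::field, 'a, 'm) graded_scheme \<Rightarrow> ('a list \<Rightarrow> 'a) \<Rightarrow> bool" where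
  "a_infinity_algebra V m \<longleftrightarrow>
     graded_space V \<and> multilinear V V 2 m \<and>
     (\<forall>xs ds. xs \<noteq> [] \<and> has_degrees V xs ds \<longrightarrow> insertions V m m xs ds = \<zero>\<^bsub>V\<^esub>)"

definition compositions :: "nat \<Rightarrow> nat list set" where
  "compositions n = {is. sum_list is = n \<and> (\<forall>i\<in>set is. 1 \<le> i)}"

fun blocks :: "nat list \<Rightarrow> 'a list \<Rightarrow> 'a list list" where
  "blocks [] xs = []"
| "blocks (i # is) xs = take i xs # blocks is (drop i xs)"

text \<open>For \<open>is = [i\<^sub>1, \<dots>, i\<^sub>q]\<close>, the first sum below is
  \<open>(q - 1) (i\<^sub>1 - 1) + (q - 2) (i\<^sub>2 - 1) + \<dots> + (i\<^sub>q\<^sub>-\<^sub>1 - 1)\<close>, the usual sign in the definition of a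
  morphism. The second sum is the Koszul sign of applying
  \<open>f\<^sub>i\<^sub>1 \<otimes> \<dots> \<otimes> f\<^sub>i\<^sub>q\<close>, with \<open>f\<^sub>i\<close> of degree \<open>1 - i\<close>, to arguments of degrees \<open>ds\<close>.\<close>

definition block_sign :: "nat list \<Rightarrow> int list \<Rightarrow> int" where
  "block_sign is ds =
     (\<Sum>j<length is. int (length is - 1 - j) * (int (is ! j) - 1)) +
     (\<Sum>j<length is. (1 - int (is ! j)) * sum_list (take (sum_list (take j is)) ds))"

definition a_infinity_morphism ::
  "('k::field, 'a, 'm) graded_scheme \<Rightarrow> ('a list \<Rightarrow> 'a) \<Rightarrow>
   ('k, 'b, 'n) graded_scheme \<Rightarrow> ('b list \<Rightarrow> 'b) \<Rightarrow> ('a list \<Rightarrow> 'b) \<Rightarrow> bool" where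
  "a_infinity_morphism V m W m' f \<longleftrightarrow>
     a_infinity_algebra V m \<and> a_infinity_algebra W m' \<and> multilinear V W 1 f \<and>
     (\<forall>xs ds. xs \<noteq> [] \<and> has_degrees V xs ds \<longrightarrow>
        insertions W m f xs ds =
        (\<Oplus>\<^bsub>W\<^esub>is\<in>compositions (length xs).
           (-1) powi block_sign is ds \<odot>\<^bsub>W\<^esub> m' (map f (blocks is xs))))"

definition a_infinity_quasi_iso ::
  "('k::field, 'a, 'm) graded_scheme \<Rightarrow> ('a list \<Rightarrow> 'a) \<Rightarrow>
   ('k, 'b, 'n) graded_scheme \<Rightarrow> ('b list \<Rightarrow> 'b) \<Rightarrow> ('a list \<Rightarrow> 'b) \<Rightarrow> bool" where
  "a_infinity_quasi_iso V m W m' f \<longleftrightarrow>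
     a_infinity_morphism V m W m' f \<and>
     induces_coh_iso V (\<lambda>x. m [x]) W (\<lambda>y. m' [y]) (\<lambda>x. f [x])"

fun dga_ops :: "('k, 'a) dg_alg \<Rightarrow> 'a list \<Rightarrow> 'a" where
  "dga_ops A [x] = dif A x"
| "dga_ops A [x, y] = x \<otimes>\<^bsub>A\<^esub> y"
| "dga_ops A _ = \<zero>\<^bsub>A\<^esub>"

definition minimal_model :: "('k::field, 'a) dg_alg \<Rightarrow> ('a set list \<Rightarrow> 'a set) \<Rightarrow> bool" where
  "minimal_model A m \<longleftrightarrow>
     a_infinity_algebra (cohomology A) m \<and>
     (\<forall>X\<in>carrier (cohomology A). m [X] = \<zero>\<^bsub>cohomology A\<^esub>) \<and>
     (\<forall>X\<in>carrier (cohomology A). \<forall>Y\<in>carrier (cohomology A). m [X, Y] = X \<otimes>\<^bsub>cohomology A\<^esub> Y) \<and>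
     (\<exists>f. a_infinity_quasi_iso (cohomology A) m A (dga_ops A) f)"


section \<open>Path algebras\<close>

text \<open>A path is given by its starting vertex and its list of arrows, read from left to right;
  \<open>(v, [])\<close> is the trivial path at \<open>v\<close>. Elements of the path algebra are finitely supported
  functions on paths.\<close>

type_synonym ('v, 'e, 'k) path_elem = "('v \<times> 'e list) \<Rightarrow>\<^sub>0 'k"

definition quiver_paths :: "('v, 'e) pre_digraph \<Rightarrow> ('v \<times> 'e list) set" where
  "quiver_paths Q = {(u, p). \<exists>v. pre_digraph.awalk Q u p v}"

definition path_mult ::
  "('v, 'e) pre_digraph \<Rightarrow> ('v, 'e, 'k::field) path_elem \<Rightarrow> ('v, 'e, 'k) path_elem \<Rightarrow> ('v, 'e, 'k) path_elem" where
  "path_mult Q f g =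
     (\<Sum>(u, p)\<in>Poly_Mapping.keys f. \<Sum>(v, q)\<in>Poly_Mapping.keys g.
        if pre_digraph.awlast Q u p = v
        then Poly_Mapping.single (u, p @ q) (Poly_Mapping.lookup f (u, p) * Poly_Mapping.lookup g (v, q)) else 0)"

definition path_scale :: "'k::field \<Rightarrow> ('v, 'e, 'k) path_elem \<Rightarrow> ('v, 'e, 'k) path_elem" where
  "path_scale c = Poly_Mapping.map ((*) c)"

text \<open>The path given by a nonempty list of arrows, as an element of the path algebra.\<close>

definition path_of :: "('v, 'e) pre_digraph \<Rightarrow> 'e list \<Rightarrow> ('v, 'e, 'k::field) path_elem" where
  "path_of Q p = Poly_Mapping.single (tail Q (hd p), p) 1"

text \<open>The differential of a path, given the differentials \<open>\<delta>\<close> of the arrows and extended by the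
  Leibniz rule.\<close>

fun path_dif ::
  "('v, 'e) pre_digraph \<Rightarrow> ('e \<Rightarrow> int) \<Rightarrow> ('e \<Rightarrow> ('v, 'e, 'k::field) path_elem) \<Rightarrow> 'e list \<Rightarrow> ('v, 'e, 'k) path_elem" where
  "path_dif Q deg \<delta> [] = 0"
| "path_dif Q deg \<delta> (a # p) =
     path_mult Q (\<delta> a) (Poly_Mapping.single (head Q a, p) 1) +
     path_scale ((-1) powi deg a) (path_mult Q (path_of Q [a]) (path_dif Q deg \<delta> p))"

definition path_dga ::
  "('v, 'e) pre_digraph \<Rightarrow> ('e \<Rightarrow> int) \<Rightarrow> ('e \<Rightarrow> ('v, 'e, 'k::field) path_elem) \<Rightarrow>
   ('k, ('v, 'e, 'k) path_elem) dg_alg" where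
  "path_dga Q deg \<delta> = \<lparr>
     carrier = {f. Poly_Mapping.keys f \<subseteq> quiver_paths Q},
     monoid.mult = path_mult Q,
     one = (\<Sum>v\<in>verts Q. Poly_Mapping.single (v, []) 1),
     zero = 0,
     add = (+),
     module.smult = path_scale,
     homog = (\<lambda>n. {f. Poly_Mapping.keys f \<subseteq> quiver_paths Q \<and> (\<forall>(u, p)\<in>Poly_Mapping.keys f. sum_list (map deg p) = n)}),
     dif = (\<lambda>f. \<Sum>(u, p)\<in>Poly_Mapping.keys f. path_scale (Poly_Mapping.lookup f (u, p)) (path_dif Q deg \<delta> p))\<rparr>"


section \<open>The symmetric square of an annulus with stops\<close>

text \<open>The arrows \<open>x\<^sub>i\<^sub>,\<^sub>j\<close>, \<open>y\<^sub>i\<^sub>,\<^sub>j\<close>, \<open>u\<^sub>1\<^sub>,\<^sub>i\<close> and \<open>z\<^sub>i\<^sub>,\<^sub>i\<^sub>+\<^sub>1\<close> are \<open>X i j\<close>, \<open>Y i j\<close>, \<open>U i\<close> and \<open>Z i\<close>.\<close>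

datatype arrow = X nat nat | Y nat nat | U nat | Z nat

text \<open>The vertex \<open>L\<^sub>a\<^sub>,\<^sub>b = L\<^sub>b\<^sub>,\<^sub>a\<close>.\<close>

definition vertex :: "nat \<Rightarrow> nat \<Rightarrow> nat \<times> nat" where
  "vertex a b = (min a b, max a b)"

fun arrow_source :: "arrow \<Rightarrow> nat \<times> nat" where
  "arrow_source (X i j) = vertex i j"
| "arrow_source (Y i j) = vertex i j"
| "arrow_source (U i) = vertex 1 i"
| "arrow_source (Z i) = vertex i (i + 1)"

fun arrow_target :: "nat \<Rightarrow> arrow \<Rightarrow> nat \<times> nat" where
  "arrow_target n\<^sub>1 (X i j) = vertex i (j + 1)"
| "arrow_target n\<^sub>1 (Y i j) = vertex (i + 1) j"
| "arrow_target n\<^sub>1 (U i) = vertex i (n\<^sub>1 + 1)"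
| "arrow_target n\<^sub>1 (Z i) = vertex (i + 1) (i + 2)"

definition sym_quiver :: "nat \<Rightarrow> nat \<Rightarrow> (nat \<times> nat, arrow) pre_digraph" where
  "sym_quiver n\<^sub>1 n\<^sub>2 = (let N = n\<^sub>1 + n\<^sub>2 in \<lparr>
     verts = {vertex i j | i j. 1 \<le> i \<and> i < j \<and> j \<le> N},
     arcs = {X i j | i j. 1 \<le> i \<and> i < j \<and> j + 1 \<le> N}
          \<union> {Y i j | i j. 1 \<le> i \<and> i + 2 \<le> N \<and> i + 2 \<le> j \<and> j \<le> N}
          \<union> {U i | i. 2 \<le> i \<and> i \<le> N \<and> i \<noteq> n\<^sub>1 + 1}
          \<union> {Z i | i. 1 \<le> i \<and> i + 2 \<le> N},
     tail = arrow_source,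
     head = arrow_target n\<^sub>1\<rparr>)"

text \<open>The pairs \<open>(p, q)\<close> stand for relations \<open>p = q\<close>, the lists in \<^term>\<open>zero_relations\<close> for
  relations \<open>p = 0\<close>. Both sets are restricted to the arrows of the quiver in \<^term>\<open>sym_relations\<close>.\<close>

definition equality_relations :: "nat \<Rightarrow> nat \<Rightarrow> (arrow list \<times> arrow list) set" where
  "equality_relations n\<^sub>1 n\<^sub>2 = (let N = n\<^sub>1 + n\<^sub>2 in
     {([X i j, Y i (j + 1)], [Y i j, X (i + 1) j]) | i j. 1 \<le> i \<and> i + 1 < j \<and> j + 1 \<le> N}
   \<union> {([U i, X (n\<^sub>1 + 1) i], [X 1 i, U (i + 1)]) | i. n\<^sub>1 + 2 \<le> i \<and> i + 1 \<le> N}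
   \<union> {([U i, Y i (n\<^sub>1 + 1)], [X 1 i, U (i + 1)]) | i. 1 < i \<and> i < n\<^sub>1}
   \<union> {([U n\<^sub>1, Z n\<^sub>1], [X 1 n\<^sub>1, X 1 (n\<^sub>1 + 1), U (n\<^sub>1 + 2)])}
   \<union> {([Z i, X (i + 1) (i + 2), Y (i + 1) (i + 3)], [X i (i + 1), Y i (i + 2), Z (i + 1)])
        | i. 1 \<le> i \<and> i + 3 \<le> N})"

definition zero_relations :: "nat \<Rightarrow> nat \<Rightarrow> arrow list set" where
  "zero_relations n\<^sub>1 n\<^sub>2 = (let N = n\<^sub>1 + n\<^sub>2 in
     {[U i, X i (n\<^sub>1 + 1)] | i. 1 < i \<and> i \<le> n\<^sub>1}
   \<union> {[U (n\<^sub>1 + i), Y (n\<^sub>1 + 1) (n\<^sub>1 + i)] | i. 3 \<le> i \<and> i \<le> n\<^sub>2}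
   \<union> {[U (n\<^sub>1 + 2), Z (n\<^sub>1 + 1)]}
   \<union> {[Z i, Z (i + 1)] | i. 1 \<le> i \<and> i + 3 \<le> N})"

type_synonym 'k sym_elem = "(nat \<times> nat, arrow, 'k) path_elem"

definition sym_relations :: "nat \<Rightarrow> nat \<Rightarrow> 'k::field sym_elem set" where
  "sym_relations n\<^sub>1 n\<^sub>2 = (let Q = sym_quiver n\<^sub>1 n\<^sub>2 in
     {path_of Q p - path_of Q q | p q.
        (p, q) \<in> equality_relations n\<^sub>1 n\<^sub>2 \<and> set p \<union> set q \<subseteq> arcs Q}
   \<union> {path_of Q p | p. p \<in> zero_relations n\<^sub>1 n\<^sub>2 \<and> set p \<subseteq> arcs Q})"

fun arrow_dif :: "nat \<Rightarrow> nat \<Rightarrow> arrow \<Rightarrow> 'k::field sym_elem" where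
  "arrow_dif n\<^sub>1 n\<^sub>2 (Z i) = path_of (sym_quiver n\<^sub>1 n\<^sub>2) [X i (i + 1), Y i (i + 2)]"
| "arrow_dif n\<^sub>1 n\<^sub>2 _ = 0"

definition sym_path_dga :: "nat \<Rightarrow> nat \<Rightarrow> (arrow \<Rightarrow> int) \<Rightarrow> ('k::field, 'k sym_elem) dg_alg" where
  "sym_path_dga n\<^sub>1 n\<^sub>2 deg = path_dga (sym_quiver n\<^sub>1 n\<^sub>2) deg (arrow_dif n\<^sub>1 n\<^sub>2)"

definition sym_ideal :: "nat \<Rightarrow> nat \<Rightarrow> (arrow \<Rightarrow> int) \<Rightarrow> 'k::field sym_elem set" where
  "sym_ideal n\<^sub>1 n\<^sub>2 deg = Idl\<^bsub>sym_path_dga n\<^sub>1 n\<^sub>2 deg\<^esub> (sym_relations n\<^sub>1 n\<^sub>2)"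

text \<open>The gradings by arrow degrees for which the relations are homogeneous and the differential
  has degree 1 and descends to the quotient.\<close>

definition admissible_grading :: "'k::field itself \<Rightarrow> nat \<Rightarrow> nat \<Rightarrow> (arrow \<Rightarrow> int) \<Rightarrow> bool" where
  "admissible_grading K n\<^sub>1 n\<^sub>2 deg \<longleftrightarrow> (let P = (sym_path_dga n\<^sub>1 n\<^sub>2 deg :: ('k, 'k sym_elem) dg_alg) in
     (\<forall>\<rho>\<in>sym_relations n\<^sub>1 n\<^sub>2. \<exists>n. \<rho> \<in> homog P n) \<and>
     (\<forall>a\<in>arcs (sym_quiver n\<^sub>1 n\<^sub>2). arrow_dif n\<^sub>1 n\<^sub>2 a \<in> homog P (deg a + 1)) \<and>
     dif P ` sym_ideal n\<^sub>1 n\<^sub>2 deg \<subseteq> sym_ideal n\<^sub>1 n\<^sub>2 deg)"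

definition sym_dga :: "nat \<Rightarrow> nat \<Rightarrow> (arrow \<Rightarrow> int) \<Rightarrow> ('k::field, 'k sym_elem set) dg_alg" where
  "sym_dga n\<^sub>1 n\<^sub>2 deg = quot_dga (sym_path_dga n\<^sub>1 n\<^sub>2 deg) (sym_ideal n\<^sub>1 n\<^sub>2 deg)"

end

theory Submission
  imports Defs
begin

text \<open>
  The proof rests on a basis of the algebra by strand diagrams. A vertex \<open>(i, j)\<close> is a pair of
  positions, and a diagram moves two strands from \<open>(i, j)\<close> to \<open>(k, l)\<close> in one of three ways:
  without crossing (\<open>i\<close> to \<open>k\<close>, \<open>j\<close> to \<open>l\<close>), with one crossing (\<open>i\<close> to \<open>l\<close>, \<open>j\<close> to \<open>k\<close>, which
  requires \<open>j \<le> k\<close>), or with one strand taking the arrow \<open>\<beta>\<close> from \<open>1\<close> to \<open>n1 + 1\<close> while the other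
  advances to some position. The product is stacking, where double crossings and the composites
  \<open>\<beta>\<alpha>\<close> are zero, and the differential resolves a crossing. Evaluating paths as diagrams kills the
  relations, and conversely the relations rewrite every path to a normal form of its diagram
  (\<open>path_class_eval\<close>); hence the coordinate map \<open>coords\<close> identifies the dg algebra with the span
  of the diagrams.

  On the basis there is an evident contraction \<open>h\<close>, which crosses the strands of an uncrossed
  diagram whenever this is possible. The identities \<open>h d h = h\<close>, \<open>d h d = d\<close> and \<open>h h = 0\<close> make
  \<open>\<pi> = 1 - d h - h d\<close> a projection onto representatives of the cohomology. Moreover, the image of
  \<open>h\<close> is spanned by the crossed diagrams; it is a right ideal on which \<open>h d\<close> is the identity, it
  has square zero, and a product \<open>x (h y)\<close> involves no uncrossed diagram, so that
  \<open>h (x (h y)) = 0\<close>. With these identities the tree formula for the transferred \<open>A\<^sub>\<infinity>\<close>-structure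
  stops after three leaves: up to sign, \<open>m\<^sub>3 (x, y, z)\<close> is \<open>\<pi> (x (h (y z)))\<close>, the
  quasi-isomorphism consists of the inclusion of the representatives and \<open>f\<^sub>2 (x, y) = - h (x y)\<close>,
  and all other operations and components vanish (\<open>minimal_model_transferred\<close>).

  If \<open>n1 = 1\<close>, no diagram with a \<open>\<beta>\<close>-strand can be followed by a crossing that keeps this strand
  in place, so the image of \<open>h\<close> is a two-sided ideal. Then \<open>\<pi>\<close> induces a multiplicative projection
  to cohomology, which is a quasi-isomorphism (\<open>formal_if_two_sided\<close>).

  If \<open>n1 > 1\<close>, put \<open>i = n1\<close> and consider the arrows \<open>u = u\<^sub>1\<^sub>,\<^sub>i\<close>, \<open>x = x\<^sub>i\<^sub>,\<^sub>i\<^sub>+\<^sub>1\<close>,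
  \<open>y = y\<^sub>i\<^sub>,\<^sub>i\<^sub>+\<^sub>2\<close> and \<open>z = z\<^sub>i\<^sub>,\<^sub>i\<^sub>+\<^sub>1\<close>. Here \<open>u x = 0\<close> and \<open>x y = d z\<close>, so \<open>u z\<close> represents, up
  to sign, the Massey product of \<open>u\<close>, \<open>x\<close>, \<open>y\<close>. The diagram of \<open>u z\<close> occurs neither in a product
  of \<open>u\<close> with a cocycle, nor in a right multiple of \<open>y\<close>, nor in a coboundary; hence this Massey
  product does not contain zero (\<open>nonzero_massey_product\<close>). Vanishing of all triple Massey
  products is reflected and preserved by quasi-isomorphisms and holds for zero differential, so it
  holds for every formal dg algebra (\<open>formal_massey_vanishing\<close>), whatever type the intermediate
  algebras of the zig-zag live in.
\<close>

section \<open>Vector spaces and finite sums\<close>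

lemma field_ring_simps [simp]:
  "carrier field_ring = UNIV" "monoid.mult field_ring = (*)" "one field_ring = 1"
  "zero field_ring = 0" "add field_ring = (+)"
  by (simp_all add: field_ring_def)

lemma field_ring_cring: "cring (field_ring :: 'k::field ring)"
proof (rule cringI)
  show "abelian_group (field_ring :: 'k ring)"
    by (rule abelian_groupI) (auto simp: algebra_simps intro: exI[of _ "- _"])
  show "comm_monoid (field_ring :: 'k ring)"
    by (rule comm_monoidI) (auto simp: algebra_simps)
qed (auto simp: algebra_simps)

lemma field_ring_moduleI:
  fixes V :: "('k::field, 'a, 'm) module_scheme" (structure)
  assumes "abelian_group V"
    and "\<And>c x. x \<in> carrier V \<Longrightarrow> c \<odot> x \<in> carrier V"
    and "\<And>b c x. x \<in> carrier V \<Longrightarrow> (b + c) \<odot> x = b \<odot> x \<oplus> c \<odot> x"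
    and "\<And>c x y. x \<in> carrier V \<Longrightarrow> y \<in> carrier V \<Longrightarrow> c \<odot> (x \<oplus> y) = c \<odot> x \<oplus> c \<odot> y"
    and "\<And>b c x. x \<in> carrier V \<Longrightarrow> (b * c) \<odot> x = b \<odot> (c \<odot> x)"
    and "\<And>x. x \<in> carrier V \<Longrightarrow> 1 \<odot> x = x"
  shows "Module.module field_ring V"
  using assms field_ring_cring by (intro moduleI) auto

lemma (in abelian_group) finsum_mono_neutral:
  assumes "finite F" "S \<subseteq> F" "\<And>n. n \<in> F \<Longrightarrow> f n \<in> carrier G" "\<And>n. n \<in> F - S \<Longrightarrow> f n = \<zero>"
  shows "(\<Oplus>n\<in>F. f n) = (\<Oplus>n\<in>S. f n)"
proof -
  have fin: "finite S" "finite (F - S)" using assms finite_subset by auto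
  have "(\<Oplus>n\<in>F. f n) = (\<Oplus>n\<in>S \<union> (F - S). f n)"
    using assms(2) by (simp add: Un_absorb1)
  also have "\<dots> = (\<Oplus>n\<in>S. f n) \<oplus> (\<Oplus>n\<in>F - S. f n)"
    using fin assms by (intro finsum_Un_disjoint) auto
  also have "(\<Oplus>n\<in>F - S. f n) = (\<Oplus>n\<in>F - S. \<zero>)"
    using assms(4) by (intro finsum_cong') auto
  also have "\<dots> = \<zero>" by (rule finsum_zero)
  finally have eq: "(\<Oplus>n\<in>F. f n) = (\<Oplus>n\<in>S. f n) \<oplus> \<zero>" .
  moreover have "(\<Oplus>n\<in>S. f n) \<in> carrier G" using assms by (intro finsum_closed) auto
  ultimately show ?thesis by simp
qed

lemma (in abelian_group) finsum_additive:
  assumes "abelian_group H" "finite F" "\<And>n. n \<in> F \<Longrightarrow> f n \<in> carrier G"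
    and "\<And>x. x \<in> carrier G \<Longrightarrow> p x \<in> carrier H"
    and "\<And>x y. x \<in> carrier G \<Longrightarrow> y \<in> carrier G \<Longrightarrow> p (x \<oplus> y) = p x \<oplus>\<^bsub>H\<^esub> p y"
  shows "p (\<Oplus>n\<in>F. f n) = (\<Oplus>\<^bsub>H\<^esub>n\<in>F. p (f n))"
  using assms(2,3)
proof (induction F rule: finite_induct)
  case empty
  interpret H: abelian_group H by fact
  have "p \<zero> \<oplus>\<^bsub>H\<^esub> p \<zero> = p \<zero>" using assms(5)[of \<zero> \<zero>] by simp
  then show ?case using assms(4)[of \<zero>] by (simp add: H.add.r_cancel_one')
next
  case (insert a F)
  interpret H: abelian_group H by fact
  show ?case using insert assms(4,5)
    by (subst finsum_insert; (subst H.finsum_insert)?) (auto intro!: finsum_closed)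
qed

section \<open>Graded vector spaces\<close>

context graded_space
begin

sublocale abelian_group V
  using module by (simp add: Module.module_def)

lemma smult_closed [simp, intro]: "x \<in> carrier V \<Longrightarrow> c \<odot> x \<in> carrier V"
  and smult_add_left: "x \<in> carrier V \<Longrightarrow> (b + c) \<odot> x = b \<odot> x \<oplus> c \<odot> x"
  and smult_add_right: "x \<in> carrier V \<Longrightarrow> y \<in> carrier V \<Longrightarrow> c \<odot> (x \<oplus> y) = c \<odot> x \<oplus> c \<odot> y"
  and smult_smult [simp]: "x \<in> carrier V \<Longrightarrow> b \<odot> (c \<odot> x) = (b * c) \<odot> x"
  and smult_one [simp]: "x \<in> carrier V \<Longrightarrow> 1 \<odot> x = x"
  using Module.module.smult_closed[OF module] Module.module.smult_l_distr[OF module]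
    Module.module.smult_r_distr[OF module] Module.module.smult_assoc1[OF module]
    Module.module.smult_one[OF module] by simp_all

lemma smult_zero_left [simp]: "x \<in> carrier V \<Longrightarrow> 0 \<odot> x = \<zero>"
  and smult_zero_right [simp]: "c \<odot> \<zero> = \<zero>"
  using Module.module.smult_l_null[OF module] Module.module.smult_r_null[OF module] by simp_all

lemma smult_minus_one: "x \<in> carrier V \<Longrightarrow> (- 1) \<odot> x = \<ominus> x"
  by (metis add.inv_equality add.left_inverse smult_add_left smult_closed smult_one smult_zero_left)

lemma smult_minus_right: "x \<in> carrier V \<Longrightarrow> c \<odot> (\<ominus> x) = \<ominus> (c \<odot> x)"
  using smult_minus_one[of x] smult_minus_one[of "c \<odot> x"] by (metis mult.commute smult_closed smult_smult)

lemma homog_carrier [simp]: "x \<in> homog V n \<Longrightarrow> x \<in> carrier V"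
  using Module.module.submoduleE(1)[OF module homog_submodule] by blast

lemma homog_add [intro]: "x \<in> homog V n \<Longrightarrow> y \<in> homog V n \<Longrightarrow> x \<oplus> y \<in> homog V n"
  by (rule Module.module.submoduleE(5)[OF module homog_submodule])

lemma homog_smult [intro]: "x \<in> homog V n \<Longrightarrow> c \<odot> x \<in> homog V n"
  using Module.module.submoduleE(4)[OF module homog_submodule] by simp

lemma homog_zero [simp, intro]: "\<zero> \<in> homog V n"
  using Module.module.submoduleE(2)[OF module homog_submodule, of n] homog_smult[of _ n 0]
  by (metis all_not_in_conv homog_carrier smult_zero_left)

lemma homog_minus [intro]: "x \<in> homog V n \<Longrightarrow> \<ominus> x \<in> homog V n"
  using homog_smult[of x n "-1"] by (simp add: smult_minus_one)

definition component :: "'a \<Rightarrow> int \<Rightarrow> 'a" where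
  "component x = (THE h. (\<forall>n. h n \<in> homog V n) \<and> finite {n. h n \<noteq> \<zero>} \<and>
        x = (\<Oplus>n\<in>{n. h n \<noteq> \<zero>}. h n))"

lemma component:
  assumes "x \<in> carrier V"
  shows component_homog: "component x n \<in> homog V n"
    and finite_component: "finite {n. component x n \<noteq> \<zero>}"
    and component_sum: "x = (\<Oplus>n\<in>{n. component x n \<noteq> \<zero>}. component x n)"
  using theI'[OF decomposition[OF assms]] unfolding component_def[symmetric] by blast+

lemma component_closed [simp]: "x \<in> carrier V \<Longrightarrow> component x n \<in> carrier V"
  using component_homog homog_carrier by blast

lemma component_unique:
  assumes "\<And>n. h n \<in> homog V n" "finite F" "\<And>n. n \<notin> F \<Longrightarrow> h n = \<zero>" "x = (\<Oplus>n\<in>F. h n)"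
  shows "component x = h"
proof -
  have x: "x \<in> carrier V"
    unfolding assms(4) by (intro finsum_closed Pi_I) (rule homog_carrier[OF assms(1)])
  have sub: "{n. h n \<noteq> \<zero>} \<subseteq> F" using assms(3) by auto
  then have fin: "finite {n. h n \<noteq> \<zero>}" using assms(2) finite_subset by auto
  have "x = (\<Oplus>n\<in>{n. h n \<noteq> \<zero>}. h n)"
    unfolding assms(4) using sub assms
    by (intro finsum_mono_neutral) (auto intro!: homog_carrier)
  then show ?thesis
    unfolding component_def using assms(1) fin by (intro the1_equality[OF decomposition[OF x]]) auto
qed

lemma component_sum':
  assumes "x \<in> carrier V" "finite F" "{n. component x n \<noteq> \<zero>} \<subseteq> F"
  shows "x = (\<Oplus>n\<in>F. component x n)"
proof -
  have "(\<Oplus>n\<in>F. component x n) = (\<Oplus>n\<in>{n. component x n \<noteq> \<zero>}. component x n)"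
    using assms by (intro finsum_mono_neutral) auto
  then show ?thesis using component_sum[OF assms(1)] by (rule trans[OF _ sym, rotated])
qed

lemma component_add:
  assumes "x \<in> carrier V" "y \<in> carrier V"
  shows "component (x \<oplus> y) n = component x n \<oplus> component y n"
proof -
  let ?F = "{n. component x n \<noteq> \<zero>} \<union> {n. component y n \<noteq> \<zero>}"
  have fin: "finite ?F" using assms finite_component by auto
  have "x \<oplus> y = (\<Oplus>n\<in>?F. component x n) \<oplus> (\<Oplus>n\<in>?F. component y n)"
    using component_sum'[OF assms(1) fin, symmetric] component_sum'[OF assms(2) fin, symmetric] by auto
  also have "\<dots> = (\<Oplus>n\<in>?F. component x n \<oplus> component y n)"
    using assms by (intro finsum_addf[symmetric]) auto
  finally have "component (x \<oplus> y) = (\<lambda>n. component x n \<oplus> component y n)"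
    by (intro component_unique[OF _ fin]) (auto intro: component_homog assms)
  then show ?thesis by simp
qed

lemma component_of_homog:
  assumes "x \<in> homog V n"
  shows "component x m = (if m = n then x else \<zero>)"
proof -
  have "component x = (\<lambda>m. if m = n then x else \<zero>)"
    by (rule component_unique[of _ "{n}"]) (use assms in \<open>auto\<close>)
  then show ?thesis by simp
qed

lemma homog_induct [consumes 1, case_names zero homog add]:
  assumes "x \<in> carrier V" and "P \<zero>" and "\<And>n x. x \<in> homog V n \<Longrightarrow> P x"
    and "\<And>x y. x \<in> carrier V \<Longrightarrow> y \<in> carrier V \<Longrightarrow> P x \<Longrightarrow> P y \<Longrightarrow> P (x \<oplus> y)"
  shows "P x"
proof -
  have "P (\<Oplus>n\<in>F. component x n)" if "finite F" for F
    using that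
  proof (induction F rule: finite_induct)
    case empty
    show ?case using assms(2) by simp
  next
    case (insert a F)
    show ?case
      using insert assms(1) assms(3)[OF component_homog[OF assms(1)]]
      by (subst finsum_insert) (auto intro!: assms(4) finsum_closed)
  qed
  from this[OF finite_component[OF assms(1)]] component_sum[OF assms(1)] show ?thesis by simp
qed

lemma component_smult:
  assumes "x \<in> carrier V"
  shows "component (c \<odot> x) n = c \<odot> component x n"
  using assms
  by (induction rule: homog_induct)
    (auto simp: component_add smult_add_right component_of_homog[OF homog_smult] component_of_homog[of \<zero> 0] component_of_homog)

text \<open>The grading involution, \<open>(-1)\<^sup>n\<close> in degree \<open>n\<close>. It carries the signs of the Leibniz rule
  (\<open>dif_mult\<close>), so that identities can be proved without decomposing their arguments into
  homogeneous parts.\<close>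

definition eps :: "'a \<Rightarrow> 'a" where
  "eps x = (\<Oplus>n\<in>{n. component x n \<noteq> \<zero>}. (-1) powi n \<odot> component x n)"

lemma eps_eq:
  assumes "x \<in> carrier V" "finite F" "{n. component x n \<noteq> \<zero>} \<subseteq> F"
  shows "eps x = (\<Oplus>n\<in>F. (-1) powi n \<odot> component x n)"
  unfolding eps_def using assms by (intro finsum_mono_neutral[symmetric]) auto

lemma eps_closed [simp, intro]: "x \<in> carrier V \<Longrightarrow> eps x \<in> carrier V"
  unfolding eps_def by (auto intro!: finsum_closed)

lemma eps_add:
  assumes "x \<in> carrier V" "y \<in> carrier V"
  shows "eps (x \<oplus> y) = eps x \<oplus> eps y"
proof -
  let ?F = "{n. component x n \<noteq> \<zero>} \<union> {n. component y n \<noteq> \<zero>}"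
  have fin: "finite ?F" using assms finite_component by auto
  have "eps (x \<oplus> y) = (\<Oplus>n\<in>?F. (-1) powi n \<odot> component (x \<oplus> y) n)"
    using assms fin by (intro eps_eq) (auto simp: component_add)
  also have "\<dots> = (\<Oplus>n\<in>?F. (-1) powi n \<odot> component x n \<oplus> (-1) powi n \<odot> component y n)"
    using assms by (intro finsum_cong') (auto simp: component_add smult_add_right)
  also have "\<dots> = eps x \<oplus> eps y"
    using assms by (subst finsum_addf) (auto simp: eps_eq[OF _ fin])
  finally show ?thesis .
qed

lemma eps_of_homog:
  assumes "x \<in> homog V n"
  shows "eps x = (-1) powi n \<odot> x"
proof -
  have "eps x = (\<Oplus>m\<in>{n}. (-1) powi m \<odot> component x m)"
    using assms by (intro eps_eq) (auto simp: component_of_homog)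
  then show ?thesis using assms by (simp add: component_of_homog)
qed

lemma eps_zero [simp]: "eps \<zero> = \<zero>"
  using eps_of_homog[of \<zero> 0] by simp

lemma eps_smult:
  assumes "x \<in> carrier V"
  shows "eps (c \<odot> x) = c \<odot> eps x"
  using assms
  by (induction rule: homog_induct)
    (auto simp: eps_add smult_add_right eps_of_homog[OF homog_smult] eps_of_homog mult.commute)

lemma eps_homog: "x \<in> homog V n \<Longrightarrow> eps x \<in> homog V n"
  by (auto simp: eps_of_homog)

lemma eps_eps [simp]:
  assumes "x \<in> carrier V"
  shows "eps (eps x) = x"
  using assms
  by (induction rule: homog_induct) (auto simp: eps_add eps_of_homog eps_smult)

lemma eps_minus: "x \<in> carrier V \<Longrightarrow> eps (\<ominus> x) = \<ominus> (eps x)"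
  using eps_smult[of x "-1"] by (simp add: smult_minus_one)

end

text \<open>A family of additive projections onto the homogeneous parts makes the decomposition
  unique: applied to any decomposition, the projections return its summands.\<close>

lemma graded_spaceI:
  fixes V :: "('k::field, 'a, 'm) graded_scheme" (structure) and pr :: "int \<Rightarrow> 'a \<Rightarrow> 'a"
  assumes module: "Module.module field_ring V"
    and sub: "\<And>n. submodule (homog V n) field_ring V"
    and pr_homog: "\<And>n x. x \<in> carrier V \<Longrightarrow> pr n x \<in> homog V n"
    and pr_add: "\<And>n x y. x \<in> carrier V \<Longrightarrow> y \<in> carrier V \<Longrightarrow> pr n (x \<oplus> y) = pr n x \<oplus> pr n y"
    and pr_of_homog: "\<And>m n x. x \<in> homog V n \<Longrightarrow> pr m x = (if m = n then x else \<zero>)"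
    and pr_sum: "\<And>x. x \<in> carrier V \<Longrightarrow>
      \<exists>F. finite F \<and> (\<forall>n. n \<notin> F \<longrightarrow> pr n x = \<zero>) \<and> x = (\<Oplus>n\<in>F. pr n x)"
  shows "graded_space V"
proof (rule graded_space.intro[OF module sub])
  fix x assume x: "x \<in> carrier V"
  interpret abelian_group V using module by (simp add: Module.module_def)
  have sub_carrier: "homog V n \<subseteq> carrier V" for n
    by (rule Module.module.submoduleE(1)[OF module sub])
  obtain F where F: "finite F" "\<And>n. n \<notin> F \<Longrightarrow> pr n x = \<zero>" "x = (\<Oplus>n\<in>F. pr n x)"
    using pr_sum[OF x] by auto
  have prc: "pr n x \<in> carrier V" if "x \<in> carrier V" for n x using pr_homog[OF that] sub_carrier by auto
  have supp: "{n. pr n x \<noteq> \<zero>} \<subseteq> F" using F(2) by auto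
  show "\<exists>!h :: int \<Rightarrow> 'a. (\<forall>n. h n \<in> homog V n) \<and> finite {n. h n \<noteq> \<zero>} \<and>
        x = (\<Oplus>n\<in>{n. h n \<noteq> \<zero>}. h n)"
  proof (intro ex1I[of _ "\<lambda>n. pr n x"] conjI allI)
    show "pr n x \<in> homog V n" for n using x by (rule pr_homog)
    show "finite {n. pr n x \<noteq> \<zero>}" using supp F(1) finite_subset by auto
    show "x = (\<Oplus>n\<in>{n. pr n x \<noteq> \<zero>}. pr n x)"
      by (subst F(3)) (rule finsum_mono_neutral[OF F(1) supp]; use prc x in auto)
  next
    fix h assume h: "(\<forall>n. h n \<in> homog V n) \<and> finite {n. h n \<noteq> \<zero>} \<and> x = (\<Oplus>n\<in>{n. h n \<noteq> \<zero>}. h n)"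
    then have hc: "h n \<in> carrier V" for n using sub_carrier by blast
    have "pr m x = h m" for m
    proof -
      have "pr m x = (\<Oplus>n\<in>{n. h n \<noteq> \<zero>}. pr m (h n))"
        by (subst (1) conjunct2[OF conjunct2[OF h]], rule finsum_additive)
          (use h hc prc pr_add in \<open>auto intro: abelian_group_axioms\<close>)
      also have "\<dots> = (\<Oplus>n\<in>{n. h n \<noteq> \<zero>}. if m = n then h n else \<zero>)"
        using pr_of_homog h hc by (intro finsum_cong') auto
      also have "\<dots> = (\<Oplus>n\<in>insert m {n. h n \<noteq> \<zero>}. if m = n then h n else \<zero>)"
        using h hc by (intro finsum_mono_neutral[symmetric]) auto
      also have "\<dots> = (\<Oplus>n\<in>{m}. if m = n then h n else \<zero>)"
        using h hc by (intro finsum_mono_neutral) auto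
      also have "\<dots> = h m" using hc by simp
      finally show ?thesis .
    qed
    then show "h = (\<lambda>n. pr n x)" by auto
  qed
qed

section \<open>Differential graded algebras\<close>

context dg_algebra
begin

sublocale ring A by (rule ring)

lemma dif_closed [simp, intro]:
  assumes "x \<in> carrier A"
  shows "dif A x \<in> carrier A"
  using assms
proof (induction rule: homog_induct)
  case zero show ?case using dif_homog[of \<zero> 0] by auto
next
  case (homog n x) then show ?case using dif_homog[of x n] by auto
qed (auto simp: dif_add)

lemma dif_zero [simp]: "dif A \<zero> = \<zero>"
  using dif_smult[of \<zero> 0] by simp

lemma dif_minus: "x \<in> carrier A \<Longrightarrow> dif A (\<ominus> x) = \<ominus> (dif A x)"
  using dif_smult[of x "-1"] by (simp add: smult_minus_one)

lemma dif_minus_eq: "x \<in> carrier A \<Longrightarrow> y \<in> carrier A \<Longrightarrow> dif A (x \<ominus> y) = dif A x \<ominus> dif A y"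
  by (simp add: a_minus_def dif_add dif_minus)

lemma dif_mult:
  assumes "x \<in> carrier A" "y \<in> carrier A"
  shows "dif A (x \<otimes> y) = (dif A x \<otimes> y) \<oplus> (eps x \<otimes> dif A y)"
  using assms
proof (induction rule: homog_induct)
  case (homog n x)
  then show ?case by (simp add: leibniz eps_of_homog smult_mult_left)
next
  case (add x x')
  then show ?case by (simp add: l_distr dif_add eps_add a_ac)
qed auto

lemma eps_mult:
  assumes "x \<in> carrier A" "y \<in> carrier A"
  shows "eps (x \<otimes> y) = eps x \<otimes> eps y"
  using assms
proof (induction rule: homog_induct)
  case x: (homog n x)
  from x(2) show ?case
  proof (induction rule: homog_induct)
    case (homog m y)
    then show ?case using x
      by (simp add: eps_of_homog[OF mult_homog] eps_of_homog smult_mult_left smult_mult_right power_int_add mult.commute)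
  qed (use x in \<open>auto simp: eps_add r_distr\<close>)
qed (auto simp: eps_add l_distr)

lemma eps_dif:
  assumes "x \<in> carrier A"
  shows "eps (dif A x) = \<ominus> (dif A (eps x))"
  using assms
proof (induction rule: homog_induct)
  case (homog n x)
  have "(-1) powi (n + 1) = - ((-1) powi n :: 'k)" by (simp add: power_int_add)
  then show ?case using homog smult_minus_one[of "(-1) powi n \<odot> dif A x"]
    by (simp add: eps_of_homog[OF dif_homog] eps_of_homog dif_smult)
qed (auto simp: eps_add dif_add minus_add)

lemma dif_eps: "x \<in> carrier A \<Longrightarrow> dif A (eps x) = \<ominus> (eps (dif A x))"
  by (simp add: eps_dif)

lemma dif_one: "dif A \<one> = \<zero>"
proof -
  have "eps \<one> = \<one>" using one_homog by (simp add: eps_of_homog)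
  then have "dif A \<one> = dif A \<one> \<oplus> dif A \<one>" using dif_mult[of \<one> \<one>] by simp
  then show ?thesis by (simp add: add.r_cancel_one)
qed

lemma component_dif:
  assumes "x \<in> carrier A"
  shows "component (dif A x) n = dif A (component x (n - 1))"
  using assms
proof (induction rule: homog_induct)
  case (homog m x)
  then show ?case by (simp add: component_of_homog[OF dif_homog] component_of_homog)
qed (auto simp: component_add dif_add component_of_homog[of \<zero> 0])

end

section \<open>Quotients and cohomology of dg algebras\<close>

locale dg_ideal = dg_algebra A + ideal I A
  for A :: "('k::field, 'a) dg_alg" (structure) and I +
  assumes component_ideal: "x \<in> I \<Longrightarrow> component x n \<in> I"
    and dif_ideal: "x \<in> I \<Longrightarrow> dif A x \<in> I"
begin

lemma smult_ideal: "x \<in> I \<Longrightarrow> c \<odot> x \<in> I"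
  using I_l_closed[of x "c \<odot> \<one>"] a_Hcarr[of x] by (simp add: smult_mult_left)

lemma coset_eq_iff:
  assumes "x \<in> carrier A" "y \<in> carrier A"
  shows "I +> x = I +> y \<longleftrightarrow> x \<ominus> y \<in> I"
  by (metis a_rcos_module_minus a_rcos_self a_repr_independence' assms is_abelian_group ring_axioms)

text \<open>The operations of a quotient are unions over representatives; such a union is the common
  value on all representatives.\<close>

lemma coset_UN:
  assumes "x \<in> carrier A" and "\<And>y. y \<in> carrier A \<Longrightarrow> y \<ominus> x \<in> I \<Longrightarrow> f y = f x"
  shows "(\<Union>y\<in>I +> x. f y) = f x"
proof -
  have eq: "f y = f x" if "y \<in> I +> x" for y
    using that assms a_elemrcos_carrier[OF assms(1) that] a_rcos_module_minus[OF ring_axioms assms(1)] by auto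
  have "x \<in> I +> x" using assms(1) by (rule a_rcos_self)
  moreover have "(\<Union>y\<in>I +> x. f y) = (\<Union>y\<in>I +> x. f x)" using eq by (rule SUP_cong[OF refl])
  ultimately show ?thesis by (simp only: UN_constant) auto
qed

abbreviation quot :: "('k, 'a set) dg_alg" where
  "quot \<equiv> quot_dga A I"

lemma quot_carrier: "carrier quot = (\<lambda>x. I +> x) ` carrier A"
  by (auto simp: quot_dga_def FactRing_simps)

lemma quot_closed [simp, intro]: "x \<in> carrier A \<Longrightarrow> I +> x \<in> carrier quot"
  by (auto simp: quot_carrier)

lemma quotE:
  assumes "S \<in> carrier quot"
  obtains x where "x \<in> carrier A" "S = I +> x"
  using assms by (auto simp: quot_carrier)

lemma quot_zero: "\<zero>\<^bsub>quot\<^esub> = I +> \<zero>"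
  by (simp add: quot_dga_def FactRing_def a_rcos_const)

lemma quot_one: "\<one>\<^bsub>quot\<^esub> = I +> \<one>"
  by (simp add: quot_dga_def FactRing_def)

lemma quot_add:
  "x \<in> carrier A \<Longrightarrow> y \<in> carrier A \<Longrightarrow> (I +> x) \<oplus>\<^bsub>quot\<^esub> (I +> y) = I +> (x \<oplus> y)"
  by (simp add: quot_dga_def FactRing_def a_rcos_sum)

lemma quot_mult:
  "x \<in> carrier A \<Longrightarrow> y \<in> carrier A \<Longrightarrow> (I +> x) \<otimes>\<^bsub>quot\<^esub> (I +> y) = I +> (x \<otimes> y)"
  by (simp add: quot_dga_def FactRing_def rcoset_mult_add)

lemma quot_smult: "x \<in> carrier A \<Longrightarrow> c \<odot>\<^bsub>quot\<^esub> (I +> x) = I +> (c \<odot> x)"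
proof -
  assume x: "x \<in> carrier A"
  have "I +> (c \<odot> y) = I +> (c \<odot> x)" if "y \<in> carrier A" "y \<ominus> x \<in> I" for y
  proof -
    have "c \<odot> y \<ominus> c \<odot> x = c \<odot> (y \<ominus> x)"
      using x that by (simp add: a_minus_def smult_add_right smult_minus_right)
    then show ?thesis using x that smult_ideal[OF that(2)] by (simp add: coset_eq_iff)
  qed
  then show ?thesis using x by (simp add: quot_dga_def coset_UN)
qed

lemma quot_dif: "x \<in> carrier A \<Longrightarrow> dif quot (I +> x) = I +> dif A x"
proof -
  assume x: "x \<in> carrier A"
  have "I +> dif A y = I +> dif A x" if "y \<in> carrier A" "y \<ominus> x \<in> I" for y
    using x that dif_ideal[OF that(2)] by (simp add: coset_eq_iff dif_minus_eq)
  then show ?thesis using x by (simp add: quot_dga_def coset_UN)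
qed

lemma quot_homog: "homog quot n = (\<lambda>x. I +> x) ` homog A n"
  by (simp add: quot_dga_def)

lemma quot_ring: "ring quot"
proof (rule ringI)
  show "abelian_group quot"
  proof (rule abelian_groupI)
    show "\<exists>T\<in>carrier quot. T \<oplus>\<^bsub>quot\<^esub> S = \<zero>\<^bsub>quot\<^esub>" if S: "S \<in> carrier quot" for S
    proof -
      obtain x where x: "x \<in> carrier A" "S = I +> x" using S by (rule quotE)
      then show ?thesis by (intro bexI[of _ "I +> (\<ominus> x)"]) (auto simp: quot_add quot_zero l_neg)
    qed
  qed (auto elim!: quotE simp: quot_add quot_zero a_ac)
  show "Group.monoid quot"
    by (rule monoidI) (auto elim!: quotE simp: quot_mult quot_one m_assoc)
qed (auto elim!: quotE simp: quot_mult quot_add l_distr r_distr)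

lemma quot_finsum:
  assumes "finite F" "\<And>n. n \<in> F \<Longrightarrow> f n \<in> carrier A"
  shows "(\<Oplus>\<^bsub>quot\<^esub>n\<in>F. I +> f n) = I +> (\<Oplus>n\<in>F. f n)"
proof -
  interpret Q: ring quot by (rule quot_ring)
  show ?thesis
    by (rule finsum_additive[symmetric]) (use assms in \<open>auto simp: quot_add intro: Q.abelian_group_axioms\<close>)
qed

lemma quot_module: "Module.module field_ring quot"
proof (rule field_ring_moduleI)
  show "abelian_group quot" using quot_ring by (rule ring.is_abelian_group)
qed (auto elim!: quotE simp: quot_smult quot_add smult_add_left smult_add_right)

definition quot_component :: "int \<Rightarrow> 'a set \<Rightarrow> 'a set" where
  "quot_component n S = (\<Union>x\<in>S. I +> component x n)"

lemma quot_component: "x \<in> carrier A \<Longrightarrow> quot_component n (I +> x) = I +> component x n"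
proof -
  assume x: "x \<in> carrier A"
  have "I +> component y n = I +> component x n" if "y \<in> carrier A" "y \<ominus> x \<in> I" for y
  proof -
    have "component (y \<ominus> x) n = component y n \<ominus> component x n"
      using x that component_smult[of x "-1" n] by (simp add: a_minus_def component_add smult_minus_one)
    then show ?thesis using x that component_ideal[OF that(2), of n] by (simp add: coset_eq_iff)
  qed
  then show ?thesis using x by (simp add: quot_component_def coset_UN)
qed

lemma quot_graded_space: "graded_space quot"
proof (rule graded_spaceI[where pr = quot_component])
  interpret Q: ring quot by (rule quot_ring)
  show "Module.module field_ring quot" by (rule quot_module)
  show "submodule (homog quot n) field_ring quot" for n
  proof (rule Module.module.submoduleI[OF quot_module])
    have inv: "\<ominus>\<^bsub>quot\<^esub> (I +> x) = I +> (\<ominus> x)" if "x \<in> carrier A" for x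
      using that by (intro Q.minus_equality) (auto simp: quot_add quot_zero l_neg)
    show "\<And>a. a \<in> homog quot n \<Longrightarrow> \<ominus>\<^bsub>quot\<^esub> a \<in> homog quot n"
      by (auto simp: quot_homog inv)
  qed (auto simp: quot_homog quot_add quot_smult quot_zero)
  show "quot_component n S \<in> homog quot n" if "S \<in> carrier quot" for n S
    using that by (auto elim!: quotE simp: quot_component quot_homog component_homog)
  show "quot_component n (S \<oplus>\<^bsub>quot\<^esub> T) = quot_component n S \<oplus>\<^bsub>quot\<^esub> quot_component n T"
    if "S \<in> carrier quot" "T \<in> carrier quot" for n S T
    using that by (auto elim!: quotE simp: quot_component quot_add component_add)
  show "quot_component m S = (if m = n then S else \<zero>\<^bsub>quot\<^esub>)" if "S \<in> homog quot n" for m n S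
    using that by (auto simp: quot_homog quot_component quot_zero component_of_homog)
  show "\<exists>F. finite F \<and> (\<forall>n. n \<notin> F \<longrightarrow> quot_component n S = \<zero>\<^bsub>quot\<^esub>) \<and>
      S = (\<Oplus>\<^bsub>quot\<^esub>n\<in>F. quot_component n S)" if S: "S \<in> carrier quot" for S
  proof -
    obtain x where x: "x \<in> carrier A" "S = I +> x" using S by (rule quotE)
    have eq: "I +> x = (\<Oplus>\<^bsub>quot\<^esub>n\<in>{n. component x n \<noteq> \<zero>}. I +> component x n)"
      using x(1) component_sum[OF x(1), symmetric] finite_component[OF x(1)] by (subst quot_finsum) auto
    have qd: "quot_component n S = I +> component x n" for n using quot_component[OF x(1)] x(2) by simp
    show ?thesis
      unfolding qd unfolding x(2) using eq finite_component[OF x(1)]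
      by (intro exI[of _ "{n. component x n \<noteq> \<zero>}"] conjI) (simp_all add: quot_zero)
  qed
qed

theorem quot_dg_algebra: "dg_algebra quot"
proof (rule dg_algebra.intro[OF quot_graded_space dg_algebra_axioms.intro])
  show "ring quot" by (rule quot_ring)
  show "(c \<odot>\<^bsub>quot\<^esub> x) \<otimes>\<^bsub>quot\<^esub> y = c \<odot>\<^bsub>quot\<^esub> (x \<otimes>\<^bsub>quot\<^esub> y)"
    if "x \<in> carrier quot" "y \<in> carrier quot" for c x y
    using that by (auto elim!: quotE simp: quot_smult quot_mult smult_mult_left)
  show "x \<otimes>\<^bsub>quot\<^esub> (c \<odot>\<^bsub>quot\<^esub> y) = c \<odot>\<^bsub>quot\<^esub> (x \<otimes>\<^bsub>quot\<^esub> y)"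
    if "x \<in> carrier quot" "y \<in> carrier quot" for c x y
    using that by (auto elim!: quotE simp: quot_smult quot_mult smult_mult_right)
  show "\<one>\<^bsub>quot\<^esub> \<in> homog quot 0" using one_homog by (auto simp: quot_one quot_homog)
  show "x \<otimes>\<^bsub>quot\<^esub> y \<in> homog quot (m + n)" if "x \<in> homog quot m" "y \<in> homog quot n" for m n x y
    using that by (auto simp: quot_homog quot_mult mult_homog)
  show "dif quot (x \<oplus>\<^bsub>quot\<^esub> y) = dif quot x \<oplus>\<^bsub>quot\<^esub> dif quot y"
    if "x \<in> carrier quot" "y \<in> carrier quot" for x y
    using that by (auto elim!: quotE simp: quot_add quot_dif dif_add)
  show "dif quot (c \<odot>\<^bsub>quot\<^esub> x) = c \<odot>\<^bsub>quot\<^esub> dif quot x" if "x \<in> carrier quot" for c x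
    using that by (auto elim!: quotE simp: quot_smult quot_dif dif_smult)
  show "dif quot x \<in> homog quot (n + 1)" if "x \<in> homog quot n" for n x
    using that by (auto simp: quot_homog quot_dif dif_homog)
  show "dif quot (dif quot x) = \<zero>\<^bsub>quot\<^esub>" if "x \<in> carrier quot" for x
    using that by (auto elim!: quotE simp: quot_dif dif_dif quot_zero)
  show "dif quot (x \<otimes>\<^bsub>quot\<^esub> y) =
      (dif quot x \<otimes>\<^bsub>quot\<^esub> y) \<oplus>\<^bsub>quot\<^esub> ((-1) powi n \<odot>\<^bsub>quot\<^esub> (x \<otimes>\<^bsub>quot\<^esub> dif quot y))"
    if "x \<in> homog quot n" "y \<in> carrier quot" for n x y
    using that by (auto elim!: quotE simp: quot_homog quot_dif quot_mult quot_add quot_smult leibniz)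
qed

end

context dg_algebra
begin

text \<open>Cohomology is the quotient of the dg algebra of cocycles by the dg ideal of coboundaries,
  which reduces its properties to those of quotients.\<close>

definition cocycle_alg :: "('k, 'a) dg_alg" where
  "cocycle_alg = A\<lparr>carrier := cocycles A (dif A), homog := (\<lambda>n. homog A n \<inter> cocycles A (dif A))\<rparr>"

lemma cocycles_iff: "x \<in> cocycles A (dif A) \<longleftrightarrow> x \<in> carrier A \<and> dif A x = \<zero>"
  by (simp add: cocycles_def)

lemma cocycle_alg_simps [simp]:
  "carrier cocycle_alg = cocycles A (dif A)" "monoid.mult cocycle_alg = monoid.mult A"
  "one cocycle_alg = one A" "zero cocycle_alg = zero A" "add cocycle_alg = add A"
  "module.smult cocycle_alg = module.smult A" "dif cocycle_alg = dif A"
  "homog cocycle_alg n = homog A n \<inter> cocycles A (dif A)"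
  by (simp_all add: cocycle_alg_def)

lemma cocycle_ring: "ring cocycle_alg"
proof (rule ringI)
  show "abelian_group cocycle_alg"
  proof (rule abelian_groupI)
    show "\<exists>y\<in>carrier cocycle_alg. y \<oplus>\<^bsub>cocycle_alg\<^esub> x = \<zero>\<^bsub>cocycle_alg\<^esub>"
      if "x \<in> carrier cocycle_alg" for x
      using that by (intro bexI[of _ "\<ominus> x"]) (auto simp: cocycles_iff l_neg dif_minus)
  qed (auto simp: cocycles_iff dif_add a_ac)
  show "Group.monoid cocycle_alg"
    by (rule monoidI) (auto simp: cocycles_iff dif_mult dif_one m_assoc)
qed (auto simp: cocycles_iff l_distr r_distr)

lemma cocycle_finsum:
  assumes "finite F" "\<And>n. n \<in> F \<Longrightarrow> f n \<in> cocycles A (dif A)"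
  shows "(\<Oplus>\<^bsub>cocycle_alg\<^esub>n\<in>F. f n) = (\<Oplus>n\<in>F. f n)"
proof -
  interpret ZA: ring cocycle_alg by (rule cocycle_ring)
  show ?thesis using ZA.finsum_additive[where H = A and p = id and F = F and f = f] assms
    by (auto simp: cocycles_iff abelian_group_axioms)
qed

lemma component_cocycle: "x \<in> cocycles A (dif A) \<Longrightarrow> component x n \<in> cocycles A (dif A)"
  using component_dif[of x "n + 1"] by (auto simp: cocycles_iff component_of_homog[of \<zero> 0])

lemma cocycle_graded_space: "graded_space cocycle_alg"
proof (rule graded_spaceI[where pr = "\<lambda>n x. component x n"])
  interpret ZA: ring cocycle_alg by (rule cocycle_ring)
  show mod: "Module.module field_ring cocycle_alg"
    by (rule field_ring_moduleI)
      (auto simp: cocycles_iff dif_smult smult_add_left smult_add_right ZA.abelian_group_axioms)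
  show "submodule (homog cocycle_alg n) field_ring cocycle_alg" for n
  proof (rule Module.module.submoduleI[OF mod])
    have inv: "\<ominus>\<^bsub>cocycle_alg\<^esub> x = \<ominus> x" if "x \<in> cocycles A (dif A)" for x
      using that by (intro ZA.minus_equality) (auto simp: cocycles_iff l_neg dif_minus)
    show "\<And>a. a \<in> homog cocycle_alg n \<Longrightarrow> \<ominus>\<^bsub>cocycle_alg\<^esub> a \<in> homog cocycle_alg n"
      by (auto simp: inv) (auto simp: cocycles_iff dif_minus)
  qed (auto simp: cocycles_iff dif_add dif_smult)
  show "\<exists>F. finite F \<and> (\<forall>n. n \<notin> F \<longrightarrow> component x n = \<zero>\<^bsub>cocycle_alg\<^esub>) \<and>
      x = (\<Oplus>\<^bsub>cocycle_alg\<^esub>n\<in>F. component x n)" if "x \<in> carrier cocycle_alg" for x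
  proof -
    have x: "x \<in> carrier A" "x \<in> cocycles A (dif A)" using that by (auto simp: cocycles_iff)
    have "x = (\<Oplus>\<^bsub>cocycle_alg\<^esub>n\<in>{n. component x n \<noteq> \<zero>}. component x n)"
      using x by (subst cocycle_finsum) (auto simp: component_cocycle finite_component component_sum[symmetric])
    then show ?thesis using finite_component[OF x(1)]
      by (intro exI[of _ "{n. component x n \<noteq> \<zero>}"] conjI) simp_all
  qed
qed (auto simp: cocycles_iff component_add component_homog component_of_homog component_cocycle[unfolded cocycles_iff])

lemma cocycle_dg_algebra: "dg_algebra cocycle_alg"
  by (rule dg_algebra.intro[OF cocycle_graded_space dg_algebra_axioms.intro[OF cocycle_ring]])
    (auto simp: cocycles_iff smult_mult_left smult_mult_right one_homog mult_homog dif_one dif_mult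
      dif_add dif_smult dif_homog l_distr)

lemma coboundaries_iff: "x \<in> coboundaries A (dif A) \<longleftrightarrow> (\<exists>y\<in>carrier A. x = dif A y)"
  by (auto simp: coboundaries_def)

lemma coboundaries_sub: "coboundaries A (dif A) \<subseteq> cocycles A (dif A)"
  by (auto simp: coboundaries_iff cocycles_iff dif_dif)

text \<open>A product of a cocycle and a coboundary is a coboundary: \<open>x (d y) = d (\<epsilon>(x) y)\<close>, where \<open>\<epsilon>\<close>
  is the involution, and \<open>(d y) x = d (y x)\<close>.\<close>

lemma coboundary_ideal: "dg_ideal cocycle_alg (coboundaries A (dif A))"
proof -
  interpret ZA: dg_algebra cocycle_alg by (rule cocycle_dg_algebra)
  let ?B = "coboundaries A (dif A)"
  have inv: "\<ominus>\<^bsub>cocycle_alg\<^esub> x = \<ominus> x" if "x \<in> cocycles A (dif A)" for x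
    using that by (intro ZA.minus_equality) (auto simp: cocycles_iff l_neg dif_minus)
  have ideal: "ideal ?B cocycle_alg"
  proof (rule idealI[OF cocycle_ring])
    show "subgroup ?B (add_monoid cocycle_alg)"
    proof
      show "?B \<subseteq> carrier (add_monoid cocycle_alg)" using coboundaries_sub by simp
      show "x \<otimes>\<^bsub>add_monoid cocycle_alg\<^esub> y \<in> ?B" if xy: "x \<in> ?B" "y \<in> ?B" for x y
      proof -
        obtain x' y' where "x = dif A x'" "y = dif A y'" "x' \<in> carrier A" "y' \<in> carrier A"
          using xy by (auto simp: coboundaries_iff)
        then show ?thesis by (auto simp: coboundaries_iff dif_add intro!: bexI[of _ "x' \<oplus> y'"])
      qed
      show "\<one>\<^bsub>add_monoid cocycle_alg\<^esub> \<in> ?B" by (auto simp: coboundaries_iff intro!: bexI[of _ \<zero>])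
      show "inv\<^bsub>add_monoid cocycle_alg\<^esub> x \<in> ?B" if x: "x \<in> ?B" for x
      proof -
        have "inv\<^bsub>add_monoid cocycle_alg\<^esub> x = \<ominus> x"
          using inv[of x] x coboundaries_sub by (auto simp: a_inv_def)
        then show ?thesis using x by (auto simp: coboundaries_iff dif_minus intro!: bexI[of _ "\<ominus> _"])
      qed
    qed
    show "x \<otimes>\<^bsub>cocycle_alg\<^esub> a \<in> ?B" if a: "a \<in> ?B" and x: "x \<in> carrier cocycle_alg" for a x
    proof -
      obtain y where y: "y \<in> carrier A" "a = dif A y" using a by (auto simp: coboundaries_iff)
      have "eps (eps x) \<otimes> dif A y = dif A (eps x \<otimes> y)"
        using x y by (auto simp: dif_mult cocycles_iff dif_eps)
      then show ?thesis using x y by (auto simp: coboundaries_iff cocycles_iff intro!: bexI[of _ "eps x \<otimes> y"])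
    qed
    show "a \<otimes>\<^bsub>cocycle_alg\<^esub> x \<in> ?B" if a: "a \<in> ?B" and x: "x \<in> carrier cocycle_alg" for a x
    proof -
      obtain y where y: "y \<in> carrier A" "a = dif A y" using a by (auto simp: coboundaries_iff)
      have "dif A y \<otimes> x = dif A (y \<otimes> x)" using x y by (auto simp: dif_mult cocycles_iff)
      then show ?thesis using x y by (auto simp: coboundaries_iff cocycles_iff)
    qed
  qed
  have component: "ZA.component x = component x" if "x \<in> cocycles A (dif A)" for x
    using that by (intro ZA.component_unique[where F = "{n. component x n \<noteq> \<zero>}"])
      (auto simp: cocycles_iff[of x] component_homog component_cocycle[unfolded cocycles_iff] finite_component cocycle_finsum component_cocycle
        component_sum[symmetric])
  show ?thesis
  proof (rule dg_ideal.intro[OF cocycle_dg_algebra ideal dg_ideal_axioms.intro])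
    show "ZA.component x n \<in> ?B" if x: "x \<in> ?B" for x n
    proof -
      obtain y where y: "y \<in> carrier A" "x = dif A y" using x by (auto simp: coboundaries_iff)
      then show ?thesis using x coboundaries_sub
        by (auto simp: component coboundaries_iff component_dif subset_iff)
    qed
    show "dif cocycle_alg x \<in> ?B" if "x \<in> ?B" for x
      using that by (auto simp: coboundaries_iff dif_dif intro!: bexI[of _ \<zero>])
  qed
qed

lemma cohomology_eq: "cohomology A = quot_dga cocycle_alg (coboundaries A (dif A))"
  by (simp add: cohomology_def cocycle_alg_def)

abbreviation cls :: "'a \<Rightarrow> 'a set" where
  "cls \<equiv> coh_class A (dif A)"

lemma cls_eq: "cls x = coboundaries A (dif A) +>\<^bsub>cocycle_alg\<^esub> x"
  by (simp add: coh_class_def a_r_coset_def r_coset_def)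

lemma coh_dg_algebra: "dg_algebra (cohomology A)"
  unfolding cohomology_eq by (rule dg_ideal.quot_dg_algebra[OF coboundary_ideal])

lemma coh_carrier: "carrier (cohomology A) = cls ` cocycles A (dif A)"
  using dg_ideal.quot_carrier[OF coboundary_ideal] by (simp add: cohomology_eq cls_eq)

lemma coh_homog: "homog (cohomology A) n = cls ` (homog A n \<inter> cocycles A (dif A))"
  using dg_ideal.quot_homog[OF coboundary_ideal] by (simp add: cohomology_eq cls_eq)

lemma coh_zero: "\<zero>\<^bsub>cohomology A\<^esub> = cls \<zero>"
  using dg_ideal.quot_zero[OF coboundary_ideal] by (simp add: cohomology_eq cls_eq)

lemma coh_one: "\<one>\<^bsub>cohomology A\<^esub> = cls \<one>"
  using dg_ideal.quot_one[OF coboundary_ideal] by (simp add: cohomology_eq cls_eq)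

lemma coh_add: "x \<in> cocycles A (dif A) \<Longrightarrow> y \<in> cocycles A (dif A) \<Longrightarrow> cls x \<oplus>\<^bsub>cohomology A\<^esub> cls y = cls (x \<oplus> y)"
  using dg_ideal.quot_add[OF coboundary_ideal] by (simp add: cohomology_eq cls_eq)

lemma coh_mult: "x \<in> cocycles A (dif A) \<Longrightarrow> y \<in> cocycles A (dif A) \<Longrightarrow> cls x \<otimes>\<^bsub>cohomology A\<^esub> cls y = cls (x \<otimes> y)"
  using dg_ideal.quot_mult[OF coboundary_ideal] by (simp add: cohomology_eq cls_eq)

lemma coh_smult: "x \<in> cocycles A (dif A) \<Longrightarrow> c \<odot>\<^bsub>cohomology A\<^esub> cls x = cls (c \<odot> x)"
  using dg_ideal.quot_smult[OF coboundary_ideal] by (simp add: cohomology_eq cls_eq)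

lemma coh_dif: "x \<in> cocycles A (dif A) \<Longrightarrow> dif (cohomology A) (cls x) = \<zero>\<^bsub>cohomology A\<^esub>"
  using dg_ideal.quot_dif[OF coboundary_ideal] dg_ideal.quot_zero[OF coboundary_ideal]
  by (simp add: cohomology_eq cls_eq cocycles_iff)

lemma cls_eq_iff:
  assumes x: "x \<in> cocycles A (dif A)" and y: "y \<in> cocycles A (dif A)"
  shows "cls x = cls y \<longleftrightarrow> (\<exists>z\<in>carrier A. x = y \<oplus> dif A z)"
proof -
  interpret ZA: dg_ideal cocycle_alg "coboundaries A (dif A)" by (rule coboundary_ideal)
  have "cls x = cls y \<longleftrightarrow> x \<ominus>\<^bsub>cocycle_alg\<^esub> y \<in> coboundaries A (dif A)"
    using x y by (simp add: ZA.coset_eq_iff cls_eq)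
  also have "x \<ominus>\<^bsub>cocycle_alg\<^esub> y = x \<ominus> y"
    using y ZA.minus_equality[of "\<ominus> y" y] by (auto simp: a_minus_def cocycles_iff l_neg dif_minus)
  also have "x \<ominus> y \<in> coboundaries A (dif A) \<longleftrightarrow> (\<exists>z\<in>carrier A. x = y \<oplus> dif A z)"
  proof -
    have "x \<ominus> y = dif A z \<longleftrightarrow> x = y \<oplus> dif A z" if "z \<in> carrier A" for z
      using that x y by (metis a_minus_def add.inv_solve_right' add.m_comm cocycles_iff dif_closed)
    then show ?thesis by (auto simp: coboundaries_iff)
  qed
  finally show ?thesis .
qed

lemma cohE:
  assumes "S \<in> carrier (cohomology A)"
  obtains x where "x \<in> cocycles A (dif A)" "S = cls x"
  using assms by (auto simp: coh_carrier)

text \<open>The analogue of \<open>coset_UN\<close>, which evaluates the maps induced on cohomology.\<close>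

lemma cls_UN:
  assumes "x \<in> cocycles A (dif A)"
    and "\<And>z. z \<in> carrier A \<Longrightarrow> f (x \<oplus> dif A z) = f x"
  shows "(\<Union>y\<in>cls x. f y) = f x"
proof -
  interpret ZA: dg_ideal cocycle_alg "coboundaries A (dif A)" by (rule coboundary_ideal)
  have "y \<in> cocycles A (dif A) \<and> cls y = cls x" if "y \<in> cls x" for y
    using that assms ZA.a_elemrcos_carrier[of x y] ZA.a_repr_independence'[of y x] by (simp add: cls_eq)
  then have eq: "f y = f x" if "y \<in> cls x" for y
    using that assms cls_eq_iff[of y x] by auto
  have "x \<in> cls x" using assms(1) ZA.a_rcos_self[of x] by (simp add: cls_eq)
  moreover have "(\<Union>y\<in>cls x. f y) = (\<Union>y\<in>cls x. f x)" using eq by (rule SUP_cong[OF refl])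
  ultimately show ?thesis by (simp only: UN_constant) auto
qed

end

section \<open>Triple Massey products and quasi-isomorphisms\<close>

locale dga_quasi_isomorphism = A?: dg_algebra A + B?: dg_algebra B
  for A :: "('k::field, 'a) dg_alg" and B :: "('k, 'b) dg_alg" +
  fixes \<phi> :: "'a \<Rightarrow> 'b"
  assumes hom: "dga_hom A B \<phi>" and coh_iso: "induces_coh_iso A (dif A) B (dif B) \<phi>"
begin

lemma hom_closed [simp]: "x \<in> carrier A \<Longrightarrow> \<phi> x \<in> carrier B"
  and hom_mult [simp]: "x \<in> carrier A \<Longrightarrow> y \<in> carrier A \<Longrightarrow> \<phi> (x \<otimes>\<^bsub>A\<^esub> y) = \<phi> x \<otimes>\<^bsub>B\<^esub> \<phi> y"
  and hom_add [simp]: "x \<in> carrier A \<Longrightarrow> y \<in> carrier A \<Longrightarrow> \<phi> (x \<oplus>\<^bsub>A\<^esub> y) = \<phi> x \<oplus>\<^bsub>B\<^esub> \<phi> y"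
  and hom_smult [simp]: "x \<in> carrier A \<Longrightarrow> \<phi> (c \<odot>\<^bsub>A\<^esub> x) = c \<odot>\<^bsub>B\<^esub> \<phi> x"
  and hom_homog: "x \<in> homog A n \<Longrightarrow> \<phi> x \<in> homog B n"
  and hom_dif: "x \<in> carrier A \<Longrightarrow> \<phi> (dif A x) = dif B (\<phi> x)"
  using hom unfolding dga_hom_def by (auto simp: ring_hom_def subset_iff)

lemma hom_zero [simp]: "\<phi> \<zero>\<^bsub>A\<^esub> = \<zero>\<^bsub>B\<^esub>"
  using hom_smult[of "\<zero>\<^bsub>A\<^esub>" 0] by simp

lemma hom_minus [simp]: "x \<in> carrier A \<Longrightarrow> \<phi> (\<ominus>\<^bsub>A\<^esub> x) = \<ominus>\<^bsub>B\<^esub> \<phi> x"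
  using hom_smult[of x "-1"] by (simp add: A.smult_minus_one B.smult_minus_one)

lemma hom_eps: "x \<in> carrier A \<Longrightarrow> \<phi> (A.eps x) = B.eps (\<phi> x)"
  by (induction rule: A.homog_induct) (auto simp: A.eps_add B.eps_add A.eps_of_homog B.eps_of_homog[OF hom_homog])

lemma hom_cocycle: "x \<in> cocycles A (dif A) \<Longrightarrow> \<phi> x \<in> cocycles B (dif B)"
  by (auto simp: A.cocycles_iff B.cocycles_iff hom_dif[symmetric])

lemma hom_cls:
  assumes "x \<in> cocycles A (dif A)"
  shows "(\<Union>y\<in>A.cls x. B.cls (\<phi> y)) = B.cls (\<phi> x)"
proof (rule A.cls_UN[OF assms])
  fix z assume z: "z \<in> carrier A"
  have x: "x \<in> carrier A" using assms by (simp add: A.cocycles_iff)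
  have "x \<oplus>\<^bsub>A\<^esub> dif A z \<in> cocycles A (dif A)"
    using assms z by (simp add: A.cocycles_iff A.dif_add A.dif_dif)
  then show "B.cls (\<phi> (x \<oplus>\<^bsub>A\<^esub> dif A z)) = B.cls (\<phi> x)"
    using assms z x by (subst B.cls_eq_iff) (auto intro!: bexI[of _ "\<phi> z"] hom_cocycle simp flip: hom_dif hom_add)
qed

text \<open>Surjectivity on cohomology, for elements.\<close>

lemma lift_cocycle:
  assumes "y \<in> cocycles B (dif B)"
  obtains x e where "x \<in> cocycles A (dif A)" "e \<in> carrier B" "y = \<phi> x \<oplus>\<^bsub>B\<^esub> dif B e"
proof -
  have "B.cls y \<in> (\<lambda>S. \<Union>y\<in>S. B.cls (\<phi> y)) ` (A.cls ` cocycles A (dif A))"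
    using coh_iso assms unfolding induces_coh_iso_def bij_betw_def by auto
  then obtain x where "x \<in> cocycles A (dif A)" "B.cls y = B.cls (\<phi> x)" by (auto simp: hom_cls)
  then show ?thesis using that assms B.cls_eq_iff[OF assms hom_cocycle] by blast
qed

text \<open>Injectivity on cohomology, for elements.\<close>

lemma reflect_coboundary:
  assumes "x \<in> cocycles A (dif A)" "e \<in> carrier B" "\<phi> x = dif B e"
  obtains z where "z \<in> carrier A" "x = dif A z"
proof -
  have zA: "\<zero>\<^bsub>A\<^esub> \<in> cocycles A (dif A)" and zB: "\<zero>\<^bsub>B\<^esub> \<in> cocycles B (dif B)"
    by (simp_all add: A.cocycles_iff B.cocycles_iff)
  have "B.cls (\<phi> x) = B.cls (\<phi> \<zero>\<^bsub>A\<^esub>)"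
    using assms zB by (subst B.cls_eq_iff[OF hom_cocycle[OF assms(1)]]) auto
  then have eq: "(\<Union>y\<in>A.cls x. B.cls (\<phi> y)) = (\<Union>y\<in>A.cls \<zero>\<^bsub>A\<^esub>. B.cls (\<phi> y))"
    by (simp only: hom_cls[OF assms(1)] hom_cls[OF zA])
  have "inj_on (\<lambda>S. \<Union>y\<in>S. B.cls (\<phi> y)) (A.cls ` cocycles A (dif A))"
    using coh_iso by (simp add: induces_coh_iso_def bij_betw_def)
  from inj_onD[OF this eq] have "A.cls x = A.cls \<zero>\<^bsub>A\<^esub>"
    using assms(1) zA by blast
  then show ?thesis using that A.cls_eq_iff[OF assms(1) zA] by auto
qed

end

context dg_algebra
begin

text \<open>All triple Massey products contain zero. For a defining system \<open>(v, w)\<close> of a triple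
  \<open>(a, b, c)\<close>, the cocycle \<open>v c - \<epsilon>(a) w\<close> represents the Massey product, and its indeterminacy
  consists of the products of \<open>\<epsilon>(a)\<close> and of \<open>c\<close> with cocycles.\<close>

definition massey_vanishing :: bool where
  "massey_vanishing \<longleftrightarrow>
     (\<forall>a\<in>cocycles A (dif A). \<forall>b\<in>cocycles A (dif A). \<forall>c\<in>cocycles A (dif A).
      \<forall>v\<in>carrier A. \<forall>w\<in>carrier A. dif A v = a \<otimes> b \<longrightarrow> dif A w = b \<otimes> c \<longrightarrow>
        (\<exists>s\<in>cocycles A (dif A). \<exists>t\<in>cocycles A (dif A). \<exists>r\<in>carrier A.
           v \<otimes> c \<ominus> eps a \<otimes> w = eps a \<otimes> s \<oplus> t \<otimes> c \<oplus> dif A r))"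

text \<open>Without a differential, \<open>v\<close> and \<open>w\<close> are cocycles themselves, so the whole Massey product
  lies in the indeterminacy.\<close>

lemma massey_vanishing_zero_dif:
  assumes "\<And>x. x \<in> carrier A \<Longrightarrow> dif A x = \<zero>"
  shows massey_vanishing
  unfolding massey_vanishing_def
proof (intro ballI impI)
  fix a b c v w
  assume *: "a \<in> cocycles A (dif A)" "c \<in> cocycles A (dif A)" "v \<in> carrier A" "w \<in> carrier A"
  then have [simp]: "a \<in> carrier A" "c \<in> carrier A" by (auto simp: cocycles_iff)
  have "v \<otimes> c \<ominus> eps a \<otimes> w = eps a \<otimes> (\<ominus> w) \<oplus> v \<otimes> c \<oplus> dif A \<zero>"
    using * by (simp add: a_minus_def r_minus a_ac)
  then show "\<exists>s\<in>cocycles A (dif A). \<exists>t\<in>cocycles A (dif A). \<exists>r\<in>carrier A.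
           v \<otimes> c \<ominus> eps a \<otimes> w = eps a \<otimes> s \<oplus> t \<otimes> c \<oplus> dif A r"
    using * assms by (intro bexI[of _ "\<ominus> w"] bexI[of _ v] bexI[of _ \<zero>]) (auto simp: cocycles_iff)
qed

lemma dif_cocycle_mult:
  "x \<in> cocycles A (dif A) \<Longrightarrow> y \<in> carrier A \<Longrightarrow> dif A (eps x \<otimes> y) = x \<otimes> dif A y"
  "x \<in> cocycles A (dif A) \<Longrightarrow> y \<in> carrier A \<Longrightarrow> dif A (x \<otimes> y) = eps x \<otimes> dif A y"
  "y \<in> cocycles A (dif A) \<Longrightarrow> x \<in> carrier A \<Longrightarrow> dif A (x \<otimes> y) = dif A x \<otimes> y"
  by (auto simp: cocycles_iff dif_mult dif_eps)

end

context dga_quasi_isomorphism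
begin

text \<open>A defining system in the source is mapped to one in the target. There the Massey product
  lies in the indeterminacy; the two cocycles that witness this lift up to coboundaries, and the
  remaining difference is a coboundary in the target, hence already in the source.\<close>

lemma massey_vanishing_reflect:
  assumes B: "B.massey_vanishing"
  shows "A.massey_vanishing"
  unfolding A.massey_vanishing_def
proof (intro ballI impI)
  fix a b c v w
  assume cyc: "a \<in> cocycles A (dif A)" "b \<in> cocycles A (dif A)" "c \<in> cocycles A (dif A)"
    and vw: "v \<in> carrier A" "w \<in> carrier A"
    and dv: "dif A v = a \<otimes>\<^bsub>A\<^esub> b" and dw: "dif A w = b \<otimes>\<^bsub>A\<^esub> c"
  have car [simp]: "a \<in> carrier A" "b \<in> carrier A" "c \<in> carrier A"
    using cyc by (auto simp: A.cocycles_iff)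
  note [simp] = vw
  obtain s' t' r' where st': "s' \<in> cocycles B (dif B)" "t' \<in> cocycles B (dif B)" "r' \<in> carrier B"
    and m: "\<phi> v \<otimes>\<^bsub>B\<^esub> \<phi> c \<ominus>\<^bsub>B\<^esub> B.eps (\<phi> a) \<otimes>\<^bsub>B\<^esub> \<phi> w
          = B.eps (\<phi> a) \<otimes>\<^bsub>B\<^esub> s' \<oplus>\<^bsub>B\<^esub> t' \<otimes>\<^bsub>B\<^esub> \<phi> c \<oplus>\<^bsub>B\<^esub> dif B r'"
    using B[unfolded B.massey_vanishing_def, rule_format, OF hom_cocycle[OF cyc(1)] hom_cocycle[OF cyc(2)]
        hom_cocycle[OF cyc(3)], of "\<phi> v" "\<phi> w"] dv dw by (auto simp flip: hom_dif hom_mult)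
  obtain s e where s: "s \<in> cocycles A (dif A)" "e \<in> carrier B" "s' = \<phi> s \<oplus>\<^bsub>B\<^esub> dif B e"
    using lift_cocycle[OF st'(1)] .
  obtain t f where t: "t \<in> cocycles A (dif A)" "f \<in> carrier B" "t' = \<phi> t \<oplus>\<^bsub>B\<^esub> dif B f"
    using lift_cocycle[OF st'(2)] .
  have [simp]: "s \<in> carrier A" "t \<in> carrier A" "dif A s = \<zero>\<^bsub>A\<^esub>" "dif A t = \<zero>\<^bsub>A\<^esub>" "dif A c = \<zero>\<^bsub>A\<^esub>"
    "dif A a = \<zero>\<^bsub>A\<^esub>"
    using s t cyc by (auto simp: A.cocycles_iff)
  define m where "m = v \<otimes>\<^bsub>A\<^esub> c \<ominus>\<^bsub>A\<^esub> A.eps a \<otimes>\<^bsub>A\<^esub> w"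
  define n where "n = A.eps a \<otimes>\<^bsub>A\<^esub> s \<oplus>\<^bsub>A\<^esub> t \<otimes>\<^bsub>A\<^esub> c"
  have mn [simp]: "m \<in> carrier A" "n \<in> carrier A" by (simp_all add: m_def n_def)
  have "dif A (m \<ominus>\<^bsub>A\<^esub> n) = \<zero>\<^bsub>A\<^esub>"
    using cyc s t dv dw
    by (simp add: m_def n_def A.dif_minus_eq A.dif_minus A.dif_add A.dif_cocycle_mult A.dif_eps A.m_assoc A.minus_eq A.r_neg)
  then have mn_cyc: "m \<ominus>\<^bsub>A\<^esub> n \<in> cocycles A (dif A)" by (simp add: A.cocycles_iff)
  have d1: "dif B (\<phi> a \<otimes>\<^bsub>B\<^esub> e) = B.eps (\<phi> a) \<otimes>\<^bsub>B\<^esub> dif B e"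
    using hom_cocycle[OF cyc(1)] s by (simp add: B.dif_cocycle_mult)
  have d2: "dif B (f \<otimes>\<^bsub>B\<^esub> \<phi> c) = dif B f \<otimes>\<^bsub>B\<^esub> \<phi> c"
    using hom_cocycle[OF cyc(3)] t by (simp add: B.dif_cocycle_mult)
  have "\<phi> m = B.eps (\<phi> a) \<otimes>\<^bsub>B\<^esub> s' \<oplus>\<^bsub>B\<^esub> t' \<otimes>\<^bsub>B\<^esub> \<phi> c \<oplus>\<^bsub>B\<^esub> dif B r'"
    using \<open>\<phi> v \<otimes>\<^bsub>B\<^esub> \<phi> c \<ominus>\<^bsub>B\<^esub> _ = _\<close> by (simp add: m_def a_minus_def hom_eps)
  also have "\<dots> = \<phi> n \<oplus>\<^bsub>B\<^esub> dif B (\<phi> a \<otimes>\<^bsub>B\<^esub> e \<oplus>\<^bsub>B\<^esub> f \<otimes>\<^bsub>B\<^esub> \<phi> c \<oplus>\<^bsub>B\<^esub> r')"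
    using s t st' by (simp add: n_def hom_eps B.dif_add d1 d2 B.l_distr B.r_distr B.a_ac)
  finally have "\<phi> (m \<ominus>\<^bsub>A\<^esub> n) = dif B (\<phi> a \<otimes>\<^bsub>B\<^esub> e \<oplus>\<^bsub>B\<^esub> f \<otimes>\<^bsub>B\<^esub> \<phi> c \<oplus>\<^bsub>B\<^esub> r')"
    using s t st' by (simp add: a_minus_def B.a_assoc B.a_comm[of "\<phi> n"] B.r_neg)
  then obtain r where r: "r \<in> carrier A" "m \<ominus>\<^bsub>A\<^esub> n = dif A r"
    using reflect_coboundary[OF mn_cyc] s t st' by (metis B.add.m_closed B.m_closed car(1) car(3) hom_closed)
  have "m = n \<oplus>\<^bsub>A\<^esub> (m \<ominus>\<^bsub>A\<^esub> n)"
    by (simp add: a_minus_def A.a_comm[of m] A.r_neg2)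
  then show "\<exists>s\<in>cocycles A (dif A). \<exists>t\<in>cocycles A (dif A). \<exists>r\<in>carrier A.
      v \<otimes>\<^bsub>A\<^esub> c \<ominus>\<^bsub>A\<^esub> A.eps a \<otimes>\<^bsub>A\<^esub> w = A.eps a \<otimes>\<^bsub>A\<^esub> s \<oplus>\<^bsub>A\<^esub> t \<otimes>\<^bsub>A\<^esub> c \<oplus>\<^bsub>A\<^esub> dif A r"
    using r s t unfolding m_def n_def by metis
qed

end

lemma (in abelian_group) minus_solve:
  assumes "x \<in> carrier G" "y \<in> carrier G" "x \<oplus> y = z"
  shows "y = z \<ominus> x"
  using assms(1,2) by (simp add: assms(3)[symmetric] minus_eq a_comm[of _ "\<ominus> x"] r_neg1)

text \<open>Cancellation of a term against its negative standing further to the right;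
  \<open>ring_simprules\<close> cancels only neighbouring terms.\<close>

lemma (in abelian_group) neg_cancel:
  assumes "x \<in> carrier G" "y \<in> carrier G"
  shows "x \<oplus> (y \<oplus> \<ominus> x) = y"
    and "z \<in> carrier G \<Longrightarrow> x \<oplus> (y \<oplus> (\<ominus> x \<oplus> z)) = y \<oplus> z"
    and "u \<in> carrier G \<Longrightarrow> x \<oplus> (u \<oplus> (y \<oplus> \<ominus> x)) = u \<oplus> y"
    and "\<lbrakk>u \<in> carrier G; z \<in> carrier G\<rbrakk> \<Longrightarrow>
      x \<oplus> (u \<oplus> (y \<oplus> (\<ominus> x \<oplus> z))) = u \<oplus> (y \<oplus> z)"
    and "\<lbrakk>u \<in> carrier G; v \<in> carrier G\<rbrakk> \<Longrightarrow>
      x \<oplus> (u \<oplus> (v \<oplus> (y \<oplus> \<ominus> x))) = u \<oplus> (v \<oplus> y)"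
    and "\<lbrakk>u \<in> carrier G; v \<in> carrier G; z \<in> carrier G\<rbrakk> \<Longrightarrow>
      x \<oplus> (u \<oplus> (v \<oplus> (y \<oplus> (\<ominus> x \<oplus> z)))) = u \<oplus> (v \<oplus> (y \<oplus> z))"
    and "\<lbrakk>u \<in> carrier G; v \<in> carrier G; w \<in> carrier G\<rbrakk> \<Longrightarrow>
      x \<oplus> (u \<oplus> (v \<oplus> (w \<oplus> (y \<oplus> \<ominus> x)))) = u \<oplus> (v \<oplus> (w \<oplus> y))"
    and "\<lbrakk>u \<in> carrier G; v \<in> carrier G; w \<in> carrier G; z \<in> carrier G\<rbrakk> \<Longrightarrow>
      x \<oplus> (u \<oplus> (v \<oplus> (w \<oplus> (y \<oplus> (\<ominus> x \<oplus> z))))) = u \<oplus> (v \<oplus> (w \<oplus> (y \<oplus> z)))"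
  using assms by (simp_all add: a_lcomm[of _ "\<ominus> x"] a_comm[of _ "\<ominus> x"] r_neg2)

text \<open>The computation behind \<open>massey_vanishing_push\<close>. A prefix \<open>p\<close> marks the image of an element
  of the source, \<open>e\<close> the involution and \<open>d\<close> the differential of an element; thus \<open>ea - de\<close> is the
  involution of the sum of an image and a coboundary. The terms \<open>d1\<close> to \<open>d5\<close> will be coboundaries,
  and the conclusion says that the Massey products of two cohomologous triples differ by
  coboundaries and the indeterminacy.\<close>

lemma (in ring) massey_identity:
  assumes [simp]: "pv \<in> carrier R" "pc \<in> carrier R" "dg \<in> carrier R" "ea \<in> carrier R"
    "f \<in> carrier R" "e \<in> carrier R" "b \<in> carrier R" "de \<in> carrier R" "pw \<in> carrier R"
    "eb \<in> carrier R" "g \<in> carrier R" "ps \<in> carrier R" "pt \<in> carrier R"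
    "d1 \<in> carrier R" "d2 \<in> carrier R" "d3 \<in> carrier R" "d4 \<in> carrier R" "d5 \<in> carrier R"
  and c: "c = pc \<oplus> dg" and w: "w = pw \<oplus> eb \<otimes> g \<oplus> f \<otimes> c"
  and 1: "pv \<otimes> dg = d1 \<oplus> ea \<otimes> (eb \<otimes> g)"
  and 2: "de \<otimes> w \<oplus> e \<otimes> (b \<otimes> c) = d2"
  and 3: "pv \<otimes> pc \<ominus> ea \<otimes> pw = ea \<otimes> ps \<oplus> pt \<otimes> pc \<oplus> d3"
  and 4: "de \<otimes> ps = d4" and 5: "pt \<otimes> dg = d5"
  shows "(pv \<oplus> ea \<otimes> f \<oplus> e \<otimes> b) \<otimes> c \<ominus> (ea \<ominus> de) \<otimes> w
       = (ea \<ominus> de) \<otimes> ps \<oplus> pt \<otimes> c \<oplus> (d1 \<oplus> d2 \<oplus> d3 \<oplus> d4 \<ominus> d5)"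
proof -
  have cw [simp]: "c \<in> carrier R" "w \<in> carrier R" by (simp_all add: c w)
  have "(pv \<oplus> ea \<otimes> f \<oplus> e \<otimes> b) \<otimes> c \<ominus> (ea \<ominus> de) \<otimes> w
      = pv \<otimes> c \<oplus> ea \<otimes> (f \<otimes> c) \<ominus> ea \<otimes> w \<oplus> (de \<otimes> w \<oplus> e \<otimes> (b \<otimes> c))"
    by (simp add: ring_simprules)
  also have "ea \<otimes> w = ea \<otimes> pw \<oplus> ea \<otimes> (eb \<otimes> g) \<oplus> ea \<otimes> (f \<otimes> c)"
    by (simp add: w ring_simprules)
  also have "pv \<otimes> c = pv \<otimes> pc \<oplus> (d1 \<oplus> ea \<otimes> (eb \<otimes> g))"
    unfolding c 1[symmetric] by (simp add: ring_simprules)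
  also have "pv \<otimes> pc \<oplus> (d1 \<oplus> ea \<otimes> (eb \<otimes> g)) \<oplus> ea \<otimes> (f \<otimes> c) \<ominus>
      (ea \<otimes> pw \<oplus> ea \<otimes> (eb \<otimes> g) \<oplus> ea \<otimes> (f \<otimes> c)) \<oplus> (de \<otimes> w \<oplus> e \<otimes> (b \<otimes> c))
     = (pv \<otimes> pc \<ominus> ea \<otimes> pw) \<oplus> d1 \<oplus> (de \<otimes> w \<oplus> e \<otimes> (b \<otimes> c))"
    by (simp add: ring_simprules)
  also have "\<dots> = (ea \<otimes> ps \<oplus> pt \<otimes> pc \<oplus> d3) \<oplus> d1 \<oplus> d2" by (simp add: 2 3)
  also have "\<dots> = (ea \<ominus> de) \<otimes> ps \<oplus> de \<otimes> ps \<oplus> (pt \<otimes> c \<ominus> pt \<otimes> dg) \<oplus> d3 \<oplus> d1 \<oplus> d2"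
    unfolding c by (simp add: ring_simprules neg_cancel)
  also have "\<dots> = (ea \<ominus> de) \<otimes> ps \<oplus> pt \<otimes> c \<oplus> (d1 \<oplus> d2 \<oplus> d3 \<oplus> d4 \<ominus> d5)"
    unfolding 4[symmetric] 5[symmetric] by (simp add: ring_simprules neg_cancel)
  finally show ?thesis .
qed

context dga_quasi_isomorphism
begin

text \<open>Cocycles \<open>a\<close>, \<open>b\<close>, \<open>c\<close> of the target are cohomologous to images of cocycles \<open>a'\<close>, \<open>b'\<close>,
  \<open>c'\<close>, and a defining system of the latter yields one of the former. Any other defining system
  differs from it by cocycles, which change the Massey product only within the indeterminacy.\<close>

lemma massey_vanishing_push:
  assumes A: "A.massey_vanishing"
  shows "B.massey_vanishing"
  unfolding B.massey_vanishing_def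
proof (intro ballI impI)
  fix a b c v w
  assume cyc: "a \<in> cocycles B (dif B)" "b \<in> cocycles B (dif B)" "c \<in> cocycles B (dif B)"
    and vw [simp]: "v \<in> carrier B" "w \<in> carrier B"
    and dv: "dif B v = a \<otimes>\<^bsub>B\<^esub> b" and dw: "dif B w = b \<otimes>\<^bsub>B\<^esub> c"
  obtain a' e where a: "a' \<in> cocycles A (dif A)" "e \<in> carrier B" "a = \<phi> a' \<oplus>\<^bsub>B\<^esub> dif B e"
    using lift_cocycle[OF cyc(1)] .
  obtain b' f where b: "b' \<in> cocycles A (dif A)" "f \<in> carrier B" "b = \<phi> b' \<oplus>\<^bsub>B\<^esub> dif B f"
    using lift_cocycle[OF cyc(2)] .
  obtain c' g where c: "c' \<in> cocycles A (dif A)" "g \<in> carrier B" "c = \<phi> c' \<oplus>\<^bsub>B\<^esub> dif B g"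
    using lift_cocycle[OF cyc(3)] .
  note pc = hom_cocycle[OF a(1)] hom_cocycle[OF b(1)] hom_cocycle[OF c(1)]
  have car [simp]: "a \<in> carrier B" "b \<in> carrier B" "c \<in> carrier B" "a' \<in> carrier A" "b' \<in> carrier A"
    "c' \<in> carrier A" "e \<in> carrier B" "f \<in> carrier B" "g \<in> carrier B"
    using cyc a b c by (auto simp: A.cocycles_iff B.cocycles_iff)
  have [simp]: "dif A a' = \<zero>\<^bsub>A\<^esub>" "dif A b' = \<zero>\<^bsub>A\<^esub>" "dif A c' = \<zero>\<^bsub>A\<^esub>"
    "dif B a = \<zero>\<^bsub>B\<^esub>" "dif B b = \<zero>\<^bsub>B\<^esub>" "dif B c = \<zero>\<^bsub>B\<^esub>"
    using cyc a b c by (auto simp: A.cocycles_iff B.cocycles_iff)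
  \<comment> \<open>The defining systems of the two triples differ by explicit correction terms.\<close>
  have dv1: "dif B (B.eps (\<phi> a') \<otimes>\<^bsub>B\<^esub> f \<oplus>\<^bsub>B\<^esub> e \<otimes>\<^bsub>B\<^esub> b) \<oplus>\<^bsub>B\<^esub> \<phi> (a' \<otimes>\<^bsub>A\<^esub> b') = a \<otimes>\<^bsub>B\<^esub> b"
    using pc cyc by (simp add: B.dif_add B.dif_cocycle_mult) (simp add: a(3) b(3) B.ring_simprules)
  have dw1: "dif B (B.eps (\<phi> b') \<otimes>\<^bsub>B\<^esub> g \<oplus>\<^bsub>B\<^esub> f \<otimes>\<^bsub>B\<^esub> c) \<oplus>\<^bsub>B\<^esub> \<phi> (b' \<otimes>\<^bsub>A\<^esub> c') = b \<otimes>\<^bsub>B\<^esub> c"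
    using pc cyc by (simp add: B.dif_add B.dif_cocycle_mult) (simp add: b(3) c(3) B.ring_simprules)
  have "\<phi> (a' \<otimes>\<^bsub>A\<^esub> b') = dif B (v \<ominus>\<^bsub>B\<^esub> (B.eps (\<phi> a') \<otimes>\<^bsub>B\<^esub> f \<oplus>\<^bsub>B\<^esub> e \<otimes>\<^bsub>B\<^esub> b))"
    using B.minus_solve[OF _ _ dv1] dv by (simp add: B.dif_minus_eq)
  then obtain v' where v': "v' \<in> carrier A" "a' \<otimes>\<^bsub>A\<^esub> b' = dif A v'"
    by (rule reflect_coboundary[rotated 2]) (use a(1) b(1) in \<open>auto simp: A.cocycles_iff A.dif_mult\<close>)
  have "\<phi> (b' \<otimes>\<^bsub>A\<^esub> c') = dif B (w \<ominus>\<^bsub>B\<^esub> (B.eps (\<phi> b') \<otimes>\<^bsub>B\<^esub> g \<oplus>\<^bsub>B\<^esub> f \<otimes>\<^bsub>B\<^esub> c))"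
    using B.minus_solve[OF _ _ dw1] dw by (simp add: B.dif_minus_eq)
  then obtain w' where w': "w' \<in> carrier A" "b' \<otimes>\<^bsub>A\<^esub> c' = dif A w'"
    by (rule reflect_coboundary[rotated 2]) (use b(1) c(1) in \<open>auto simp: A.cocycles_iff A.dif_mult\<close>)
  note [simp] = v'(1) w'(1)
  define v1 where "v1 = \<phi> v' \<oplus>\<^bsub>B\<^esub> B.eps (\<phi> a') \<otimes>\<^bsub>B\<^esub> f \<oplus>\<^bsub>B\<^esub> e \<otimes>\<^bsub>B\<^esub> b"
  define w1 where "w1 = \<phi> w' \<oplus>\<^bsub>B\<^esub> B.eps (\<phi> b') \<otimes>\<^bsub>B\<^esub> g \<oplus>\<^bsub>B\<^esub> f \<otimes>\<^bsub>B\<^esub> c"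
  have vw1 [simp]: "v1 \<in> carrier B" "w1 \<in> carrier B" by (simp_all add: v1_def w1_def)
  have d1: "dif B v1 = a \<otimes>\<^bsub>B\<^esub> b" 
    using dv1 by (simp add: v1_def B.dif_add v'(2) hom_dif B.a_ac del: hom_mult)
  have d2: "dif B w1 = b \<otimes>\<^bsub>B\<^esub> c"
    using dw1 by (simp add: w1_def B.dif_add w'(2) hom_dif B.a_ac del: hom_mult)
  define t1 where "t1 = v \<ominus>\<^bsub>B\<^esub> v1"
  define s1 where "s1 = w \<ominus>\<^bsub>B\<^esub> w1"
  have st1 [simp]: "t1 \<in> carrier B" "s1 \<in> carrier B" by (simp_all add: t1_def s1_def)
  have st1c: "dif B t1 = \<zero>\<^bsub>B\<^esub>" "dif B s1 = \<zero>\<^bsub>B\<^esub>"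
    using vw vw1 by (simp_all only: t1_def s1_def B.dif_minus_eq d1 d2 dv dw) (simp_all add: B.minus_eq B.r_neg)
  have vw2: "v = v1 \<oplus>\<^bsub>B\<^esub> t1" "w = w1 \<oplus>\<^bsub>B\<^esub> s1"
    by (simp_all add: t1_def s1_def B.minus_eq B.neg_cancel)
  obtain s t r where str: "s \<in> cocycles A (dif A)" "t \<in> cocycles A (dif A)" "r \<in> carrier A"
    and m: "v' \<otimes>\<^bsub>A\<^esub> c' \<ominus>\<^bsub>A\<^esub> A.eps a' \<otimes>\<^bsub>A\<^esub> w' = A.eps a' \<otimes>\<^bsub>A\<^esub> s \<oplus>\<^bsub>A\<^esub> t \<otimes>\<^bsub>A\<^esub> c' \<oplus>\<^bsub>A\<^esub> dif A r"
    using A[unfolded A.massey_vanishing_def, rule_format, OF a(1) b(1) c(1), of v' w'] v' w' by auto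
  have st [simp]: "s \<in> carrier A" "t \<in> carrier A" "r \<in> carrier A" "dif A s = \<zero>\<^bsub>A\<^esub>" "dif A t = \<zero>\<^bsub>A\<^esub>"
    using str by (auto simp: A.cocycles_iff)
  have st' [simp]: "dif B (\<phi> s) = \<zero>\<^bsub>B\<^esub>" "dif B (\<phi> t) = \<zero>\<^bsub>B\<^esub>" by (simp_all flip: hom_dif)
  have ea: "B.eps a = B.eps (\<phi> a') \<ominus>\<^bsub>B\<^esub> dif B (B.eps e)"
    by (simp add: a(3) B.eps_add B.minus_eq B.eps_dif)
  have "\<phi> (v' \<otimes>\<^bsub>A\<^esub> c' \<ominus>\<^bsub>A\<^esub> A.eps a' \<otimes>\<^bsub>A\<^esub> w') = \<phi> (A.eps a' \<otimes>\<^bsub>A\<^esub> s \<oplus>\<^bsub>A\<^esub> t \<otimes>\<^bsub>A\<^esub> c' \<oplus>\<^bsub>A\<^esub> dif A r)"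
    by (simp only: m)
  then have m': "\<phi> v' \<otimes>\<^bsub>B\<^esub> \<phi> c' \<ominus>\<^bsub>B\<^esub> B.eps (\<phi> a') \<otimes>\<^bsub>B\<^esub> \<phi> w' =
      B.eps (\<phi> a') \<otimes>\<^bsub>B\<^esub> \<phi> s \<oplus>\<^bsub>B\<^esub> \<phi> t \<otimes>\<^bsub>B\<^esub> \<phi> c' \<oplus>\<^bsub>B\<^esub> dif B (\<phi> r)"
    by (simp add: a_minus_def hom_eps hom_dif)
  have dpv: "dif B (B.eps (\<phi> v')) = \<ominus>\<^bsub>B\<^esub> (B.eps (\<phi> a') \<otimes>\<^bsub>B\<^esub> B.eps (\<phi> b'))"
    by (simp add: B.dif_eps B.eps_mult flip: hom_dif v'(2))
  have e1: "\<phi> v' \<otimes>\<^bsub>B\<^esub> dif B g = dif B (B.eps (\<phi> v') \<otimes>\<^bsub>B\<^esub> g) \<oplus>\<^bsub>B\<^esub> B.eps (\<phi> a') \<otimes>\<^bsub>B\<^esub> (B.eps (\<phi> b') \<otimes>\<^bsub>B\<^esub> g)"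
    by (simp add: B.dif_mult dpv B.ring_simprules)
  have e2: "dif B (B.eps e) \<otimes>\<^bsub>B\<^esub> w1 \<oplus>\<^bsub>B\<^esub> e \<otimes>\<^bsub>B\<^esub> (b \<otimes>\<^bsub>B\<^esub> c) = dif B (B.eps e \<otimes>\<^bsub>B\<^esub> w1)"
    by (simp add: B.dif_mult d2)
  have e4: "dif B (B.eps e) \<otimes>\<^bsub>B\<^esub> \<phi> s = dif B (B.eps e \<otimes>\<^bsub>B\<^esub> \<phi> s)"
    by (simp add: B.dif_mult)
  have e5: "\<phi> t \<otimes>\<^bsub>B\<^esub> dif B g = dif B (B.eps (\<phi> t) \<otimes>\<^bsub>B\<^esub> g)"
    using hom_cocycle[OF str(2)] by (simp add: B.dif_cocycle_mult)
  define R where "R = B.eps (\<phi> v') \<otimes>\<^bsub>B\<^esub> g \<oplus>\<^bsub>B\<^esub> B.eps e \<otimes>\<^bsub>B\<^esub> w1 \<oplus>\<^bsub>B\<^esub> \<phi> r \<oplus>\<^bsub>B\<^esub> B.eps e \<otimes>\<^bsub>B\<^esub> \<phi> s \<ominus>\<^bsub>B\<^esub> B.eps (\<phi> t) \<otimes>\<^bsub>B\<^esub> g"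
  have R [simp]: "R \<in> carrier B" by (simp add: R_def)
  have main: "v1 \<otimes>\<^bsub>B\<^esub> c \<ominus>\<^bsub>B\<^esub> B.eps a \<otimes>\<^bsub>B\<^esub> w1 = B.eps a \<otimes>\<^bsub>B\<^esub> \<phi> s \<oplus>\<^bsub>B\<^esub> \<phi> t \<otimes>\<^bsub>B\<^esub> c \<oplus>\<^bsub>B\<^esub> dif B R"
    unfolding v1_def ea
    by (subst B.massey_identity[OF _ _ _ _ _ _ _ _ _ _ _ _ _ _ _ _ _ _ c(3) w1_def e1 e2 m' e4 e5])
      (simp_all add: R_def B.dif_add B.dif_minus_eq)
  have "v \<otimes>\<^bsub>B\<^esub> c \<ominus>\<^bsub>B\<^esub> B.eps a \<otimes>\<^bsub>B\<^esub> w = (v1 \<otimes>\<^bsub>B\<^esub> c \<ominus>\<^bsub>B\<^esub> B.eps a \<otimes>\<^bsub>B\<^esub> w1) \<oplus>\<^bsub>B\<^esub> t1 \<otimes>\<^bsub>B\<^esub> c \<ominus>\<^bsub>B\<^esub> B.eps a \<otimes>\<^bsub>B\<^esub> s1"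
    unfolding vw2 by (simp add: B.ring_simprules)
  also have "\<dots> = B.eps a \<otimes>\<^bsub>B\<^esub> (\<phi> s \<ominus>\<^bsub>B\<^esub> s1) \<oplus>\<^bsub>B\<^esub> (\<phi> t \<oplus>\<^bsub>B\<^esub> t1) \<otimes>\<^bsub>B\<^esub> c \<oplus>\<^bsub>B\<^esub> dif B R"
    unfolding main by (simp add: B.ring_simprules)
  finally have "v \<otimes>\<^bsub>B\<^esub> c \<ominus>\<^bsub>B\<^esub> B.eps a \<otimes>\<^bsub>B\<^esub> w =
      B.eps a \<otimes>\<^bsub>B\<^esub> (\<phi> s \<ominus>\<^bsub>B\<^esub> s1) \<oplus>\<^bsub>B\<^esub> (\<phi> t \<oplus>\<^bsub>B\<^esub> t1) \<otimes>\<^bsub>B\<^esub> c \<oplus>\<^bsub>B\<^esub> dif B R" .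
  moreover have "\<phi> s \<ominus>\<^bsub>B\<^esub> s1 \<in> cocycles B (dif B)" "\<phi> t \<oplus>\<^bsub>B\<^esub> t1 \<in> cocycles B (dif B)"
    by (simp_all add: B.cocycles_iff B.dif_add B.dif_minus_eq st1c B.minus_eq[of _ "\<zero>\<^bsub>B\<^esub>"])
  ultimately show "\<exists>s\<in>cocycles B (dif B). \<exists>t\<in>cocycles B (dif B). \<exists>r\<in>carrier B.
      v \<otimes>\<^bsub>B\<^esub> c \<ominus>\<^bsub>B\<^esub> B.eps a \<otimes>\<^bsub>B\<^esub> w = B.eps a \<otimes>\<^bsub>B\<^esub> s \<oplus>\<^bsub>B\<^esub> t \<otimes>\<^bsub>B\<^esub> c \<oplus>\<^bsub>B\<^esub> dif B r"
    using R by blast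
qed

end

lemma dga_quasi_iso_massey:
  assumes "dga_quasi_iso A B \<phi>"
  shows "dg_algebra.massey_vanishing A \<longleftrightarrow> dg_algebra.massey_vanishing B"
proof -
  interpret dga_quasi_isomorphism A B \<phi>
    using assms by (simp add: dga_quasi_iso_def dga_quasi_isomorphism_def dga_quasi_isomorphism_axioms_def)
  show ?thesis using massey_vanishing_push massey_vanishing_reflect by blast
qed

lemma qis_adjacent_massey:
  assumes "qis_adjacent A B"
  shows "dg_algebra.massey_vanishing A \<longleftrightarrow> dg_algebra.massey_vanishing B"
  using assms unfolding qis_adjacent_def by (metis dga_quasi_iso_massey)

text \<open>Triple Massey products vanish in the cohomology algebra, which ends the zig-zag, and each
  step of the zig-zag preserves and reflects this property.\<close>

theorem formal_massey_vanishing: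
  fixes A :: "('k::field, 'a) dg_alg" and ty :: "'u itself"
  assumes "formal_in ty A"
  shows "dg_algebra.massey_vanishing A"
proof -
  obtain B C :: "('k, 'u) dg_alg" where AB: "qis_adjacent A B" and BC: "qis_adjacent\<^sup>*\<^sup>* B C" and CH: "qis_adjacent C (cohomology A)"
    using assms unfolding formal_in_def by auto
  interpret dg_algebra A using AB by (auto simp: qis_adjacent_def dga_quasi_iso_def)
  have H: "dg_algebra.massey_vanishing (cohomology A)"
    by (rule dg_algebra.massey_vanishing_zero_dif[OF coh_dg_algebra])
      (auto simp: coh_carrier coh_dif)
  have "dg_algebra.massey_vanishing B \<longleftrightarrow> dg_algebra.massey_vanishing C"
    using BC by (induction rule: rtranclp_induct) (auto dest: qis_adjacent_massey)
  then show ?thesis using H qis_adjacent_massey[OF AB] qis_adjacent_massey[OF CH] by blast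
qed

section \<open>Transfer along a contracting homotopy\<close>

text \<open>The last three conditions make the transferred structure stop after three inputs: the
  image of \<open>h\<close> is a right ideal of square zero on which \<open>h d\<close> is the identity, and \<open>h\<close> vanishes on
  left multiples of this image. The conditions without products are the usual ones for a
  contraction onto cohomology.\<close>

locale contracted_dga = dg_algebra A
  for A :: "('k::field, 'a) dg_alg" (structure) +
  fixes h :: "'a \<Rightarrow> 'a"
  assumes h_closed [simp, intro]: "x \<in> carrier A \<Longrightarrow> h x \<in> carrier A"
    and h_add: "x \<in> carrier A \<Longrightarrow> y \<in> carrier A \<Longrightarrow> h (x \<oplus> y) = h x \<oplus> h y"
    and h_smult: "x \<in> carrier A \<Longrightarrow> h (c \<odot> x) = c \<odot> h x"
    and h_homog: "x \<in> homog A n \<Longrightarrow> h x \<in> homog A (n - 1)"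
    and h_h [simp]: "x \<in> carrier A \<Longrightarrow> h (h x) = \<zero>"
    and h_dif_h [simp]: "x \<in> carrier A \<Longrightarrow> h (dif A (h x)) = h x"
    and dif_h_dif [simp]: "x \<in> carrier A \<Longrightarrow> dif A (h (dif A x)) = dif A x"
    and h_mult_right: "x \<in> carrier A \<Longrightarrow> y \<in> carrier A \<Longrightarrow> h (dif A (h x \<otimes> y)) = h x \<otimes> y"
    and h_mult_left [simp]: "x \<in> carrier A \<Longrightarrow> y \<in> carrier A \<Longrightarrow> h (x \<otimes> h y) = \<zero>"
    and h_mult_h [simp]: "x \<in> carrier A \<Longrightarrow> y \<in> carrier A \<Longrightarrow> h x \<otimes> h y = \<zero>"
begin

lemma h_zero [simp]: "h \<zero> = \<zero>"
  using h_smult[of \<zero> 0] by simp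

lemma h_minus: "x \<in> carrier A \<Longrightarrow> h (\<ominus> x) = \<ominus> (h x)"
  using h_smult[of x "-1"] by (simp add: smult_minus_one)

lemma h_minus_eq: "x \<in> carrier A \<Longrightarrow> y \<in> carrier A \<Longrightarrow> h (x \<ominus> y) = h x \<ominus> h y"
  by (simp add: a_minus_def h_add h_minus)

lemma h_eps: "x \<in> carrier A \<Longrightarrow> h (eps x) = \<ominus> (eps (h x))"
proof (induction rule: homog_induct)
  case (homog n x)
  have "(-1) powi (n - 1) = - ((-1) powi n :: 'k)" by (simp add: power_int_diff)
  then show ?case using homog smult_minus_one[of "(-1) powi n \<odot> h x"]
    by (simp add: eps_of_homog[OF h_homog] eps_of_homog h_smult)
qed (auto simp: eps_add h_add minus_add)

lemma h_h_mult [simp]: "x \<in> carrier A \<Longrightarrow> y \<in> carrier A \<Longrightarrow> h (h x \<otimes> y) = \<zero>"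
  using h_h[of "dif A (h x \<otimes> y)"] by (simp add: h_mult_right)

text \<open>The projection onto the elements with \<open>d x = 0\<close> and \<open>h x = 0\<close>. They represent the
  cohomology classes uniquely.\<close>

definition pi :: "'a \<Rightarrow> 'a" where
  "pi x = x \<ominus> dif A (h x) \<ominus> h (dif A x)"

lemma pi_closed [simp, intro]: "x \<in> carrier A \<Longrightarrow> pi x \<in> carrier A"
  by (simp add: pi_def)

lemma pi_add: "x \<in> carrier A \<Longrightarrow> y \<in> carrier A \<Longrightarrow> pi (x \<oplus> y) = pi x \<oplus> pi y"
  by (simp add: pi_def h_add dif_add) (simp add: ring_simprules)

lemma pi_smult: "x \<in> carrier A \<Longrightarrow> pi (c \<odot> x) = c \<odot> pi x"
  by (simp add: pi_def h_smult dif_smult a_minus_def smult_add_right smult_minus_right)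

lemma pi_minus: "x \<in> carrier A \<Longrightarrow> pi (\<ominus> x) = \<ominus> (pi x)"
  using pi_smult[of x "-1"] by (simp add: smult_minus_one)

lemma pi_zero [simp]: "pi \<zero> = \<zero>"
  by (simp add: pi_def minus_eq)

lemma pi_homog: "x \<in> homog A n \<Longrightarrow> pi x \<in> homog A n"
  using h_homog[of x n] dif_homog[of x n] h_homog[of "dif A x" "n + 1"] dif_homog[of "h x" "n - 1"]
  by (simp add: pi_def a_minus_def homog_add homog_minus)

lemma dif_pi [simp]: "x \<in> carrier A \<Longrightarrow> dif A (pi x) = \<zero>"
  by (simp add: pi_def dif_minus_eq dif_dif) (simp add: ring_simprules)

lemma h_pi [simp]: "x \<in> carrier A \<Longrightarrow> h (pi x) = \<zero>"
  by (simp add: pi_def h_minus_eq) (simp add: ring_simprules)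

lemma pi_dif [simp]: "x \<in> carrier A \<Longrightarrow> pi (dif A x) = \<zero>"
  by (simp add: pi_def dif_dif) (simp add: ring_simprules)

lemma pi_h [simp]: "x \<in> carrier A \<Longrightarrow> pi (h x) = \<zero>"
  by (simp add: pi_def) (simp add: ring_simprules)

lemma pi_h_mult [simp]: "x \<in> carrier A \<Longrightarrow> y \<in> carrier A \<Longrightarrow> pi (h x \<otimes> y) = \<zero>"
  using pi_h[of "dif A (h x \<otimes> y)"] by (simp add: h_mult_right)

lemma pi_eps: "x \<in> carrier A \<Longrightarrow> pi (eps x) = eps (pi x)"
  by (simp add: pi_def h_eps dif_eps h_minus dif_minus eps_add eps_minus a_minus_def)

lemma pi_harmonic: "x \<in> carrier A \<Longrightarrow> dif A x = \<zero> \<Longrightarrow> h x = \<zero> \<Longrightarrow> pi x = x"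
  by (simp add: pi_def minus_eq)

lemma pi_pi [simp]: "x \<in> carrier A \<Longrightarrow> pi (pi x) = pi x"
  by (rule pi_harmonic) auto

lemma pi_cocycle: "x \<in> cocycles A (dif A) \<Longrightarrow> pi x = x \<ominus> dif A (h x)"
  by (simp add: pi_def cocycles_iff minus_eq)

lemma pi_in_cocycles [simp]: "x \<in> carrier A \<Longrightarrow> pi x \<in> cocycles A (dif A)"
  by (simp add: cocycles_iff)

lemma pi_of_left_mult_h: "x \<in> carrier A \<Longrightarrow> y \<in> carrier A \<Longrightarrow> pi (x \<otimes> h y) = x \<otimes> h y \<ominus> h (dif A (x \<otimes> h y))"
  by (simp add: pi_def) (simp add: ring_simprules)

text \<open>The next two lemmas compare the homotopy of a product of cocycles with the homotopy after
  projecting one factor. If the left factor is projected, the correction lies in the right ideal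
  \<open>h A\<close>, where \<open>h d\<close> is the identity. If the right factor is projected, a projection remains,
  because the image of \<open>h\<close> need not be a left ideal.\<close>

lemma h_pi_mult:
  assumes u: "u \<in> cocycles A (dif A)" and x: "x \<in> cocycles A (dif A)"
  shows "h (pi u \<otimes> x) = h (u \<otimes> x) \<ominus> h u \<otimes> x"
proof -
  have [simp]: "x \<in> carrier A" "u \<in> carrier A" "dif A x = \<zero>" using x u by (auto simp: cocycles_iff)
  have "pi u \<otimes> x = u \<otimes> x \<ominus> dif A (h u \<otimes> x)"
    by (simp add: pi_cocycle[OF u] dif_mult) (simp add: ring_simprules)
  then show ?thesis by (simp add: h_minus_eq h_mult_right)
qed

lemma h_mult_pi:
  assumes x: "x \<in> cocycles A (dif A)" and u: "u \<in> cocycles A (dif A)"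
  shows "h (x \<otimes> pi u) = h (x \<otimes> u) \<ominus> eps x \<otimes> h u \<oplus> pi (eps x \<otimes> h u)"
proof -
  have [simp]: "x \<in> carrier A" "u \<in> carrier A" using x u by (auto simp: cocycles_iff)
  have "x \<otimes> pi u = x \<otimes> u \<ominus> dif A (eps x \<otimes> h u)"
    using dif_cocycle_mult(1)[OF x, of "h u"] by (simp add: pi_cocycle[OF u]) (simp add: ring_simprules)
  then have "h (x \<otimes> pi u) = h (x \<otimes> u) \<ominus> h (dif A (eps x \<otimes> h u))"
    by (simp add: h_minus_eq)
  then show ?thesis by (simp add: pi_of_left_mult_h) (simp add: ring_simprules neg_cancel)
qed

text \<open>The correction term is \<open>(d \<epsilon>(h u)) (h w)\<close>. Differentiating \<open>\<epsilon>(h u) (h w) = 0\<close> turns it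
  into an element of the right ideal \<open>h A\<close>, on which \<open>\<pi>\<close> is zero.\<close>

lemma pi_eps_pi_mult_h:
  assumes u: "u \<in> cocycles A (dif A)" and w [simp]: "w \<in> carrier A"
  shows "pi (eps (pi u) \<otimes> h w) = pi (eps u \<otimes> h w)"
proof -
  have [simp]: "u \<in> carrier A" "dif A u = \<zero>" using u by (auto simp: cocycles_iff)
  have hu: "eps (h u) = h (\<ominus> eps u)" by (simp add: h_minus h_eps eps_minus)
  have e0: "eps (h u) \<otimes> h w = \<zero>" unfolding hu by simp
  have "dif A (eps (h u) \<otimes> h w) = dif A (eps (h u)) \<otimes> h w \<oplus> h u \<otimes> dif A (h w)"
    by (simp add: dif_mult)
  then have e1: "\<zero> = dif A (eps (h u)) \<otimes> h w \<oplus> h u \<otimes> dif A (h w)" unfolding e0 by simp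
  have "eps (pi u) = eps u \<oplus> dif A (eps (h u))"
    by (simp add: pi_cocycle[OF u] a_minus_def eps_add eps_minus dif_eps)
  then have "pi (eps (pi u) \<otimes> h w) = pi (eps u \<otimes> h w) \<oplus> pi (dif A (eps (h u)) \<otimes> h w)"
    by (simp add: l_distr pi_add)
  also have "dif A (eps (h u)) \<otimes> h w = \<ominus> (h u \<otimes> dif A (h w))"
    using e1 by (intro minus_equality[symmetric]) (simp_all)
  finally show ?thesis by (simp add: pi_minus)
qed

text \<open>The projection of \<open>y (h w)\<close> differs from \<open>y (h w)\<close> by an element of the right ideal \<open>h A\<close>.
  This and the next three statements follow from the behaviour of \<open>h\<close> and \<open>\<pi>\<close> on this ideal.\<close>

lemma pi_pi_mult:
  "y \<in> carrier A \<Longrightarrow> w \<in> carrier A \<Longrightarrow> x \<in> carrier A \<Longrightarrow> pi (pi (y \<otimes> h w) \<otimes> x) = pi (y \<otimes> h w \<otimes> x)"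
  by (simp add: pi_of_left_mult_h a_minus_def l_distr l_minus pi_add pi_minus)

lemma pi_mult_h_mult_h:
  "y \<in> carrier A \<Longrightarrow> w \<in> carrier A \<Longrightarrow> x \<in> carrier A \<Longrightarrow> pi (y \<otimes> h w) \<otimes> h x = \<zero>"
  by (simp add: pi_of_left_mult_h a_minus_def l_distr l_minus m_assoc)

lemma h_pi_mult_h_mult:
  assumes [simp]: "y \<in> carrier A" "w \<in> carrier A" "x \<in> carrier A"
  shows "h (pi (y \<otimes> h w) \<otimes> x) = \<zero>"
proof -
  have "h (y \<otimes> h w \<otimes> x) = h (y \<otimes> h (dif A (h w \<otimes> x)))" by (simp add: m_assoc h_mult_right)
  then have "h (y \<otimes> h w \<otimes> x) = \<zero>" by simp
  then show ?thesis by (simp add: pi_of_left_mult_h a_minus_def l_distr l_minus h_add h_minus)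
qed

lemma h_mult_pi_mult_h:
  assumes [simp]: "y \<in> carrier A" "w \<in> carrier A" "x \<in> carrier A"
  shows "h (x \<otimes> pi (y \<otimes> h w)) = \<zero>"
proof -
  have "h (x \<otimes> (y \<otimes> h w)) = \<zero>" using h_mult_left[of "x \<otimes> y" w] by (simp add: m_assoc)
  then show ?thesis by (simp add: pi_of_left_mult_h a_minus_def r_distr r_minus h_add h_minus)
qed

text \<open>The ternary operation on representatives. Of the two binary trees with three leaves only
  \<open>x (h (y z))\<close> contributes, since \<open>(h (x y)) z\<close> lies in the right ideal \<open>h A\<close>, where \<open>\<pi>\<close> is
  zero.\<close>

definition mu3 :: "'a \<Rightarrow> 'a \<Rightarrow> 'a \<Rightarrow> 'a" where
  "mu3 x y z = \<ominus> pi (eps x \<otimes> h (y \<otimes> z))"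

lemma mu3_closed [simp]:
  assumes "x \<in> carrier A" "y \<in> carrier A" "z \<in> carrier A"
  shows "mu3 x y z \<in> carrier A" "dif A (mu3 x y z) = \<zero>" "h (mu3 x y z) = \<zero>" "pi (mu3 x y z) = mu3 x y z"
    "mu3 x y z \<in> cocycles A (dif A)"
proof -
  have "eps x \<otimes> h (y \<otimes> z) \<in> carrier A" using assms by auto
  then have t: "\<ominus> pi t \<in> carrier A \<and> dif A (\<ominus> pi t) = \<zero> \<and> h (\<ominus> pi t) = \<zero> \<and> pi (\<ominus> pi t) = \<ominus> pi t"
    if "t = eps x \<otimes> h (y \<otimes> z)" for t
    using that by (simp add: dif_minus h_minus pi_minus)
  show "mu3 x y z \<in> carrier A" "dif A (mu3 x y z) = \<zero>" "h (mu3 x y z) = \<zero>" "pi (mu3 x y z) = mu3 x y z"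
    "mu3 x y z \<in> cocycles A (dif A)"
    unfolding mu3_def using t[OF refl] by (simp_all only: cocycles_iff simp_thms)
qed

lemma mu3_homog:
  assumes "x \<in> homog A l" "y \<in> homog A m" "z \<in> homog A n"
  shows "mu3 x y z \<in> homog A (l + m + n - 1)"
proof -
  have "\<ominus> pi (eps x \<otimes> h (y \<otimes> z)) \<in> homog A (l + (m + n - 1))"
    by (intro homog_minus pi_homog mult_homog eps_homog h_homog assms)
  then show ?thesis by (simp add: mu3_def add_diff_eq add.assoc)
qed

text \<open>The \<open>A\<^sub>\<infinity>\<close>-relation for four inputs, on representatives. All five terms reduce to four
  projected products, which cancel in pairs.\<close>

lemma mu3_relation4:
  assumes "x \<in> cocycles A (dif A)" "y \<in> cocycles A (dif A)" "z \<in> cocycles A (dif A)" "w \<in> cocycles A (dif A)"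
  shows "mu3 (pi (x \<otimes> y)) z w \<ominus> mu3 x (pi (y \<otimes> z)) w \<oplus> mu3 x y (pi (z \<otimes> w)) \<ominus> pi (mu3 x y z \<otimes> w)
    \<ominus> pi (eps x \<otimes> mu3 y z w) = \<zero>"
proof -
  have [simp]: "x \<in> carrier A" "y \<in> carrier A" "z \<in> carrier A" "w \<in> carrier A"
    using assms by (auto simp: cocycles_iff)
  have prod: "x \<otimes> y \<in> cocycles A (dif A)" "y \<otimes> z \<in> cocycles A (dif A)" "z \<otimes> w \<in> cocycles A (dif A)"
    using assms by (auto simp: cocycles_iff dif_mult)
  let ?P1 = "pi (eps x \<otimes> eps y \<otimes> h (z \<otimes> w))" and ?P2 = "pi (eps x \<otimes> h (y \<otimes> (z \<otimes> w)))"
  let ?P3 = "pi (eps x \<otimes> h (y \<otimes> z) \<otimes> w)" and ?P4 = "pi (eps x \<otimes> pi (eps y \<otimes> h (z \<otimes> w)))"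
  have 1: "mu3 (pi (x \<otimes> y)) z w = \<ominus> ?P1"
    by (simp add: mu3_def pi_eps_pi_mult_h[OF prod(1)] eps_mult)
  have 2: "mu3 x (pi (y \<otimes> z)) w = \<ominus> ?P2 \<oplus> ?P3"
    by (simp add: mu3_def h_pi_mult[OF prod(2) assms(4)] r_distr r_minus a_minus_def pi_add pi_minus m_assoc minus_add)
  have 3: "mu3 x y (pi (z \<otimes> w)) = \<ominus> ?P2 \<oplus> ?P1 \<ominus> ?P4"
    by (simp add: mu3_def h_mult_pi[OF assms(2) prod(3)] r_distr r_minus a_minus_def pi_add pi_minus m_assoc minus_add)
  have 4: "pi (mu3 x y z \<otimes> w) = \<ominus> ?P3"
    using pi_pi_mult[of "eps x" "y \<otimes> z" w] by (simp add: mu3_def l_minus pi_minus)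
  have 5: "pi (eps x \<otimes> mu3 y z w) = \<ominus> ?P4"
    by (simp add: mu3_def r_minus pi_minus)
  have "\<ominus> P1 \<ominus> (\<ominus> P2 \<oplus> P3) \<oplus> (\<ominus> P2 \<oplus> P1 \<ominus> P4) \<ominus> (\<ominus> P3) \<ominus> (\<ominus> P4) = \<zero>"
    if "P1 \<in> carrier A" "P2 \<in> carrier A" "P3 \<in> carrier A" "P4 \<in> carrier A" for P1 P2 P3 P4
    using that by (simp add: ring_simprules neg_cancel)
  then show ?thesis unfolding 1 2 3 4 5 by simp
qed

text \<open>In the relation for five inputs every term vanishes by itself, because an operation inside
  \<open>mu3\<close> is the projection of a left multiple of the image of \<open>h\<close>.\<close>

lemma mu3_relation5:
  assumes "x \<in> cocycles A (dif A)" "y \<in> cocycles A (dif A)" "z \<in> cocycles A (dif A)" "v \<in> cocycles A (dif A)"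
    "w \<in> cocycles A (dif A)"
  shows "mu3 (mu3 x y z) v w = \<zero>" "mu3 x (mu3 y z v) w = \<zero>" "mu3 x y (mu3 z v w) = \<zero>"
proof -
  have car [simp]: "x \<in> carrier A" "y \<in> carrier A" "z \<in> carrier A" "v \<in> carrier A" "w \<in> carrier A"
    using assms by (auto simp: cocycles_iff)
  have "eps (pi (eps x \<otimes> h (y \<otimes> z))) = pi (x \<otimes> h (\<ominus> eps (y \<otimes> z)))"
    by (simp add: pi_eps[symmetric] eps_mult[of _ "h _"] h_minus h_eps eps_minus)
  then show "mu3 (mu3 x y z) v w = \<zero>"
    using pi_mult_h_mult_h[of x "\<ominus> eps (y \<otimes> z)" "v \<otimes> w"]
    by (simp add: mu3_def eps_minus l_minus)
  show "mu3 x (mu3 y z v) w = \<zero>"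
    using h_pi_mult_h_mult[of "eps y" "z \<otimes> v" w] by (simp add: mu3_def l_minus h_minus)
  show "mu3 x y (mu3 z v w) = \<zero>"
    using h_mult_pi_mult_h[of "eps z" "v \<otimes> w" y] by (simp add: mu3_def r_minus h_minus)
qed

text \<open>The morphism equation for three inputs, for the morphism with second component
  \<open>(x, y) \<mapsto> - h (x y)\<close>.\<close>

lemma mu3_homotopy:
  assumes "x \<in> cocycles A (dif A)" "y \<in> cocycles A (dif A)" "z \<in> cocycles A (dif A)"
  shows "mu3 x y z \<ominus> h (pi (x \<otimes> y) \<otimes> z) \<oplus> h (x \<otimes> pi (y \<otimes> z)) = h (x \<otimes> y) \<otimes> z \<ominus> eps x \<otimes> h (y \<otimes> z)"
proof -
  have [simp]: "x \<in> carrier A" "y \<in> carrier A" "z \<in> carrier A"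
    using assms by (auto simp: cocycles_iff)
  have prod: "x \<otimes> y \<in> cocycles A (dif A)" "y \<otimes> z \<in> cocycles A (dif A)"
    using assms by (auto simp: cocycles_iff dif_mult)
  show ?thesis
    unfolding mu3_def h_pi_mult[OF prod(1) assms(3)] h_mult_pi[OF assms(1) prod(2)]
    by (simp add: ring_simprules neg_cancel)
qed

end

section \<open>Dg algebras as A-infinity algebras\<close>

text \<open>The cases distinguish how many inputs stand to the left and to the right of a given one,
  up to three inputs in total; longer lists occur only where all operations vanish.\<close>

lemma context_cases:
  obtains "xs = []" "zs = []" | a where "xs = [a]" "zs = []" | a where "xs = []" "zs = [a]"
    | a b where "xs = [a, b]" "zs = []" | a b where "xs = [a]" "zs = [b]" | a b where "xs = []" "zs = [a, b]"
    | "length xs + length zs > 2"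
proof -
  have "(xs = [] \<and> zs = []) \<or> (\<exists>a. xs = [a] \<and> zs = []) \<or> (\<exists>a. xs = [] \<and> zs = [a]) \<or>
      (\<exists>a b. xs = [a, b] \<and> zs = []) \<or> (\<exists>a b. xs = [a] \<and> zs = [b]) \<or> (\<exists>a b. xs = [] \<and> zs = [a, b]) \<or>
      length xs + length zs > 2"
    by (cases xs; cases "tl xs"; cases zs; cases "tl zs"; cases "tl (tl xs)"; cases "tl (tl zs)") auto
  then show thesis by (elim disjE exE conjE) (rule that; assumption)+
qed

lemma finite_compositions [simp]: "finite (compositions n)"
proof (rule finite_subset)
  show "compositions n \<subseteq> {is. set is \<subseteq> {..n} \<and> length is \<le> n}"
  proof (clarsimp simp: compositions_def, intro conjI subsetI)
    fix "is" :: "nat list" and i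
    assume pos: "\<forall>i\<in>set is. Suc 0 \<le> i"
    show "length is \<le> sum_list is" using pos by (induction "is") auto
    show "i \<in> {..sum_list is}" if "i \<in> set is" using member_le_sum_list[OF that] by simp
  qed
qed (simp add: finite_lists_length_le)

context graded_space
begin

text \<open>Only the terms of the sum in which some operation can be nonzero have to be written out.\<close>

lemma insertions_support:
  fixes g :: "'c list \<Rightarrow> 'a"
  assumes "S \<subseteq> {(r, s). 1 \<le> s \<and> r + s \<le> length xs}"
    and "\<And>r s. 1 \<le> s \<Longrightarrow> r + s \<le> length xs \<Longrightarrow> g (take r xs @ [m (take s (drop r xs))] @ drop (r + s) xs) \<in> carrier V"
    and "\<And>r s. 1 \<le> s \<Longrightarrow> r + s \<le> length xs \<Longrightarrow> (r, s) \<notin> S \<Longrightarrow>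
      g (take r xs @ [m (take s (drop r xs))] @ drop (r + s) xs) = \<zero>"
  shows "insertions V m g xs ds = finsum V (\<lambda>(r, s).
        (-1) powi (int r + int s * int (length xs - r - s) + (2 - int s) * sum_list (take r ds)) \<odot>
        g (take r xs @ [m (take s (drop r xs))] @ drop (r + s) xs)) S"
proof -
  have "finite {(r, s). 1 \<le> s \<and> r + s \<le> length xs}"
    by (rule finite_subset[of _ "{..length xs} \<times> {..length xs}"]) auto
  then show ?thesis
    unfolding insertions_def by (rule finsum_mono_neutral[OF _ assms(1)]) (use assms(2,3) in auto)
qed

end

context dg_algebra
begin

lemma dga_ops_eq_zero: "length xs \<noteq> 1 \<Longrightarrow> length xs \<noteq> 2 \<Longrightarrow> dga_ops A xs = \<zero>"
  by (cases "(A, xs)" rule: dga_ops.cases) auto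

lemma dga_ops_long: "length xs > 2 \<Longrightarrow> dga_ops A xs = \<zero>"
  by (simp add: dga_ops_eq_zero)

lemma dga_ops_zero: "set xs \<subseteq> carrier A \<Longrightarrow> \<zero> \<in> set xs \<Longrightarrow> dga_ops A xs = \<zero>"
  by (cases "(A, xs)" rule: dga_ops.cases) auto

lemma dga_ops_closed: "set xs \<subseteq> carrier A \<Longrightarrow> dga_ops A xs \<in> carrier A"
  by (cases "(A, xs)" rule: dga_ops.cases) auto

lemma dga_ops_multilinear: "multilinear A A 2 (dga_ops A)"
  unfolding multilinear_def
proof (intro conjI allI impI; (elim conjE)?)
  show "dga_ops A xs \<in> carrier A" if "set xs \<subseteq> carrier A" for xs
    using that by (rule dga_ops_closed)
  show "dga_ops A (xs @ [x \<oplus> y] @ zs) = dga_ops A (xs @ [x] @ zs) \<oplus> dga_ops A (xs @ [y] @ zs)"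
    if "set xs \<subseteq> carrier A" "x \<in> carrier A" "y \<in> carrier A" "set zs \<subseteq> carrier A" for xs x y zs
    using that by (cases rule: context_cases[of xs zs]) (auto simp: dif_add l_distr r_distr dga_ops_long)
  show "dga_ops A (xs @ [c \<odot> x] @ zs) = c \<odot> dga_ops A (xs @ [x] @ zs)"
    if "set xs \<subseteq> carrier A" "x \<in> carrier A" "set zs \<subseteq> carrier A" for xs c x zs
    using that by (cases rule: context_cases[of xs zs])
      (auto simp: dif_smult smult_mult_left smult_mult_right dga_ops_long)
  show "dga_ops A xs \<in> homog A (sum_list ds + 2 - int (length xs))" if "has_degrees A xs ds" for xs ds
  proof -
    have "dif A x \<in> homog A (1 + n)" if "x \<in> homog A n" for x n
      using dif_homog[OF that] by (simp add: add.commute)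
    then show ?thesis using that by (cases "(A, xs)" rule: dga_ops.cases)
      (auto simp: has_degrees_def list_all2_Cons1 mult_homog)
  qed
qed

lemma dga_a_infinity: "a_infinity_algebra A (dga_ops A)"
  unfolding a_infinity_algebra_def
proof (intro conjI allI impI; (elim conjE)?)
  show "graded_space A" by (rule graded_space_axioms)
  show "multilinear A A 2 (dga_ops A)" by (rule dga_ops_multilinear)
  fix xs ds
  assume xs: "xs \<noteq> []" and deg: "has_degrees A xs ds"
  have car: "set xs \<subseteq> carrier A"
    using deg by (auto simp: has_degrees_def list_all2_conv_all_nth set_conv_nth)
  let ?g = "\<lambda>r s. dga_ops A (take r xs @ [dga_ops A (take s (drop r xs))] @ drop (r + s) xs)"
  let ?t = "\<lambda>(r, s). (-1) powi (int r + int s * int (length xs - r - s) + (2 - int s) * sum_list (take r ds)) \<odot> ?g r s"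
  have sub: "set (take r xs) \<subseteq> carrier A" "set (drop r xs) \<subseteq> carrier A" "set (take s (drop r xs)) \<subseteq> carrier A" for r s
    using car set_take_subset set_drop_subset by (metis subset_trans)+
  have clo: "?g r s \<in> carrier A" for r s
    by (intro dga_ops_closed) (simp add: sub dga_ops_closed)
  have z1: "?g r s = \<zero>" if "s > 2" "r + s \<le> length xs" for r s
    using that by (intro dga_ops_zero) (simp_all add: sub dga_ops_closed dga_ops_long)
  have z2: "?g r s = \<zero>" if "length xs + 1 - s > 2" "r + s \<le> length xs" for r s
    using that by (intro dga_ops_eq_zero) auto
  note supp = insertions_support[where g = "dga_ops A" and m = "dga_ops A" and xs = xs, OF _ clo]
  show "insertions A (dga_ops A) (dga_ops A) xs ds = \<zero>"
  proof -
    consider "length xs = 1" | "length xs = 2" | "length xs = 3" | "length xs > 3"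
      using xs by (cases "length xs"; cases "length xs - 1"; cases "length xs - 2"; cases "length xs - 3") auto
    then show ?thesis
    proof cases
      case 1
      then obtain a where "xs = [a]" by (auto simp: length_Suc_conv)
      then have a: "xs = [a]" "a \<in> carrier A" using car by auto
      have "insertions A (dga_ops A) (dga_ops A) xs ds =
          finsum A ?t {(0, 1)}"
        by (rule supp) (auto simp: a(1) le_Suc_eq)
      then show ?thesis using a by (simp add: dif_dif)
    next
      case 2
      then obtain a b where ab: "xs = [a, b]" by (auto simp: length_Suc_conv numeral_2_eq_2)
      then obtain k l where ds: "ds = [k, l]" and hom: "a \<in> homog A k" "b \<in> homog A l"
        using deg by (auto simp: has_degrees_def list_all2_Cons1)
      have [simp]: "a \<in> carrier A" "b \<in> carrier A" using hom by auto
      have "insertions A (dga_ops A) (dga_ops A) xs ds =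
          finsum A ?t {(0, 1), (1, 1), (0, 2)}"
        by (rule supp) (auto simp: ab le_Suc_eq)
      also have "\<dots> = (-1) \<odot> (dif A a \<otimes> b) \<oplus> ((-1) powi (1 + k) \<odot> (a \<otimes> dif A b) \<oplus> dif A (a \<otimes> b))"
        using hom by (simp add: ab ds numeral_2_eq_2)
      also have "\<dots> = \<zero>"
        using smult_minus_one[of "(- 1) powi k \<odot> (a \<otimes> dif A b)"]
        by (simp add: leibniz[OF hom(1)] power_int_add smult_minus_one) (simp add: ring_simprules neg_cancel)
      finally show ?thesis .
    next
      case 3
      then obtain a b c where ab: "xs = [a, b, c]" by (auto simp: length_Suc_conv numeral_3_eq_3)
      have [simp]: "a \<in> carrier A" "b \<in> carrier A" "c \<in> carrier A" using car ab by auto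
      have "insertions A (dga_ops A) (dga_ops A) xs ds =
          finsum A ?t {(0, 2), (1, 2)}"
      proof (rule supp)
        show "?g r s = \<zero>" if "1 \<le> s" "r + s \<le> length xs" "(r, s) \<notin> {(0, 2), (1, 2)}" for r s
        proof (cases "s > 2")
          case False
          then have "s = 1" using that by (auto simp: ab)
          then show ?thesis using z2[of s r] that by (simp add: ab)
        qed (use z1 that in auto)
      qed (use ab in auto)
      also have "\<dots> = (a \<otimes> b) \<otimes> c \<oplus> (-1) \<odot> (a \<otimes> (b \<otimes> c))"
        by (simp add: ab numeral_2_eq_2)
      also have "\<dots> = \<zero>" by (simp add: m_assoc smult_minus_one r_neg)
      finally show ?thesis .
    next
      case 4
      have "insertions A (dga_ops A) (dga_ops A) xs ds =
          finsum A ?t {}"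
      proof (rule supp)
        show "?g r s = \<zero>" if "1 \<le> s" "r + s \<le> length xs" for r s
          using z1[of s r] z2[of s r] that 4 by (cases "s > 2") auto
      qed auto
      then show ?thesis by simp
    qed
  qed
qed

end

section \<open>The transferred A-infinity structure\<close>

context contracted_dga
begin

abbreviation coh :: "('k, 'a set) dg_alg" where
  "coh \<equiv> cohomology A"

text \<open>The representative of a class in the image of \<open>\<pi>\<close>. The choice of the cocycle does not
  matter, because \<open>\<pi>\<close> is zero on coboundaries.\<close>

definition rep :: "'a set \<Rightarrow> 'a" where
  "rep S = pi (SOME x. x \<in> cocycles A (dif A) \<and> cls x = S)"

lemma rep_cls:
  assumes "x \<in> cocycles A (dif A)"
  shows "rep (cls x) = pi x"
proof -
  define y where "y = (SOME y. y \<in> cocycles A (dif A) \<and> cls y = cls x)"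
  have y: "y \<in> cocycles A (dif A)" "cls y = cls x"
    using someI[of "\<lambda>y. y \<in> cocycles A (dif A) \<and> cls y = cls x" x] assms unfolding y_def by auto
  then obtain z where "z \<in> carrier A" "y = x \<oplus> dif A z" using cls_eq_iff[OF y(1) assms] by auto
  then have "pi y = pi x" using assms by (simp add: pi_add cocycles_iff)
  then show ?thesis by (simp add: rep_def y_def)
qed

lemma cls_pi: "x \<in> cocycles A (dif A) \<Longrightarrow> cls (pi x) = cls x"
  by (subst cls_eq_iff)
    (auto simp: pi_cocycle cocycles_iff a_minus_def dif_add dif_dif dif_minus intro!: bexI[of _ "\<ominus> h x"])

context
  fixes S assumes S: "S \<in> carrier coh"
begin

lemma rep_closed [simp]: "rep S \<in> carrier A"
  and rep_cocycle [simp]: "rep S \<in> cocycles A (dif A)"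
  and dif_rep [simp]: "dif A (rep S) = \<zero>"
  and cls_rep [simp]: "cls (rep S) = S"
  using S by (auto elim!: cohE simp: rep_cls cls_pi cocycles_iff)

end

lemma rep_homog:
  assumes "S \<in> homog coh n"
  shows "rep S \<in> homog A n" and "S \<in> carrier coh"
  using assms by (auto simp: coh_homog rep_cls coh_carrier intro: pi_homog)

lemma rep_add: "S \<in> carrier coh \<Longrightarrow> T \<in> carrier coh \<Longrightarrow> rep (S \<oplus>\<^bsub>coh\<^esub> T) = rep S \<oplus> rep T"
  by (auto elim!: cohE simp: coh_add rep_cls pi_add cocycles_iff dif_add)

lemma rep_smult: "S \<in> carrier coh \<Longrightarrow> rep (c \<odot>\<^bsub>coh\<^esub> S) = c \<odot> rep S"
  by (auto elim!: cohE simp: coh_smult rep_cls pi_smult cocycles_iff dif_smult)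

lemma rep_mult: "S \<in> carrier coh \<Longrightarrow> T \<in> carrier coh \<Longrightarrow> rep (S \<otimes>\<^bsub>coh\<^esub> T) = pi (rep S \<otimes> rep T)"
  using coh_mult[OF rep_cocycle rep_cocycle, of S T] rep_cls[of "rep S \<otimes> rep T"]
  by (auto simp: cocycles_iff dif_mult)

lemma rep_zero [simp]: "rep \<zero>\<^bsub>coh\<^esub> = \<zero>"
  by (simp add: coh_zero rep_cls cocycles_iff)

text \<open>By the tree formula the transferred operations are sums over planar binary trees with \<open>h\<close>
  on the inner edges and \<open>\<pi>\<close> at the root. If a tree does not vanish, then the left branch at its
  root is a leaf, as \<open>\<pi>\<close> is zero on the right ideal \<open>h A\<close>, and both branches at any other node are
  leaves, as \<open>h\<close> is zero on \<open>h A\<close> and on its left multiples. So the tree has at most three leaves,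
  and at most two in the components of the quasi-isomorphism, where the root carries \<open>h\<close> as well.\<close>

fun transferred_ops :: "'a set list \<Rightarrow> 'a set" where
  "transferred_ops [S, T] = S \<otimes>\<^bsub>coh\<^esub> T"
| "transferred_ops [S, T, R] = cls (mu3 (rep S) (rep T) (rep R))"
| "transferred_ops _ = \<zero>\<^bsub>coh\<^esub>"

fun transferred_map :: "'a set list \<Rightarrow> 'a" where
  "transferred_map [S] = rep S"
| "transferred_map [S, T] = \<ominus> h (rep S \<otimes> rep T)"
| "transferred_map _ = \<zero>"

lemma rep_mu3: "S \<in> carrier coh \<Longrightarrow> T \<in> carrier coh \<Longrightarrow> R \<in> carrier coh \<Longrightarrow>
    rep (cls (mu3 (rep S) (rep T) (rep R))) = mu3 (rep S) (rep T) (rep R)"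
  by (simp add: rep_cls)

lemma cls_closed [simp]: "x \<in> cocycles A (dif A) \<Longrightarrow> cls x \<in> carrier coh"
  by (auto simp: coh_carrier)

lemma transferred_ops_eq_zero: "length xs \<noteq> 2 \<Longrightarrow> length xs \<noteq> 3 \<Longrightarrow> transferred_ops xs = \<zero>\<^bsub>coh\<^esub>"
  by (cases xs rule: transferred_ops.cases) auto

lemma transferred_map_eq_zero: "length xs \<noteq> 1 \<Longrightarrow> length xs \<noteq> 2 \<Longrightarrow> transferred_map xs = \<zero>"
  by (cases xs rule: transferred_map.cases) auto

lemma transferred_ops_long: "length xs > 3 \<Longrightarrow> transferred_ops xs = \<zero>\<^bsub>coh\<^esub>"
  by (simp add: transferred_ops_eq_zero)

lemma transferred_map_long: "length xs > 2 \<Longrightarrow> transferred_map xs = \<zero>"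
  by (simp add: transferred_map_eq_zero)

lemma mu3_zero [simp]:
  assumes "x \<in> carrier A" "y \<in> carrier A"
  shows "mu3 \<zero> x y = \<zero>" "mu3 x \<zero> y = \<zero>" "mu3 x y \<zero> = \<zero>"
  using assms by (simp_all add: mu3_def)

lemma transferred_ops_closed: "set xs \<subseteq> carrier coh \<Longrightarrow> transferred_ops xs \<in> carrier coh"
proof -
  interpret H: dg_algebra coh by (rule coh_dg_algebra)
  show "set xs \<subseteq> carrier coh \<Longrightarrow> transferred_ops xs \<in> carrier coh"
    by (cases xs rule: transferred_ops.cases) auto
qed

lemma transferred_map_closed: "set xs \<subseteq> carrier coh \<Longrightarrow> transferred_map xs \<in> carrier A"
  by (cases xs rule: transferred_map.cases) auto

lemma transferred_ops_zero: "set xs \<subseteq> carrier coh \<Longrightarrow> \<zero>\<^bsub>coh\<^esub> \<in> set xs \<Longrightarrow> transferred_ops xs = \<zero>\<^bsub>coh\<^esub>"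
proof -
  interpret H: dg_algebra coh by (rule coh_dg_algebra)
  show "set xs \<subseteq> carrier coh \<Longrightarrow> \<zero>\<^bsub>coh\<^esub> \<in> set xs \<Longrightarrow> transferred_ops xs = \<zero>\<^bsub>coh\<^esub>"
    by (cases xs rule: transferred_ops.cases) (auto simp flip: coh_zero)
qed

lemma transferred_map_zero: "set xs \<subseteq> carrier coh \<Longrightarrow> \<zero>\<^bsub>coh\<^esub> \<in> set xs \<Longrightarrow> transferred_map xs = \<zero>"
  by (cases xs rule: transferred_map.cases) auto

lemma mu3_add:
  assumes "x \<in> carrier A" "x' \<in> carrier A" "y \<in> carrier A" "z \<in> carrier A"
  shows "mu3 (x \<oplus> x') y z = mu3 x y z \<oplus> mu3 x' y z"
    "mu3 y (x \<oplus> x') z = mu3 y x z \<oplus> mu3 y x' z" "mu3 y z (x \<oplus> x') = mu3 y z x \<oplus> mu3 y z x'"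
  using assms by (simp_all add: mu3_def eps_add l_distr r_distr h_add pi_add minus_add)

lemma mu3_smult:
  assumes "x \<in> carrier A" "y \<in> carrier A" "z \<in> carrier A"
  shows "mu3 (c \<odot> x) y z = c \<odot> mu3 x y z" "mu3 y (c \<odot> x) z = c \<odot> mu3 y x z" "mu3 y z (c \<odot> x) = c \<odot> mu3 y z x"
  using assms by (simp_all add: mu3_def eps_smult smult_mult_left smult_mult_right h_smult pi_smult smult_minus_right)

lemma transferred_ops_multilinear: "multilinear coh coh 2 transferred_ops"
  unfolding multilinear_def
proof (intro conjI allI impI; (elim conjE)?)
  interpret H: dg_algebra coh by (rule coh_dg_algebra)
  show "transferred_ops xs \<in> carrier coh" if "set xs \<subseteq> carrier coh" for xs
    using that by (rule transferred_ops_closed)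
  show "transferred_ops (xs @ [x \<oplus>\<^bsub>coh\<^esub> y] @ zs) = transferred_ops (xs @ [x] @ zs) \<oplus>\<^bsub>coh\<^esub> transferred_ops (xs @ [y] @ zs)"
    if "set xs \<subseteq> carrier coh" "x \<in> carrier coh" "y \<in> carrier coh" "set zs \<subseteq> carrier coh" for xs x y zs
    using that by (cases rule: context_cases[of xs zs])
      (auto simp: H.l_distr H.r_distr transferred_ops_long rep_add mu3_add coh_add)
  show "transferred_ops (xs @ [c \<odot>\<^bsub>coh\<^esub> x] @ zs) = c \<odot>\<^bsub>coh\<^esub> transferred_ops (xs @ [x] @ zs)"
    if "set xs \<subseteq> carrier coh" "x \<in> carrier coh" "set zs \<subseteq> carrier coh" for xs c x zs
    using that by (cases rule: context_cases[of xs zs])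
      (auto simp: H.smult_mult_left H.smult_mult_right transferred_ops_long rep_smult mu3_smult coh_smult)
  show "transferred_ops xs \<in> homog coh (sum_list ds + 2 - int (length xs))" if deg: "has_degrees coh xs ds" for xs ds
  proof (cases xs rule: transferred_ops.cases)
    case (1 S T)
    then show ?thesis using that by (auto simp: has_degrees_def list_all2_Cons1 H.mult_homog)
  next
    case (2 S T R)
    then obtain a b c where "ds = [a, b, c]" "S \<in> homog coh a" "T \<in> homog coh b" "R \<in> homog coh c"
      using deg by (auto simp: has_degrees_def list_all2_Cons1)
    then show ?thesis using 2 mu3_homog[OF rep_homog(1) rep_homog(1) rep_homog(1)]
      by (auto simp: coh_homog rep_homog(2) algebra_simps)
  qed auto
qed

lemma transferred_map_multilinear: "multilinear coh A 1 transferred_map"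
  unfolding multilinear_def
proof (intro conjI allI impI; (elim conjE)?)
  interpret H: dg_algebra coh by (rule coh_dg_algebra)
  show "transferred_map xs \<in> carrier A" if "set xs \<subseteq> carrier coh" for xs
    using that by (rule transferred_map_closed)
  show "transferred_map (xs @ [x \<oplus>\<^bsub>coh\<^esub> y] @ zs) = transferred_map (xs @ [x] @ zs) \<oplus> transferred_map (xs @ [y] @ zs)"
    if "set xs \<subseteq> carrier coh" "x \<in> carrier coh" "y \<in> carrier coh" "set zs \<subseteq> carrier coh" for xs x y zs
    using that by (cases rule: context_cases[of xs zs])
      (auto simp: l_distr r_distr transferred_map_long rep_add h_add minus_add)
  show "transferred_map (xs @ [c \<odot>\<^bsub>coh\<^esub> x] @ zs) = c \<odot> transferred_map (xs @ [x] @ zs)"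
    if "set xs \<subseteq> carrier coh" "x \<in> carrier coh" "set zs \<subseteq> carrier coh" for xs c x zs
    using that by (cases rule: context_cases[of xs zs])
      (auto simp: smult_mult_left smult_mult_right transferred_map_long rep_smult h_smult smult_minus_right)
  show "transferred_map xs \<in> homog A (sum_list ds + 1 - int (length xs))" if deg: "has_degrees coh xs ds" for xs ds
    using that
  proof (cases xs rule: transferred_map.cases)
    case (2 S T)
    then obtain a b where ab: "ds = [a, b]" "S \<in> homog coh a" "T \<in> homog coh b"
      using deg by (auto simp: has_degrees_def list_all2_Cons1)
    have "\<ominus> h (rep S \<otimes> rep T) \<in> homog A (a + b - 1)"
      using ab by (intro homog_minus h_homog mult_homog rep_homog)
    then show ?thesis using 2 ab by simp
  qed (auto simp: has_degrees_def list_all2_Cons1 rep_homog)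
qed

end

lemma length_cases_5:
  assumes "xs \<noteq> []"
  obtains a where "xs = [a]" | a b where "xs = [a, b]" | a b c where "xs = [a, b, c]"
    | a b c d where "xs = [a, b, c, d]" | a b c d e where "xs = [a, b, c, d, e]" | "length xs > 5"
proof -
  have "(\<exists>a. xs = [a]) \<or> (\<exists>a b. xs = [a, b]) \<or> (\<exists>a b c. xs = [a, b, c]) \<or> (\<exists>a b c d. xs = [a, b, c, d]) \<or>
     (\<exists>a b c d e. xs = [a, b, c, d, e]) \<or> length xs > 5"
    using assms
    by (cases xs; cases "tl xs"; cases "tl (tl xs)"; cases "tl (tl (tl xs))"; cases "tl (tl (tl (tl xs)))";
        cases "tl (tl (tl (tl (tl xs))))") auto
  then show thesis by (elim disjE exE) (rule that; assumption)+
qed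

lemma neg_one_powi:
  "(-1 :: 'k::field) powi (1 - k) = - ((-1) powi k)" "(-1 :: 'k) powi (- k) = (-1) powi k"
  by (auto simp: power_int_minus_left)

context contracted_dga
begin

lemma transferred_ops_insert_eq_zero:
  assumes "set xs \<subseteq> carrier coh" "1 \<le> s" "r + s \<le> length xs" "s \<notin> {2, 3}"
  shows "transferred_ops (take r xs @ [transferred_ops (take s (drop r xs))] @ drop (r + s) xs) = \<zero>\<^bsub>coh\<^esub>"
    and "transferred_map (take r xs @ [transferred_ops (take s (drop r xs))] @ drop (r + s) xs) = \<zero>"
proof -
  have z: "transferred_ops (take s (drop r xs)) = \<zero>\<^bsub>coh\<^esub>"
    by (rule transferred_ops_eq_zero) (use assms in auto)
  have sub: "set (take r xs) \<subseteq> carrier coh" "set (drop (r + s) xs) \<subseteq> carrier coh"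
    using assms(1) set_take_subset set_drop_subset by (metis subset_trans)+
  have zc: "\<zero>\<^bsub>coh\<^esub> \<in> carrier coh" by (simp add: coh_zero cocycles_iff)
  show "transferred_ops (take r xs @ [transferred_ops (take s (drop r xs))] @ drop (r + s) xs) = \<zero>\<^bsub>coh\<^esub>"
    unfolding z by (rule transferred_ops_zero) (use sub zc in auto)
  show "transferred_map (take r xs @ [transferred_ops (take s (drop r xs))] @ drop (r + s) xs) = \<zero>"
    unfolding z by (rule transferred_map_zero) (use sub zc in auto)
qed

lemma transferred_insert_closed:
  assumes "set xs \<subseteq> carrier coh"
  shows "set (take r xs @ [transferred_ops (take s (drop r xs))] @ drop (r + s) xs) \<subseteq> carrier coh"
proof -
  have "set (take r xs) \<subseteq> carrier coh" "set (drop (r + s) xs) \<subseteq> carrier coh" "set (take s (drop r xs)) \<subseteq> carrier coh"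
    using assms set_take_subset set_drop_subset by (metis subset_trans)+
  then show ?thesis by (simp add: transferred_ops_closed)
qed

lemma coh_minus_cls:
  "x \<in> cocycles A (dif A) \<Longrightarrow> (-1) \<odot>\<^bsub>coh\<^esub> cls x = cls (\<ominus> x)"
  by (simp add: coh_smult cocycles_iff smult_minus_one)

text \<open>Operations exist only in arities two and three, so there are relations only for three,
  four and five inputs: associativity, \<open>mu3_relation4\<close>, and the vanishing terms of
  \<open>mu3_relation5\<close>.\<close>

theorem transferred_a_infinity: "a_infinity_algebra coh transferred_ops"
  unfolding a_infinity_algebra_def
proof (intro conjI allI impI; (elim conjE)?)
  interpret H: dg_algebra coh by (rule coh_dg_algebra)
  show "graded_space coh" by (rule H.graded_space_axioms)
  show "multilinear coh coh 2 transferred_ops" by (rule transferred_ops_multilinear)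
  fix xs ds
  assume xs: "xs \<noteq> []" and deg: "has_degrees coh xs ds"
  have car: "set xs \<subseteq> carrier coh"
    using deg by (auto simp: has_degrees_def list_all2_conv_all_nth set_conv_nth)
  let ?g = "\<lambda>r s. transferred_ops (take r xs @ [transferred_ops (take s (drop r xs))] @ drop (r + s) xs)"
  let ?t = "\<lambda>(r, s). (-1) powi (int r + int s * int (length xs - r - s) + (2 - int s) * sum_list (take r ds)) \<odot>\<^bsub>coh\<^esub> ?g r s"
  have clo: "?g r s \<in> carrier coh" for r s
    using transferred_insert_closed[OF car] by (rule transferred_ops_closed)
  note supp = H.insertions_support[where g = transferred_ops and m = transferred_ops and xs = xs, OF _ clo]
  have z: "?g r s = \<zero>\<^bsub>coh\<^esub>" if "1 \<le> s" "r + s \<le> length xs" "s \<notin> {2, 3} \<or> length xs + 1 - s \<notin> {2, 3}" for r s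
  proof (cases "s \<in> {2, 3}")
    case True
    then show ?thesis using that by (intro transferred_ops_eq_zero) auto
  next
    case False
    then show ?thesis using transferred_ops_insert_eq_zero(1)[OF car that(1,2)] by auto
  qed
  have none: "insertions coh transferred_ops transferred_ops xs ds = \<zero>\<^bsub>coh\<^esub>"
    if "\<And>s. s \<in> {2, 3} \<Longrightarrow> length xs + 1 - s \<notin> {2, 3}"
    by (subst supp[of "{}"]) (use z that in auto)
  from xs show "insertions coh transferred_ops transferred_ops xs ds = \<zero>\<^bsub>coh\<^esub>"
  proof (cases rule: length_cases_5)
    case (3 a b c)
    then have [simp]: "a \<in> carrier coh" "b \<in> carrier coh" "c \<in> carrier coh" using car by auto
    have "insertions coh transferred_ops transferred_ops xs ds =
        finsum coh ?t {(0, 2), (1, 2)}"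
    proof (rule supp)
      show "?g r s = \<zero>\<^bsub>coh\<^esub>" if "1 \<le> s" "r + s \<le> length xs" "(r, s) \<notin> {(0, 2), (1, 2)}" for r s
        using z[OF that(1,2)] that by (cases "s = 2"; cases r) (auto simp: 3)
    qed (auto simp: 3)
    also have "\<dots> = (a \<otimes>\<^bsub>coh\<^esub> b) \<otimes>\<^bsub>coh\<^esub> c \<oplus>\<^bsub>coh\<^esub> (-1) \<odot>\<^bsub>coh\<^esub> (a \<otimes>\<^bsub>coh\<^esub> (b \<otimes>\<^bsub>coh\<^esub> c))"
      by (simp add: 3 numeral_2_eq_2)
    also have "\<dots> = \<zero>\<^bsub>coh\<^esub>" by (simp add: H.m_assoc H.smult_minus_one H.r_neg)
    finally show ?thesis .
  next
    \<comment> \<open>The five insertions of \<open>m\<^sub>2\<close> and \<open>m\<^sub>3\<close> into each other. The Koszul sign of moving \<open>m\<^sub>3\<close>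
      past the first input turns into the involution on that input.\<close>
    case (4 a b c d)
    then have [simp]: "a \<in> carrier coh" "b \<in> carrier coh" "c \<in> carrier coh" "d \<in> carrier coh" using car by auto
    have p4: "(-1 :: 'k) ^ 4 = 1" by (simp add: eval_nat_numeral)
    obtain k ds' where ds: "ds = k # ds'" and a: "a \<in> homog coh k"
      using deg 4 by (auto simp: has_degrees_def list_all2_Cons1)
    have "insertions coh transferred_ops transferred_ops xs ds =
        finsum coh ?t {(0, 2), (1, 2), (2, 2), (0, 3), (1, 3)}"
    proof (rule supp)
      show "?g r s = \<zero>\<^bsub>coh\<^esub>" if "1 \<le> s" "r + s \<le> length xs"
          "(r, s) \<notin> {(0, 2), (1, 2), (2, 2), (0, 3), (1, 3)}" for r s
      proof -
        have "s \<notin> {2, 3}"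
          using that by (auto simp: 4)
        then show ?thesis using z[OF that(1,2)] by auto
      qed
    qed (auto simp: 4)
    also have "\<dots> =
        cls (mu3 (pi (rep a \<otimes> rep b)) (rep c) (rep d)) \<oplus>\<^bsub>coh\<^esub>
        ((-1) \<odot>\<^bsub>coh\<^esub> cls (mu3 (rep a) (pi (rep b \<otimes> rep c)) (rep d)) \<oplus>\<^bsub>coh\<^esub>
        (cls (mu3 (rep a) (rep b) (pi (rep c \<otimes> rep d))) \<oplus>\<^bsub>coh\<^esub>
        ((-1) \<odot>\<^bsub>coh\<^esub> (cls (mu3 (rep a) (rep b) (rep c)) \<otimes>\<^bsub>coh\<^esub> d) \<oplus>\<^bsub>coh\<^esub>
         (-1) powi (1 - k) \<odot>\<^bsub>coh\<^esub> (a \<otimes>\<^bsub>coh\<^esub> cls (mu3 (rep b) (rep c) (rep d))))))"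
      using p4 by (simp add: 4 ds rep_mult numeral_2_eq_2 numeral_3_eq_3)
    also have "cls (mu3 (rep a) (rep b) (rep c)) \<otimes>\<^bsub>coh\<^esub> d = cls (pi (mu3 (rep a) (rep b) (rep c) \<otimes> rep d))"
      using coh_mult[of "mu3 (rep a) (rep b) (rep c)" "rep d"]
      by (simp add: cls_pi cocycles_iff dif_mult)
    also have "(-1) powi (1 - k) \<odot>\<^bsub>coh\<^esub> (a \<otimes>\<^bsub>coh\<^esub> cls (mu3 (rep b) (rep c) (rep d))) =
        cls (\<ominus> pi (eps (rep a) \<otimes> mu3 (rep b) (rep c) (rep d)))"
    proof -
      have "a \<otimes>\<^bsub>coh\<^esub> cls (mu3 (rep b) (rep c) (rep d)) = cls (rep a \<otimes> mu3 (rep b) (rep c) (rep d))"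
        using coh_mult[of "rep a" "mu3 (rep b) (rep c) (rep d)"] by simp
      then have "(-1) powi (1 - k) \<odot>\<^bsub>coh\<^esub> (a \<otimes>\<^bsub>coh\<^esub> cls (mu3 (rep b) (rep c) (rep d))) =
          cls ((-1) powi (1 - k) \<odot> (rep a \<otimes> mu3 (rep b) (rep c) (rep d)))"
        by (simp add: coh_smult cocycles_iff dif_mult)
      also have "(-1) powi (1 - k) \<odot> (rep a \<otimes> mu3 (rep b) (rep c) (rep d)) =
          \<ominus> (eps (rep a) \<otimes> mu3 (rep b) (rep c) (rep d))"
        using smult_minus_one[of "(-1) powi k \<odot> (rep a \<otimes> mu3 (rep b) (rep c) (rep d))"]
        by (simp add: eps_of_homog[OF rep_homog(1)[OF a]] smult_mult_left neg_one_powi)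
      also have "cls (\<ominus> (eps (rep a) \<otimes> mu3 (rep b) (rep c) (rep d))) =
          cls (\<ominus> pi (eps (rep a) \<otimes> mu3 (rep b) (rep c) (rep d)))"
        using cls_pi[of "\<ominus> (eps (rep a) \<otimes> mu3 (rep b) (rep c) (rep d))"]
        by (simp add: cocycles_iff dif_minus dif_mult dif_eps pi_minus)
      finally show ?thesis .
    qed
    also have "cls (mu3 (pi (rep a \<otimes> rep b)) (rep c) (rep d)) \<oplus>\<^bsub>coh\<^esub>
        ((-1) \<odot>\<^bsub>coh\<^esub> cls (mu3 (rep a) (pi (rep b \<otimes> rep c)) (rep d)) \<oplus>\<^bsub>coh\<^esub>
        (cls (mu3 (rep a) (rep b) (pi (rep c \<otimes> rep d))) \<oplus>\<^bsub>coh\<^esub>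
        ((-1) \<odot>\<^bsub>coh\<^esub> cls (pi (mu3 (rep a) (rep b) (rep c) \<otimes> rep d)) \<oplus>\<^bsub>coh\<^esub>
          cls (\<ominus> pi (eps (rep a) \<otimes> mu3 (rep b) (rep c) (rep d))))))
      = cls (mu3 (pi (rep a \<otimes> rep b)) (rep c) (rep d) \<ominus> mu3 (rep a) (pi (rep b \<otimes> rep c)) (rep d) \<oplus>
          mu3 (rep a) (rep b) (pi (rep c \<otimes> rep d)) \<ominus> pi (mu3 (rep a) (rep b) (rep c) \<otimes> rep d)
          \<ominus> pi (eps (rep a) \<otimes> mu3 (rep b) (rep c) (rep d)))"
      by (simp add: coh_minus_cls coh_add cocycles_iff dif_minus dif_add minus_eq a_assoc)
    also have "\<dots> = cls \<zero>" by (simp add: mu3_relation4)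
    finally show ?thesis by (simp add: coh_zero)
  next
    case (5 a b c d e)
    then have [simp]: "a \<in> carrier coh" "b \<in> carrier coh" "c \<in> carrier coh" "d \<in> carrier coh" "e \<in> carrier coh"
      using car by auto
    have "insertions coh transferred_ops transferred_ops xs ds =
        finsum coh ?t {(0, 3), (1, 3), (2, 3)}"
    proof (rule supp)
      show "?g r s = \<zero>\<^bsub>coh\<^esub>" if "1 \<le> s" "r + s \<le> length xs" "(r, s) \<notin> {(0, 3), (1, 3), (2, 3)}" for r s
      proof -
        have "s \<noteq> 3" using that by (auto simp: 5)
        then show ?thesis using z[OF that(1,2)] by (auto simp: 5)
      qed
    qed (auto simp: 5)
    also have "\<dots> = \<zero>\<^bsub>coh\<^esub>"
      by (simp add: 5 rep_mu3 mu3_relation5 numeral_2_eq_2 numeral_3_eq_3 flip: coh_zero)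
    finally show ?thesis .
  qed (rule none; auto)+
qed

text \<open>A dg algebra has operations only in arities one and two, so only compositions with one or two
  parts contribute to the morphism equation.\<close>

lemma compositions_cases:
  assumes "is \<in> compositions n" "length is \<in> {1, 2}"
  obtains "is = [n]" | i j where "is = [i, j]" "1 \<le> i" "1 \<le> j" "i + j = n"
proof (cases "length is = 1")
  case True
  then obtain i where "is = [i]" by (auto simp: length_Suc_conv)
  then show thesis using that(1) assms(1) by (auto simp: compositions_def)
next
  case False
  then obtain i j where "is = [i, j]" using assms(2) by (auto simp: length_Suc_conv numeral_2_eq_2)
  then show thesis using that(2) assms(1) by (auto simp: compositions_def)
qed

lemma length_blocks [simp]: "length (blocks is xs) = length is"
  by (induction "is" xs rule: blocks.induct) auto

lemma set_blocks: "b \<in> set (blocks is xs) \<Longrightarrow> set b \<subseteq> set xs"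
  by (induction "is" xs rule: blocks.induct) (auto dest: in_set_takeD in_set_dropD)

text \<open>For two inputs the equation is the definition of \<open>\<pi>\<close>, for three inputs it is
  \<open>mu3_homotopy\<close>, and for four inputs both sides vanish: the left one because \<open>h\<close> is zero on the
  products that occur, the right one because \<open>h A\<close> has square zero.\<close>

theorem transferred_morphism: "a_infinity_morphism coh transferred_ops A (dga_ops A) transferred_map"
  unfolding a_infinity_morphism_def
proof (intro conjI allI impI; (elim conjE)?)
  interpret H: dg_algebra coh by (rule coh_dg_algebra)
  show "a_infinity_algebra coh transferred_ops" by (rule transferred_a_infinity)
  show "a_infinity_algebra A (dga_ops A)" by (rule dga_a_infinity)
  show "multilinear coh A 1 transferred_map" by (rule transferred_map_multilinear)
  fix xs ds
  assume xs: "xs \<noteq> []" and deg: "has_degrees coh xs ds"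
  have car: "set xs \<subseteq> carrier coh"
    using deg by (auto simp: has_degrees_def list_all2_conv_all_nth set_conv_nth)
  let ?g = "\<lambda>r s. transferred_map (take r xs @ [transferred_ops (take s (drop r xs))] @ drop (r + s) xs)"
  let ?t = "\<lambda>(r, s). (-1) powi (int r + int s * int (length xs - r - s) + (2 - int s) * sum_list (take r ds)) \<odot> ?g r s"
  let ?r = "\<lambda>is. (-1) powi block_sign is ds \<odot> dga_ops A (map transferred_map (blocks is xs))"
  have clo: "?g r s \<in> carrier A" for r s
    using transferred_insert_closed[OF car] by (rule transferred_map_closed)
  note supp = insertions_support[where g = transferred_map and m = transferred_ops and xs = xs, OF _ clo]
  have z: "?g r s = \<zero>" if "1 \<le> s" "r + s \<le> length xs" "s \<notin> {2, 3} \<or> length xs + 1 - s \<notin> {1, 2}" for r s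
  proof (cases "s \<in> {2, 3}")
    case True
    then show ?thesis using that by (intro transferred_map_eq_zero) auto
  next
    case False
    then show ?thesis using transferred_ops_insert_eq_zero(2)[OF car that(1,2)] by auto
  qed
  have bcar: "set (map transferred_map (blocks is xs)) \<subseteq> carrier A" for "is"
    using set_blocks[of _ "is" xs] car by (auto intro!: transferred_map_closed)
  have rclo: "?r is \<in> carrier A" for "is" using dga_ops_closed[OF bcar] by auto
  have rz: "?r is = \<zero>" if comp: "is \<in> compositions (length xs)"
    "is \<notin> {[2], [1, 1], [1, 2], [2, 1], [2, 2]}" for "is"
  proof (cases "length is \<in> {1, 2}")
    case False
    then have "dga_ops A (map transferred_map (blocks is xs)) = \<zero>" by (intro dga_ops_eq_zero) auto
    then show ?thesis by simp
  next
    case True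
    from comp(1) True have "dga_ops A (map transferred_map (blocks is xs)) = \<zero>"
    proof (cases rule: compositions_cases)
      case 1
      have "dif A (transferred_map xs) = \<zero>"
      proof (cases "length xs = 1")
        case True
        then obtain a where "xs = [a]" by (auto simp: length_Suc_conv)
        then show ?thesis using car by simp
      next
        case False
        then show ?thesis using 1 comp(2) transferred_map_eq_zero[of xs] by auto
      qed
      then show ?thesis using 1 by simp
    next
      case (2 i j)
      have "transferred_map (take i xs) = \<zero> \<or> transferred_map (take j (drop i xs)) = \<zero>"
      proof (cases "i \<in> {1, 2}")
        case True
        then have "j \<notin> {1, 2}" using 2 comp(2) by auto
        then have "transferred_map (take j (drop i xs)) = \<zero>" using 2 by (intro transferred_map_eq_zero) auto
        then show ?thesis ..
      next
        case False
        then have "transferred_map (take i xs) = \<zero>" using 2 by (intro transferred_map_eq_zero) auto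
        then show ?thesis ..
      qed
      then have "\<zero> \<in> set (map transferred_map (blocks is xs))" using 2(1) by auto
      then show ?thesis by (rule dga_ops_zero[OF bcar])
    qed
    then show ?thesis by simp
  qed
  have rsupp: "(\<Oplus>is\<in>compositions (length xs). ?r is) = (\<Oplus>is\<in>S. ?r is)"
    if "S \<subseteq> compositions (length xs)"
      "compositions (length xs) \<inter> {[2], [1, 1], [1, 2], [2, 1], [2, 2]} \<subseteq> S" for S
    by (rule finsum_mono_neutral[OF finite_compositions that(1) rclo]) (use rz that(2) in auto)
  have none: "insertions A transferred_ops transferred_map xs ds = \<zero>"
    if "\<And>s. s \<in> {2, 3} \<Longrightarrow> length xs + 1 - s \<notin> {1, 2}"
    by (subst supp[of "{}"]) (use z that in auto)
  show "insertions A transferred_ops transferred_map xs ds = (\<Oplus>is\<in>compositions (length xs). ?r is)"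
    using xs
  proof (cases rule: length_cases_5)
    case (1 a)
    have "(\<Oplus>is\<in>compositions (length xs). ?r is) = (\<Oplus>is\<in>{}. ?r is)"
      by (rule rsupp) (auto simp: 1 compositions_def)
    moreover have "insertions A transferred_ops transferred_map xs ds = \<zero>" by (rule none) (auto simp: 1)
    ultimately show ?thesis by simp
  next
    case (2 a b)
    then have [simp]: "a \<in> carrier coh" "b \<in> carrier coh" using car by auto
    have "(\<Oplus>is\<in>compositions (length xs). ?r is) = (\<Oplus>is\<in>{[2], [1, 1]}. ?r is)"
      by (rule rsupp) (auto simp: 2 compositions_def)
    also have "\<dots> = dif A (\<ominus> h (rep a \<otimes> rep b)) \<oplus> rep a \<otimes> rep b"
      by (simp add: 2 block_sign_def numeral_2_eq_2)
    also have "\<dots> = pi (rep a \<otimes> rep b)"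
      by (simp add: pi_def dif_mult dif_minus minus_eq a_comm)
    finally have r: "(\<Oplus>is\<in>compositions (length xs). ?r is) = pi (rep a \<otimes> rep b)" .
    have "insertions A transferred_ops transferred_map xs ds =
        finsum A ?t {(0, 2)}"
    proof (rule supp)
      show "?g r s = \<zero>" if "1 \<le> s" "r + s \<le> length xs" "(r, s) \<notin> {(0, 2)}" for r s
        using z[OF that(1,2)] that by (cases "s = 2") (auto simp: 2)
    qed (auto simp: 2)
    also have "\<dots> = pi (rep a \<otimes> rep b)"
      by (simp add: 2 rep_mult numeral_2_eq_2)
    finally show ?thesis using r by simp
  next
    case (3 a b c)
    then have [simp]: "a \<in> carrier coh" "b \<in> carrier coh" "c \<in> carrier coh" using car by auto
    obtain k ds' where ds: "ds = k # ds'" and a: "a \<in> homog coh k"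
      using deg 3 by (auto simp: has_degrees_def list_all2_Cons1)
    have "(\<Oplus>is\<in>compositions (length xs). ?r is) = (\<Oplus>is\<in>{[1, 2], [2, 1]}. ?r is)"
      by (rule rsupp) (auto simp: 3 compositions_def)
    also have "\<dots> = (-1) powi (- k) \<odot> (rep a \<otimes> (\<ominus> h (rep b \<otimes> rep c))) \<oplus> (-1) \<odot> ((\<ominus> h (rep a \<otimes> rep b)) \<otimes> rep c)"
      by (simp add: 3 ds block_sign_def numeral_2_eq_2)
    also have "(-1) powi (- k) \<odot> (rep a \<otimes> (\<ominus> h (rep b \<otimes> rep c))) = \<ominus> (eps (rep a) \<otimes> h (rep b \<otimes> rep c))"
      by (simp add: eps_of_homog[OF rep_homog(1)[OF a]] smult_mult_left neg_one_powi r_minus smult_minus_right)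
    also have "\<ominus> (eps (rep a) \<otimes> h (rep b \<otimes> rep c)) \<oplus> (-1) \<odot> ((\<ominus> h (rep a \<otimes> rep b)) \<otimes> rep c) =
        h (rep a \<otimes> rep b) \<otimes> rep c \<ominus> eps (rep a) \<otimes> h (rep b \<otimes> rep c)"
      by (simp add: smult_minus_one l_minus minus_eq a_comm)
    finally have r: "(\<Oplus>is\<in>compositions (length xs). ?r is) =
        h (rep a \<otimes> rep b) \<otimes> rep c \<ominus> eps (rep a) \<otimes> h (rep b \<otimes> rep c)" .
    have "insertions A transferred_ops transferred_map xs ds =
        finsum A ?t {(0, 2), (1, 2), (0, 3)}"
    proof (rule supp)
      show "?g r s = \<zero>" if "1 \<le> s" "r + s \<le> length xs" "(r, s) \<notin> {(0, 2), (1, 2), (0, 3)}" for r s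
      proof -
        have "s \<notin> {2, 3}" using that by (auto simp: 3)
        then show ?thesis using z[OF that(1,2)] by auto
      qed
    qed (auto simp: 3)
    also have "\<dots> = \<ominus> h (pi (rep a \<otimes> rep b) \<otimes> rep c) \<oplus> ((-1) \<odot> (\<ominus> h (rep a \<otimes> pi (rep b \<otimes> rep c))) \<oplus>
        mu3 (rep a) (rep b) (rep c))"
      by (simp add: 3 ds rep_mult rep_mu3 numeral_2_eq_2 numeral_3_eq_3)
    also have "\<dots> = mu3 (rep a) (rep b) (rep c) \<ominus> h (pi (rep a \<otimes> rep b) \<otimes> rep c) \<oplus> h (rep a \<otimes> pi (rep b \<otimes> rep c))"
      by (simp add: smult_minus_one minus_eq a_ac)
    also have "\<dots> = h (rep a \<otimes> rep b) \<otimes> rep c \<ominus> eps (rep a) \<otimes> h (rep b \<otimes> rep c)"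
      by (rule mu3_homotopy) simp_all
    finally show ?thesis using r by simp
  next
    case (4 a b c d)
    then have [simp]: "a \<in> carrier coh" "b \<in> carrier coh" "c \<in> carrier coh" "d \<in> carrier coh" using car by auto
    have "(\<Oplus>is\<in>compositions (length xs). ?r is) = (\<Oplus>is\<in>{[2, 2]}. ?r is)"
      by (rule rsupp) (auto simp: 4 compositions_def)
    also have "\<dots> = \<zero>" by (simp add: 4 l_minus r_minus numeral_2_eq_2)
    finally have r: "(\<Oplus>is\<in>compositions (length xs). ?r is) = \<zero>" .
    have "insertions A transferred_ops transferred_map xs ds =
        finsum A ?t {(0, 3), (1, 3)}"
    proof (rule supp)
      show "?g r s = \<zero>" if "1 \<le> s" "r + s \<le> length xs" "(r, s) \<notin> {(0, 3), (1, 3)}" for r s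
      proof -
        have "s \<noteq> 3" using that by (auto simp: 4)
        then show ?thesis using z[OF that(1,2)] by (auto simp: 4)
      qed
    qed (auto simp: 4)
    also have "\<dots> = \<zero>"
      using h_pi_mult_h_mult[of "eps (rep a)" "rep b \<otimes> rep c" "rep d"]
        h_mult_pi_mult_h[of "eps (rep b)" "rep c \<otimes> rep d" "rep a"]
      by (simp add: 4 rep_mu3 numeral_2_eq_2 numeral_3_eq_3) (simp add: mu3_def l_minus r_minus h_minus)
    finally show ?thesis using r by simp
  next
    case (5 a b c d e)
    have "(\<Oplus>is\<in>compositions (length xs). ?r is) = (\<Oplus>is\<in>{}. ?r is)"
      by (rule rsupp) (auto simp: 5 compositions_def)
    moreover have "insertions A transferred_ops transferred_map xs ds = \<zero>" by (rule none) (auto simp: 5)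
    ultimately show ?thesis by simp
  next
    case 6
    have "(\<Oplus>is\<in>compositions (length xs). ?r is) = (\<Oplus>is\<in>{}. ?r is)"
      by (rule rsupp) (use 6 in \<open>auto simp: compositions_def\<close>)
    moreover have "insertions A transferred_ops transferred_map xs ds = \<zero>" by (rule none) (use 6 in auto)
    ultimately show ?thesis by simp
  qed
qed

lemma transferred_quasi_iso: "a_infinity_quasi_iso coh transferred_ops A (dga_ops A) transferred_map"
  unfolding a_infinity_quasi_iso_def
proof
  interpret H: dg_algebra coh by (rule coh_dg_algebra)
  show "a_infinity_morphism coh transferred_ops A (dga_ops A) transferred_map" by (rule transferred_morphism)
  have d: "(\<lambda>y. dga_ops A [y]) = dif A" by auto
  have cob: "coboundaries coh (\<lambda>x. transferred_ops [x]) = {\<zero>\<^bsub>coh\<^esub>}"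
    using H.zero_closed by (auto simp: coboundaries_def)
  have cyc: "cocycles coh (\<lambda>x. transferred_ops [x]) = carrier coh"
    by (auto simp: cocycles_def)
  have cc: "coh_class coh (\<lambda>x. transferred_ops [x]) S = {S}" if "S \<in> carrier coh" for S
    unfolding coh_class_def cob using that by (auto simp: a_r_coset_def r_coset_def)
  have eq: "(\<Union>x\<in>coh_class coh (\<lambda>x. transferred_ops [x]) S. coh_class A (dif A) (transferred_map [x])) = S"
    if "S \<in> carrier coh" for S
    unfolding cc[OF that] using that by simp
  show "induces_coh_iso coh (\<lambda>x. transferred_ops [x]) A (\<lambda>y. dga_ops A [y]) (\<lambda>x. transferred_map [x])"
    unfolding induces_coh_iso_def d cyc bij_betw_def
  proof
    show "inj_on (\<lambda>S. \<Union>x\<in>S. coh_class A (dif A) (transferred_map [x]))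
        (coh_class coh (\<lambda>x. transferred_ops [x]) ` carrier coh)"
      by (rule inj_onI) (metis (no_types, lifting) eq imageE)
    show "(\<lambda>S. \<Union>x\<in>S. coh_class A (dif A) (transferred_map [x])) `
        coh_class coh (\<lambda>x. transferred_ops [x]) ` carrier coh = coh_class A (dif A) ` cocycles A (dif A)"
      unfolding image_image coh_carrier[symmetric] using eq by simp
  qed
qed

theorem minimal_model_transferred: "minimal_model A transferred_ops"
  unfolding minimal_model_def using transferred_a_infinity transferred_quasi_iso by auto

section \<open>Formality from a two-sided ideal\<close>

text \<open>If \<open>\<pi>\<close> is zero on \<open>A (h A)\<close> as well as on \<open>(h A) A\<close>, then replacing factors by their projections
  does not change the projection of a product, so the map to cohomology is multiplicative on all of \<open>A\<close>.\<close>

theorem formal_if_two_sided: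
  assumes two_sided: "\<And>x y. x \<in> carrier A \<Longrightarrow> y \<in> carrier A \<Longrightarrow> pi (x \<otimes> h y) = \<zero>"
  shows "dga_quasi_iso A coh (\<lambda>x. cls (pi x))"
proof -
  interpret H: dg_algebra coh by (rule coh_dg_algebra)
  have mult: "pi (pi x \<otimes> pi y) = pi (x \<otimes> y)" if [simp]: "x \<in> carrier A" "y \<in> carrier A" for x y
  proof -
    have left: "pi (dif A (h u) \<otimes> w) = \<zero>" if [simp]: "u \<in> carrier A" "w \<in> carrier A" for u w
    proof -
      have "dif A (h u \<otimes> w) = dif A (h u) \<otimes> w \<oplus> eps (h u) \<otimes> dif A w" by (simp add: dif_mult)
      moreover have "eps (h u) = h (\<ominus> eps u)" by (simp add: h_minus h_eps)
      ultimately have "pi (dif A (h u \<otimes> w)) = pi (dif A (h u) \<otimes> w) \<oplus> pi (h (\<ominus> eps u) \<otimes> dif A w)"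
        by (simp add: pi_add)
      then show ?thesis by simp
    qed
    have right: "pi (w \<otimes> dif A (h u)) = \<zero>" if [simp]: "u \<in> carrier A" "w \<in> carrier A" for u w
    proof -
      have "dif A (eps w \<otimes> h u) = dif A (eps w) \<otimes> h u \<oplus> w \<otimes> dif A (h u)" by (simp add: dif_mult)
      then have "pi (dif A (eps w \<otimes> h u)) = pi (dif A (eps w) \<otimes> h u) \<oplus> pi (w \<otimes> dif A (h u))"
        by (simp add: pi_add)
      then show ?thesis by (simp add: two_sided)
    qed
    have "pi (pi x \<otimes> pi y) = pi (x \<otimes> pi y)"
      unfolding pi_def[of x] by (simp add: a_minus_def l_distr l_minus pi_add pi_minus left)
    also have "\<dots> = pi (x \<otimes> y)"
      unfolding pi_def[of y] by (simp add: a_minus_def r_distr r_minus pi_add pi_minus right two_sided)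
    finally show ?thesis .
  qed
  have cp: "cls (pi x) = cls x" if "x \<in> cocycles A (dif A)" for x using that by (rule cls_pi)
  have hom: "dga_hom A coh (\<lambda>x. cls (pi x))"
    unfolding dga_hom_def
  proof (intro conjI allI ballI)
    show "(\<lambda>x. cls (pi x)) \<in> ring_hom A coh"
    proof (rule ring_hom_memI)
      show "cls (pi x) \<in> carrier coh" if "x \<in> carrier A" for x using that by simp
      show "cls (pi \<one>) = \<one>\<^bsub>coh\<^esub>" by (simp add: cp cocycles_iff dif_one coh_one)
      fix x y assume [simp]: "x \<in> carrier A" "y \<in> carrier A"
      show "cls (pi (x \<oplus> y)) = cls (pi x) \<oplus>\<^bsub>coh\<^esub> cls (pi y)" by (simp add: pi_add coh_add)
      have "cls (pi x) \<otimes>\<^bsub>coh\<^esub> cls (pi y) = cls (pi x \<otimes> pi y)" by (simp add: coh_mult)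
      also have "\<dots> = cls (pi (pi x \<otimes> pi y))" by (simp add: cp cocycles_iff dif_mult)
      finally show "cls (pi (x \<otimes> y)) = cls (pi x) \<otimes>\<^bsub>coh\<^esub> cls (pi y)" by (simp add: mult)
    qed
    show "cls (pi (c \<odot> x)) = c \<odot>\<^bsub>coh\<^esub> cls (pi x)" if "x \<in> carrier A" for c x
      using that by (simp add: pi_smult coh_smult)
    show "(\<lambda>x. cls (pi x)) ` homog A n \<subseteq> homog coh n" for n
      by (auto simp: coh_homog pi_homog)
    show "cls (pi (dif A x)) = dif coh (cls (pi x))" if "x \<in> carrier A" for x
      using that by (simp add: coh_dif coh_zero)
  qed
  have Hdif: "dif coh S = \<zero>\<^bsub>coh\<^esub>" if "S \<in> carrier coh" for S
    using that by (auto elim!: cohE simp: coh_dif)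
  have "coboundaries coh (dif coh) = (\<lambda>S. \<zero>\<^bsub>coh\<^esub>) ` carrier coh"
    unfolding coboundaries_def using Hdif by (rule image_cong[OF refl])
  also have "\<dots> = {\<zero>\<^bsub>coh\<^esub>}" using H.zero_closed by (intro image_constant)
  finally have Hcob: "coboundaries coh (dif coh) = {\<zero>\<^bsub>coh\<^esub>}" .
  have Hcyc: "cocycles coh (dif coh) = carrier coh"
    by (auto simp: cocycles_def Hdif)
  have Hcls: "coh_class coh (dif coh) S = {S}" if "S \<in> carrier coh" for S
    using that by (auto simp: coh_class_def Hcob a_r_coset_def r_coset_def)
  have UN: "(\<Union>y\<in>cls x. coh_class coh (dif coh) (cls (pi y))) = {cls x}" if x: "x \<in> cocycles A (dif A)" for x
  proof -
    have "(\<Union>y\<in>cls x. coh_class coh (dif coh) (cls (pi y))) = coh_class coh (dif coh) (cls (pi x))"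
      using x by (intro cls_UN) (auto simp: pi_add cocycles_iff)
    then show ?thesis using x by (simp add: Hcls cp)
  qed
  have "induces_coh_iso A (dif A) coh (dif coh) (\<lambda>x. cls (pi x))"
    unfolding induces_coh_iso_def Hcyc bij_betw_def
  proof
    show "inj_on (\<lambda>S. \<Union>x\<in>S. coh_class coh (dif coh) (cls (pi x))) (cls ` cocycles A (dif A))"
      by (rule inj_onI) (auto simp: UN)
    show "(\<lambda>S. \<Union>x\<in>S. coh_class coh (dif coh) (cls (pi x))) ` cls ` cocycles A (dif A) =
        coh_class coh (dif coh) ` carrier coh"
      unfolding image_image using UN by (auto simp: coh_carrier Hcls image_image)
  qed
  then show ?thesis
    unfolding dga_quasi_iso_def using hom dg_algebra_axioms H.dg_algebra_axioms by blast
qed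

end

context dg_algebra
begin

lemma dga_quasi_iso_refl: "dga_quasi_iso A A (\<lambda>x. x)"
proof -
  have UN: "(\<Union>y\<in>cls x. cls y) = cls x" if "x \<in> cocycles A (dif A)" for x
  proof (rule cls_UN[OF that])
    fix z assume "z \<in> carrier A"
    then show "cls (x \<oplus> dif A z) = cls x"
      using that by (subst cls_eq_iff) (auto simp: cocycles_iff dif_add dif_dif)
  qed
  have "induces_coh_iso A (dif A) A (dif A) (\<lambda>x. x)"
    unfolding induces_coh_iso_def bij_betw_def
  proof
    show "inj_on (\<lambda>S. \<Union>x\<in>S. cls x) (cls ` cocycles A (dif A))"
      by (rule inj_onI) (auto simp: UN)
    show "(\<lambda>S. \<Union>x\<in>S. cls x) ` cls ` cocycles A (dif A) = cls ` cocycles A (dif A)"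
      unfolding image_image using UN by (auto simp: image_iff)
  qed
  then show ?thesis
    using dg_algebra_axioms by (auto simp: dga_quasi_iso_def dga_hom_def ring_hom_def)
qed

end

lemma formal_inI:
  fixes A :: "('k::field, 'a) dg_alg"
  assumes "dga_quasi_iso A (cohomology A) \<phi>"
  shows "formal_in TYPE('a) A"
proof -
  have "dg_algebra A" using assms by (simp add: dga_quasi_iso_def)
  then have "qis_adjacent A A"
    unfolding qis_adjacent_def using dg_algebra.dga_quasi_iso_refl by blast
  moreover have "qis_adjacent A (cohomology A)" unfolding qis_adjacent_def using assms by blast
  ultimately show ?thesis unfolding formal_in_def by blast
qed

section \<open>Linear extension and multiplication of paths\<close>

text \<open>The scalar multiplication \<open>path_scale\<close> for functions on an arbitrary basis; diagrams will
  be a second basis.\<close>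

definition pm_scale :: "'k::field \<Rightarrow> ('a \<Rightarrow>\<^sub>0 'k) \<Rightarrow> 'a \<Rightarrow>\<^sub>0 'k" where
  "pm_scale c = Poly_Mapping.map ((*) c)"

lemma path_scale_eq: "path_scale = pm_scale"
  by (rule ext) (simp add: path_scale_def pm_scale_def)

lemma lookup_pm_scale [simp]: "Poly_Mapping.lookup (pm_scale c f) k = c * Poly_Mapping.lookup f k"
  by (simp add: pm_scale_def Poly_Mapping.map.rep_eq when_def)

lemma pm_scale_simps [simp]:
  "pm_scale c 0 = 0" "pm_scale 0 f = 0" "pm_scale 1 f = f" "pm_scale b (pm_scale c f) = pm_scale (b * c) f"
  "pm_scale c (Poly_Mapping.single k a) = Poly_Mapping.single k (c * a)"
  by (rule poly_mapping_eqI; simp add: lookup_single when_def)+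

lemma pm_scale_add: "pm_scale c (f + g) = pm_scale c f + pm_scale c g"
  and pm_scale_add_left: "pm_scale (b + c) f = pm_scale b f + pm_scale c f"
  and pm_scale_uminus: "pm_scale (- c) f = - pm_scale c f"
  by (rule poly_mapping_eqI; simp add: lookup_add algebra_simps)+

lemma pm_scale_sum: "pm_scale c (\<Sum>a\<in>F. f a) = (\<Sum>a\<in>F. pm_scale c (f a))"
  by (induction F rule: infinite_finite_induct) (auto simp: pm_scale_add)

lemma keys_pm_scale: "Poly_Mapping.keys (pm_scale c f) \<subseteq> Poly_Mapping.keys f"
  by (auto simp: in_keys_iff)

lemma pm_induct [consumes 1, case_names zero single add]:
  fixes f :: "'a \<Rightarrow>\<^sub>0 'k::field"
  assumes "Poly_Mapping.keys f \<subseteq> K" and "P 0" and "\<And>k c. k \<in> K \<Longrightarrow> P (Poly_Mapping.single k c)"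
    and "\<And>f g. Poly_Mapping.keys f \<subseteq> K \<Longrightarrow> Poly_Mapping.keys g \<subseteq> K \<Longrightarrow> P f \<Longrightarrow> P g \<Longrightarrow> P (f + g)"
  shows "P f"
proof -
  have "Poly_Mapping.keys (\<Sum>k\<in>F. Poly_Mapping.single k (Poly_Mapping.lookup f k)) \<subseteq> K \<and>
      P (\<Sum>k\<in>F. Poly_Mapping.single k (Poly_Mapping.lookup f k))" if "finite F" "F \<subseteq> K" for F
    using that
  proof (induction F rule: finite_induct)
    case (insert a F)
    have "Poly_Mapping.keys (Poly_Mapping.single a (Poly_Mapping.lookup f a)) \<subseteq> K" using insert by simp
    then show ?case using insert assms(3,4)
      by (auto dest!: subsetD[OF Poly_Mapping.keys_add])
  qed (use assms(2) in auto)
  moreover have "(\<Sum>k\<in>Poly_Mapping.keys f. Poly_Mapping.single k (Poly_Mapping.lookup f k)) = f"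
    by (rule poly_mapping_eqI) (simp add: lookup_sum lookup_single when_def in_keys_iff)
  ultimately show ?thesis using assms(1) by (metis finite_keys)
qed

lemma pm_induct_all [case_names zero single add]:
  fixes f :: "'a \<Rightarrow>\<^sub>0 'k::field"
  assumes "P 0" and "\<And>k c. P (Poly_Mapping.single k c)" and "\<And>f g. P f \<Longrightarrow> P g \<Longrightarrow> P (f + g)"
  shows "P f"
  using subset_UNIV[of "Poly_Mapping.keys f"] by (induction f rule: pm_induct) (use assms in auto)

definition lin_ext :: "('a \<Rightarrow> 'b \<Rightarrow>\<^sub>0 'k::field) \<Rightarrow> ('a \<Rightarrow>\<^sub>0 'k) \<Rightarrow> 'b \<Rightarrow>\<^sub>0 'k" where
  "lin_ext \<phi> f = (\<Sum>a\<in>Poly_Mapping.keys f. pm_scale (Poly_Mapping.lookup f a) (\<phi> a))"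

lemma lin_ext_superset:
  assumes "finite F" "Poly_Mapping.keys f \<subseteq> F"
  shows "lin_ext \<phi> f = (\<Sum>a\<in>F. pm_scale (Poly_Mapping.lookup f a) (\<phi> a))"
  unfolding lin_ext_def using assms by (intro sum.mono_neutral_left) (auto simp: in_keys_iff)

lemma lin_ext_add: "lin_ext \<phi> (f + g) = lin_ext \<phi> f + lin_ext \<phi> g"
proof -
  let ?F = "Poly_Mapping.keys f \<union> Poly_Mapping.keys g"
  have "Poly_Mapping.keys (f + g) \<subseteq> ?F" by (rule Poly_Mapping.keys_add)
  then show ?thesis
    by (simp add: lin_ext_superset[of ?F] lookup_add pm_scale_add_left sum.distrib)
qed

lemma lin_ext_scale: "lin_ext \<phi> (pm_scale c f) = pm_scale c (lin_ext \<phi> f)"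
  by (subst lin_ext_superset[OF finite_keys keys_pm_scale]) (simp add: lin_ext_def pm_scale_sum)

lemma lin_ext_zero [simp]: "lin_ext \<phi> 0 = 0"
  by (simp add: lin_ext_def)

lemma lin_ext_single [simp]: "lin_ext \<phi> (Poly_Mapping.single a c) = pm_scale c (\<phi> a)"
  by (subst lin_ext_superset[of "{a}"]) auto

lemma lin_ext_uminus: "lin_ext \<phi> (- f) = - lin_ext \<phi> f"
  using lin_ext_add[of \<phi> f "- f"] by (simp add: eq_neg_iff_add_eq_0 add.commute)

lemma lin_ext_minus: "lin_ext \<phi> (f - g) = lin_ext \<phi> f - lin_ext \<phi> g"
  using lin_ext_add[of \<phi> f "- g"] by (simp add: lin_ext_uminus)

lemma lin_ext_sum: "lin_ext \<phi> (\<Sum>a\<in>F. f a) = (\<Sum>a\<in>F. lin_ext \<phi> (f a))"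
  by (induction F rule: infinite_finite_induct) (auto simp: lin_ext_add)

lemma lin_ext_add_fun: "lin_ext (\<lambda>a. \<phi> a + \<psi> a) f = lin_ext \<phi> f + lin_ext \<psi> f"
  by (simp add: lin_ext_def pm_scale_add sum.distrib)

lemma lin_ext_scale_fun: "lin_ext (\<lambda>a. pm_scale c (\<phi> a)) f = pm_scale c (lin_ext \<phi> f)"
  by (simp add: lin_ext_def pm_scale_sum mult.commute)

definition path_comp :: "('v, 'e) pre_digraph \<Rightarrow> 'v \<times> 'e list \<Rightarrow> 'v \<times> 'e list \<Rightarrow> ('v, 'e, 'k::field) path_elem" where
  "path_comp Q a b = (if pre_digraph.awlast Q (fst a) (snd a) = fst b
     then Poly_Mapping.single (fst a, snd a @ snd b) 1 else 0)"

lemma path_mult_lin_ext: "path_mult Q f g = lin_ext (\<lambda>a. lin_ext (path_comp Q a) g) f"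
  unfolding path_mult_def lin_ext_def path_comp_def pm_scale_sum
  by (intro sum.cong refl) (auto simp: split_beta intro!: sum.cong)

lemma path_mult_add_left: "path_mult Q (f + g) h = path_mult Q f h + path_mult Q g h"
  and path_mult_scale_left: "path_mult Q (pm_scale c f) h = pm_scale c (path_mult Q f h)"
  and path_mult_zero_left [simp]: "path_mult Q 0 h = 0"
  by (simp_all add: path_mult_lin_ext lin_ext_add lin_ext_scale)

lemma path_mult_add_right: "path_mult Q h (f + g) = path_mult Q h f + path_mult Q h g"
  and path_mult_scale_right: "path_mult Q h (pm_scale c f) = pm_scale c (path_mult Q h f)"
  and path_mult_zero_right [simp]: "path_mult Q h 0 = 0"
  by (simp_all add: path_mult_lin_ext lin_ext_add lin_ext_scale lin_ext_add_fun lin_ext_scale_fun)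
    (simp add: lin_ext_def)

lemma path_mult_single:
  "path_mult Q (Poly_Mapping.single (u, p) a) (Poly_Mapping.single (v, q) b) =
    (if pre_digraph.awlast Q u p = v then Poly_Mapping.single (u, p @ q) (a * b) else 0)"
  by (simp add: path_mult_lin_ext path_comp_def)

lemma path_mult_sum_left: "path_mult Q (\<Sum>a\<in>F. f a) h = (\<Sum>a\<in>F. path_mult Q (f a) h)"
  by (simp add: path_mult_lin_ext lin_ext_sum)

lemma path_mult_sum_right: "path_mult Q h (\<Sum>a\<in>F. f a) = (\<Sum>a\<in>F. path_mult Q h (f a))"
  by (induction F rule: infinite_finite_induct) (auto simp: path_mult_add_right)

lemma awlast_simps [simp]:
  "pre_digraph.awlast Q u [] = u" "pre_digraph.awlast Q u (e # p) = pre_digraph.awlast Q (head Q e) p"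
  by (simp_all add: pre_digraph.awalk_verts.simps pre_digraph.awalk_verts_non_Nil)

lemma awlast_append [simp]:
  "pre_digraph.awlast Q u (p @ q) = pre_digraph.awlast Q (pre_digraph.awlast Q u p) q"
  by (induction p arbitrary: u) auto

lemma path_mult_assoc: "path_mult Q (path_mult Q f g) h = path_mult Q f (path_mult Q g h)"
proof (induction f rule: pm_induct_all)
  case (single a c)
  show ?case
  proof (induction g rule: pm_induct_all)
    case (single b d)
    show ?case
    proof (induction h rule: pm_induct_all)
      case (single e k)
      show ?case by (cases a; cases b; cases e) (auto simp: path_mult_single mult.assoc)
    qed (auto simp: path_mult_add_right)
  qed (auto simp: path_mult_add_left path_mult_add_right)
qed (auto simp: path_mult_add_left)

section \<open>The path algebra of a quiver as a dg algebra\<close>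

text \<open>The differential of an arrow is a combination of paths parallel to it, of degree one
  higher. It then suffices that the differential has square zero on arrows.\<close>

locale dg_quiver = wf_digraph Q
  for Q :: "('v, 'e) pre_digraph" +
  fixes deg :: "'e \<Rightarrow> int" and \<delta> :: "'e \<Rightarrow> ('v, 'e, 'k::field) path_elem"
  assumes finite_verts: "finite (verts Q)"
    and \<delta>_keys: "\<And>e v q. e \<in> arcs Q \<Longrightarrow> (v, q) \<in> Poly_Mapping.keys (\<delta> e) \<Longrightarrow>
      v = tail Q e \<and> awalk (tail Q e) q (head Q e) \<and> sum_list (map deg q) = deg e + 1"
    and dif_\<delta>: "\<And>e. e \<in> arcs Q \<Longrightarrow> dif (path_dga Q deg \<delta>) (\<delta> e) = 0"
begin

abbreviation P :: "('k, ('v, 'e, 'k) path_elem) dg_alg" where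
  "P \<equiv> path_dga Q deg \<delta>"

definition walks_between :: "'v \<Rightarrow> 'v \<Rightarrow> int \<Rightarrow> ('v \<times> 'e list) set" where
  "walks_between u v n = {(u', p). u' = u \<and> awalk u p v \<and> sum_list (map deg p) = n}"

lemma P_simps [simp]:
  "carrier P = {f. Poly_Mapping.keys f \<subseteq> quiver_paths Q}" "monoid.mult P = path_mult Q"
  "one P = (\<Sum>v\<in>verts Q. Poly_Mapping.single (v, []) 1)" "zero P = 0" "add P = (+)"
  "module.smult P = pm_scale"
  by (simp_all add: path_dga_def path_scale_eq)

lemma P_homog: "homog P n = {f. Poly_Mapping.keys f \<subseteq> {(u, p) \<in> quiver_paths Q. sum_list (map deg p) = n}}"
  by (auto simp: path_dga_def)

lemma P_dif: "dif P = lin_ext (\<lambda>a. path_dif Q deg \<delta> (snd a))"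
  by (rule ext) (auto simp: path_dga_def lin_ext_def path_scale_eq split_beta)

lemma quiver_paths_iff: "(u, p) \<in> quiver_paths Q \<longleftrightarrow> awalk u p (pre_digraph.awlast Q u p)"
  by (auto simp: quiver_paths_def)

lemma awalk_awlast: "awalk u p v \<Longrightarrow> pre_digraph.awlast Q u p = v"
  by auto

lemma keys_add_subset: "Poly_Mapping.keys f \<subseteq> K \<Longrightarrow> Poly_Mapping.keys g \<subseteq> K \<Longrightarrow> Poly_Mapping.keys (f + g) \<subseteq> K"
  using Poly_Mapping.keys_add[of f g] by blast

lemma keys_scale_subset: "Poly_Mapping.keys f \<subseteq> K \<Longrightarrow> Poly_Mapping.keys (pm_scale c f) \<subseteq> K"
  using keys_pm_scale[of c f] by blast

lemma keys_path_mult: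
  assumes "Poly_Mapping.keys f \<subseteq> K" "Poly_Mapping.keys g \<subseteq> L"
    and "\<And>u p v q. (u, p) \<in> K \<Longrightarrow> (v, q) \<in> L \<Longrightarrow> pre_digraph.awlast Q u p = v \<Longrightarrow> (u, p @ q) \<in> M"
  shows "Poly_Mapping.keys (path_mult Q f g) \<subseteq> M"
  using assms(1)
proof (induction f rule: pm_induct)
  case (single k c)
  from assms(2) show ?case
  proof (induction g rule: pm_induct)
    case (single l d)
    then show ?case using assms(3) \<open>k \<in> K\<close> by (cases k; cases l) (auto simp: path_mult_single)
  next
    case (add f g)
    then show ?case by (simp add: path_mult_add_right keys_add_subset)
  qed auto
next
  case (add f h)
  then show ?case by (simp add: path_mult_add_left keys_add_subset)
qed auto

lemma keys_lin_ext:
  assumes "Poly_Mapping.keys f \<subseteq> K" "\<And>a. a \<in> K \<Longrightarrow> Poly_Mapping.keys (\<phi> a) \<subseteq> M"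
  shows "Poly_Mapping.keys (lin_ext \<phi> f) \<subseteq> M"
  using assms(1)
  by (induction f rule: pm_induct) (simp_all add: lin_ext_add assms(2) keys_add_subset keys_scale_subset)

lemma walks_between_append:
  "(u, p) \<in> walks_between a b m \<Longrightarrow> (v, q) \<in> walks_between b c n \<Longrightarrow> (u, p @ q) \<in> walks_between a c (m + n)"
  by (auto simp: walks_between_def)

lemma keys_path_dif:
  "awalk u p v \<Longrightarrow> Poly_Mapping.keys (path_dif Q deg \<delta> p) \<subseteq> walks_between u v (sum_list (map deg p) + 1)"
proof (induction p arbitrary: u)
  case (Cons e p)
  then have e: "e \<in> arcs Q" "u = tail Q e" and p: "awalk (head Q e) p v"
    by (auto simp: awalk_Cons_iff)
  have "Poly_Mapping.keys (path_mult Q (\<delta> e) (Poly_Mapping.single (head Q e, p) 1))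
      \<subseteq> walks_between u v (sum_list (map deg (e # p)) + 1)"
  proof (rule keys_path_mult)
    show "Poly_Mapping.keys (\<delta> e) \<subseteq> walks_between u (head Q e) (deg e + 1)"
      using \<delta>_keys[OF e(1)] e(2) by (auto simp: walks_between_def)
    show "Poly_Mapping.keys (Poly_Mapping.single (head Q e, p) 1) \<subseteq> walks_between (head Q e) v (sum_list (map deg p))"
      using p by (auto simp: walks_between_def)
    show "(a, r @ s) \<in> walks_between u v (sum_list (map deg (e # p)) + 1)"
      if "(a, r) \<in> walks_between u (head Q e) (deg e + 1)" "(b, s) \<in> walks_between (head Q e) v (sum_list (map deg p))" for a r b s
      using walks_between_append[OF that] by (simp add: ac_simps)
  qed
  moreover have "Poly_Mapping.keys (path_mult Q (path_of Q [e]) (path_dif Q deg \<delta> p))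
      \<subseteq> walks_between u v (sum_list (map deg (e # p)) + 1)"
  proof (rule keys_path_mult[OF _ Cons.IH[OF p]])
    show "Poly_Mapping.keys (path_of Q [e]) \<subseteq> walks_between u (head Q e) (deg e)"
      using e by (auto simp: path_of_def walks_between_def arc_implies_awalk)
    show "(a, r @ s) \<in> walks_between u v (sum_list (map deg (e # p)) + 1)"
      if "(a, r) \<in> walks_between u (head Q e) (deg e)" "(b, s) \<in> walks_between (head Q e) v (sum_list (map deg p) + 1)" for a r b s
      using walks_between_append[OF that] by (simp add: ac_simps)
  qed
  ultimately show ?case
    by (auto simp: path_scale_eq intro!: keys_add_subset keys_scale_subset del: subsetI)
qed (auto simp: awalk_Nil_iff)

lemma walks_between_paths: "walks_between u v n \<subseteq> {(u, p) \<in> quiver_paths Q. sum_list (map deg p) = n}"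
  by (auto simp: walks_between_def quiver_paths_def)

text \<open>This and the next lemma serve the Leibniz rule for two paths that cannot be composed: then
  all three terms are zero.\<close>

lemma single_mult_starting_at:
  assumes "Poly_Mapping.keys f \<subseteq> walks_between u v n"
  shows "path_mult Q (Poly_Mapping.single (w, p) c) f =
    (if pre_digraph.awlast Q w p = u then path_mult Q (Poly_Mapping.single (w, p) c) f else 0)"
  using assms by (induction f rule: pm_induct) (auto simp: path_mult_single path_mult_add_right walks_between_def)

lemma mult_single_ending_at:
  assumes "Poly_Mapping.keys f \<subseteq> walks_between u v n"
  shows "path_mult Q f (Poly_Mapping.single (w, p) c) =
    (if v = w then path_mult Q f (Poly_Mapping.single (w, p) c) else 0)"
  using assms by (induction f rule: pm_induct) (auto simp: path_mult_single path_mult_add_left walks_between_def awalk_awlast)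

lemma trivial_path_mult:
  assumes "Poly_Mapping.keys f \<subseteq> walks_between u v n"
  shows "path_mult Q (Poly_Mapping.single (u, []) 1) f = f" "path_mult Q f (Poly_Mapping.single (v, []) 1) = f"
  using assms
  by (induction f rule: pm_induct)
    (auto simp: path_mult_single path_mult_add_right path_mult_add_left walks_between_def awalk_awlast)

lemma path_dif_append:
  assumes "awalk u p v" "awalk v q w"
  shows "path_dif Q deg \<delta> (p @ q) = path_mult Q (path_dif Q deg \<delta> p) (Poly_Mapping.single (v, q) 1)
    + pm_scale ((-1) powi sum_list (map deg p)) (path_mult Q (Poly_Mapping.single (u, p) 1) (path_dif Q deg \<delta> q))"
  using assms(1)
proof (induction p arbitrary: u)
  case Nil
  then have "u = v" by (auto simp: awalk_Nil_iff)
  then show ?case using trivial_path_mult(1)[OF keys_path_dif[OF assms(2)]] by simp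
next
  case (Cons e p)
  then have e: "e \<in> arcs Q" "u = tail Q e" and p: "awalk (head Q e) p v"
    by (auto simp: awalk_Cons_iff)
  have 1: "path_mult Q (Poly_Mapping.single (head Q e, p) 1) (Poly_Mapping.single (v, q) 1) =
      (Poly_Mapping.single (head Q e, p @ q) 1 :: ('v, 'e, 'k) path_elem)"
    using awalk_awlast[OF p] by (simp add: path_mult_single)
  have 2: "path_mult Q (path_of Q [e]) (Poly_Mapping.single (head Q e, p) 1) =
      (Poly_Mapping.single (u, e # p) 1 :: ('v, 'e, 'k) path_elem)"
    using e by (simp add: path_of_def path_mult_single)
  show ?case
    by (simp add: Cons.IH[OF p] 1[symmetric] 2[symmetric] path_scale_eq path_mult_add_right path_mult_add_left
        path_mult_assoc path_mult_scale_right path_mult_scale_left pm_scale_add power_int_add add.assoc)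
qed

lemma P_dif_single [simp]: "dif P (Poly_Mapping.single (u, p) c) = pm_scale c (path_dif Q deg \<delta> p)"
  by (simp add: P_dif)

lemma P_dif_zero [simp]: "dif P 0 = 0"
  by (simp add: P_dif)

lemma P_leibniz:
  assumes "x \<in> homog P n" "y \<in> carrier P"
  shows "dif P (path_mult Q x y) = path_mult Q (dif P x) y + pm_scale ((-1) powi n) (path_mult Q x (dif P y))"
  using assms(1) unfolding P_homog mem_Collect_eq
proof (induction x rule: pm_induct)
  case (single k c)
  obtain u p where k: "k = (u, p)" by (cases k)
  define v where "v = pre_digraph.awlast Q u p"
  have p: "awalk u p v" "sum_list (map deg p) = n"
    using single by (auto simp: k quiver_paths_iff v_def)
  have "Poly_Mapping.keys y \<subseteq> quiver_paths Q" using assms(2) by simp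
  then show ?case
  proof (induction y rule: pm_induct)
    case (single l d)
    obtain v' q where l: "l = (v', q)" by (cases l)
    define w where "w = pre_digraph.awlast Q v' q"
    have q: "awalk v' q w" using single by (simp add: l quiver_paths_iff w_def)
    note kp = keys_path_dif[OF p(1)] and kq = keys_path_dif[OF q]
    have s: "Poly_Mapping.single (a, b) c = pm_scale c (Poly_Mapping.single (a, b) 1)" for a b and c :: 'k by simp
    show ?case
    proof (cases "v = v'")
      case True
      have "dif P (path_mult Q (Poly_Mapping.single k c) (Poly_Mapping.single l d)) =
          pm_scale (c * d) (path_dif Q deg \<delta> (p @ q))"
        using True awalk_awlast[OF p(1)] by (simp add: k l path_mult_single)
      also have "\<dots> = pm_scale (c * d) (path_mult Q (path_dif Q deg \<delta> p) (Poly_Mapping.single (v', q) 1)) +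
          pm_scale (c * d * (-1) powi n) (path_mult Q (Poly_Mapping.single (u, p) 1) (path_dif Q deg \<delta> q))"
        using path_dif_append[OF p(1), of q w] q p(2) True by (simp add: pm_scale_add)
      also have "pm_scale (c * d) (path_mult Q (path_dif Q deg \<delta> p) (Poly_Mapping.single (v', q) 1)) =
          path_mult Q (dif P (Poly_Mapping.single k c)) (Poly_Mapping.single l d)"
        unfolding k l s[of v' q d] P_dif_single by (simp only: path_mult_scale_left path_mult_scale_right pm_scale_simps(4) mult.commute)
      also have "pm_scale (c * d * (-1) powi n) (path_mult Q (Poly_Mapping.single (u, p) 1) (path_dif Q deg \<delta> q)) =
          pm_scale ((-1) powi n) (path_mult Q (Poly_Mapping.single k c) (dif P (Poly_Mapping.single l d)))"
        unfolding k l s[of u p c] P_dif_single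
        by (simp only: path_mult_scale_left path_mult_scale_right pm_scale_simps(4) mult.commute mult.left_commute)
      finally show ?thesis .
    next
      case False
      then show ?thesis
        using mult_single_ending_at[OF kp, of v' q d] single_mult_starting_at[OF kq, of u p c] awalk_awlast[OF p(1)]
        by (simp add: k l path_mult_single path_mult_scale_left path_mult_scale_right)
    qed
  next
    case (add f g)
    then show ?case by (simp add: path_mult_add_right P_dif lin_ext_add pm_scale_add)
  qed (simp add: P_dif)
next
  case (add f g)
  then show ?case by (simp add: path_mult_add_left P_dif lin_ext_add pm_scale_add)
qed (simp add: P_dif)

lemma P_dif_homog: "x \<in> homog P n \<Longrightarrow> dif P x \<in> homog P (n + 1)"
  unfolding P_homog P_dif mem_Collect_eq
proof (erule keys_lin_ext)
  fix a assume "a \<in> {(u, p) \<in> quiver_paths Q. sum_list (map deg p) = n}"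
  then obtain u p where a: "a = (u, p)" "(u, p) \<in> quiver_paths Q" "sum_list (map deg p) = n" by auto
  then show "Poly_Mapping.keys (path_dif Q deg \<delta> (snd a)) \<subseteq> {(u, p) \<in> quiver_paths Q. sum_list (map deg p) = n + 1}"
    using keys_path_dif[of u p] walks_between_paths[of u _ "n + 1"] by (fastforce simp: quiver_paths_iff)
qed

lemma homog_subset: "homog P n \<subseteq> carrier P"
  by (auto simp: P_homog)

lemma P_dif_closed: "x \<in> carrier P \<Longrightarrow> dif P x \<in> carrier P"
  unfolding P_dif P_simps mem_Collect_eq
proof (erule keys_lin_ext)
  fix a assume "a \<in> quiver_paths Q"
  then show "Poly_Mapping.keys (path_dif Q deg \<delta> (snd a)) \<subseteq> quiver_paths Q"
    using keys_path_dif[of "fst a" "snd a"] walks_between_paths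
    by (cases a) (fastforce simp: quiver_paths_iff)
qed

lemma P_dif_path_dif: "awalk u p v \<Longrightarrow> dif P (path_dif Q deg \<delta> p) = 0"
proof (induction p arbitrary: u)
  case (Cons e p)
  then have e: "e \<in> arcs Q" "u = tail Q e" and p: "awalk (head Q e) p v"
    by (auto simp: awalk_Cons_iff)
  have \<delta>k: "Poly_Mapping.keys (\<delta> e) \<subseteq> walks_between u (head Q e) (deg e + 1)"
    using \<delta>_keys[OF e(1)] e(2) by (auto simp: walks_between_def)
  then have \<delta>: "\<delta> e \<in> homog P (deg e + 1)"
    using subset_trans[OF _ walks_between_paths] by (simp add: P_homog)
  have "awalk u [e] (head Q e)" using e by (simp add: arc_implies_awalk)
  then have ep: "path_of Q [e] \<in> homog P (deg e)" using e(2) by (auto simp: P_homog path_of_def quiver_paths_def)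
  have "Poly_Mapping.keys (path_dif Q deg \<delta> p) \<subseteq> quiver_paths Q"
    using subset_trans[OF keys_path_dif[OF p] walks_between_paths] by blast
  then have pp: "Poly_Mapping.single (head Q e, p) 1 \<in> carrier P" "path_dif Q deg \<delta> p \<in> carrier P"
    using p by (auto simp: quiver_paths_iff awalk_awlast[OF p])
  have "dif P (path_of Q [e]) = \<delta> e"
    using trivial_path_mult(2)[OF \<delta>k] by (simp add: path_of_def path_scale_eq)
  then show ?case
    using P_leibniz[OF \<delta> pp(1)] P_leibniz[OF ep pp(2)] dif_\<delta>[OF e(1)] Cons.IH[OF p]
    by (simp add: P_dif lin_ext_add lin_ext_scale path_scale_eq power_int_add pm_scale_uminus)
qed (simp add: P_dif)

lemma P_dif_dif: "x \<in> carrier P \<Longrightarrow> dif P (dif P x) = 0"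
proof -
  assume "x \<in> carrier P"
  then have "Poly_Mapping.keys x \<subseteq> quiver_paths Q" by simp
  then show "dif P (dif P x) = 0"
  proof (induction x rule: pm_induct)
    case (single k c)
    then show ?case using P_dif_path_dif[of "fst k" "snd k"]
      by (cases k) (auto simp: quiver_paths_iff P_dif lin_ext_scale)
  qed (auto simp: P_dif lin_ext_add)
qed

lemma mult_one: "x \<in> carrier P \<Longrightarrow> path_mult Q (one P) x = x \<and> path_mult Q x (one P) = x"
proof -
  assume "x \<in> carrier P"
  then have "Poly_Mapping.keys x \<subseteq> quiver_paths Q" by simp
  then show ?thesis
  proof (induction x rule: pm_induct)
    case (single k c)
    obtain u p where k: "k = (u, p)" by (cases k)
    then have "u \<in> verts Q" "pre_digraph.awlast Q u p \<in> verts Q"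
      using single by (auto simp: quiver_paths_iff)
    then show ?case using finite_verts
      by (simp add: k path_mult_sum_left path_mult_sum_right path_mult_single)
  qed (auto simp: path_mult_add_left path_mult_add_right simp del: P_simps(3))
qed

lemma P_mult_closed: "x \<in> carrier P \<Longrightarrow> y \<in> carrier P \<Longrightarrow> path_mult Q x y \<in> carrier P"
  by (auto intro!: keys_path_mult simp: quiver_paths_iff del: subsetI)

lemma P_mult_homog: "x \<in> homog P m \<Longrightarrow> y \<in> homog P n \<Longrightarrow> path_mult Q x y \<in> homog P (m + n)"
  by (auto intro!: keys_path_mult simp: P_homog quiver_paths_iff del: subsetI)

lemma P_ring: "ring P"
proof (rule ringI)
  show "abelian_group P"
    by (rule abelian_groupI) (auto simp: algebra_simps intro!: keys_add_subset exI[of _ "- _"] del: subsetI)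
  show "Group.monoid P"
  proof (rule monoidI)
    show "\<one>\<^bsub>P\<^esub> \<in> carrier P"
      by (auto simp: quiver_paths_def awalk_Nil_iff dest!: subsetD[OF keys_sum] split: if_splits)
  qed (use mult_one P_mult_closed in \<open>auto simp: path_mult_assoc simp del: P_simps(1,3)\<close>)
qed (auto simp: path_mult_add_left path_mult_add_right)

definition deg_part :: "int \<Rightarrow> ('v, 'e, 'k) path_elem \<Rightarrow> ('v, 'e, 'k) path_elem" where
  "deg_part n = lin_ext (\<lambda>a. if sum_list (map deg (snd a)) = n then Poly_Mapping.single a 1 else 0)"

lemma lookup_deg_part:
  "Poly_Mapping.lookup (deg_part n f) a = (if sum_list (map deg (snd a)) = n then Poly_Mapping.lookup f a else 0)"
  by (induction f rule: pm_induct_all) (auto simp: deg_part_def lin_ext_add lookup_add lookup_single when_def)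

lemma P_finsum:
  assumes "finite F" "\<And>n. n \<in> F \<Longrightarrow> f n \<in> carrier P"
  shows "(\<Oplus>\<^bsub>P\<^esub>n\<in>F. f n) = (\<Sum>n\<in>F. f n)"
proof -
  interpret ring P by (rule P_ring)
  show ?thesis using assms
  proof (induction F rule: finite_induct)
    case (insert x F)
    then show ?case by (subst finsum_insert) (auto simp del: P_simps(1))
  qed simp
qed

lemma P_graded_space: "graded_space P"
proof (rule graded_spaceI[where pr = deg_part])
  show mod: "Module.module field_ring P"
  proof (rule field_ring_moduleI)
    show "abelian_group P" using P_ring by (rule ring.is_abelian_group)
  qed (auto simp: pm_scale_add pm_scale_add_left intro!: keys_scale_subset del: subsetI)
  show "submodule (homog P n) field_ring P" for n
  proof (rule Module.module.submoduleI[OF mod homog_subset])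
    interpret ring P by (rule P_ring)
    show "\<ominus>\<^bsub>P\<^esub> x \<in> homog P n" if "x \<in> homog P n" for x
    proof -
      have "\<ominus>\<^bsub>P\<^esub> x = - x"
        using that homog_subset[of n] by (intro minus_equality) auto
      then show ?thesis using that by (simp add: P_homog)
    qed
  qed (auto simp: P_homog intro!: keys_add_subset keys_scale_subset del: subsetI)
  show "deg_part n x \<in> homog P n" if "x \<in> carrier P" for n x
    using that by (auto simp: P_homog in_keys_iff lookup_deg_part subset_iff split: if_splits)
  show "deg_part n (x \<oplus>\<^bsub>P\<^esub> y) = deg_part n x \<oplus>\<^bsub>P\<^esub> deg_part n y" for n x y
    by (simp add: deg_part_def lin_ext_add)
  show "deg_part m x = (if m = n then x else \<zero>\<^bsub>P\<^esub>)" if "x \<in> homog P n" for m n x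
  proof -
    have "Poly_Mapping.lookup x a = 0" if "sum_list (map deg (snd a)) \<noteq> n" for a
      using that \<open>x \<in> homog P n\<close> by (cases a) (auto simp: P_homog in_keys_iff)
    then show ?thesis by (intro poly_mapping_eqI) (auto simp: lookup_deg_part)
  qed
  show "\<exists>F. finite F \<and> (\<forall>n. n \<notin> F \<longrightarrow> deg_part n x = \<zero>\<^bsub>P\<^esub>) \<and> x = (\<Oplus>\<^bsub>P\<^esub>n\<in>F. deg_part n x)"
    if x: "x \<in> carrier P" for x
  proof (intro exI conjI allI impI)
    let ?F = "(\<lambda>a. sum_list (map deg (snd a))) ` Poly_Mapping.keys x"
    show fin: "finite ?F" by simp
    show "deg_part n x = \<zero>\<^bsub>P\<^esub>" if "n \<notin> ?F" for n
      using that by (intro poly_mapping_eqI) (auto simp: lookup_deg_part in_keys_iff)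
    have "x = (\<Sum>n\<in>?F. deg_part n x)"
      by (rule poly_mapping_eqI) (auto simp: lookup_sum lookup_deg_part in_keys_iff image_iff)
    also have "\<dots> = (\<Oplus>\<^bsub>P\<^esub>n\<in>?F. deg_part n x)"
      using x by (intro P_finsum[symmetric, OF fin]) (auto simp: in_keys_iff lookup_deg_part split: if_splits)
    finally show "x = (\<Oplus>\<^bsub>P\<^esub>n\<in>?F. deg_part n x)" .
  qed
qed

theorem P_dg_algebra: "dg_algebra P"
proof (rule dg_algebra.intro[OF P_graded_space dg_algebra_axioms.intro[OF P_ring]])
  show "\<one>\<^bsub>P\<^esub> \<in> homog P 0"
    by (auto simp: P_homog quiver_paths_def awalk_Nil_iff dest!: subsetD[OF keys_sum] split: if_splits)
qed (use P_leibniz P_dif_homog P_dif_dif P_mult_homog in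
  \<open>auto simp: path_mult_scale_left path_mult_scale_right P_dif lin_ext_add lin_ext_scale simp del: P_simps(1,3)\<close>)

end

section \<open>Ideals generated by homogeneous elements\<close>

context dg_algebra
begin

lemma component_mult_homog_left:
  assumes "y \<in> homog A m" "x \<in> carrier A"
  shows "component (y \<otimes> x) n = y \<otimes> component x (n - m)"
  using assms(2)
proof (induction rule: homog_induct)
  case (homog k x)
  then show ?case using assms(1) by (simp add: component_of_homog[OF mult_homog[OF assms(1) homog]] component_of_homog)
qed (use assms(1) in \<open>auto simp: component_add r_distr component_of_homog[of \<zero> 0]\<close>)

lemma component_mult_homog_right:
  assumes "y \<in> homog A m" "x \<in> carrier A"
  shows "component (x \<otimes> y) n = component x (n - m) \<otimes> y"
  using assms(2)
proof (induction rule: homog_induct)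
  case (homog k x)
  then show ?case using assms(1) by (simp add: component_of_homog[OF mult_homog[OF homog assms(1)]] component_of_homog)
qed (use assms(1) in \<open>auto simp: component_add l_distr component_of_homog[of \<zero> 0]\<close>)

text \<open>The elements whose components all lie in the ideal form an ideal, and it contains the
  generators.\<close>

lemma genideal_graded:
  assumes S: "S \<subseteq> carrier A" and hom: "\<And>s. s \<in> S \<Longrightarrow> \<exists>n. s \<in> homog A n"
    and x: "x \<in> Idl S"
  shows "component x n \<in> Idl S"
proof -
  interpret I: ideal "Idl S" A using S by (rule genideal_ideal)
  define J where "J = {x \<in> carrier A. \<forall>n. component x n \<in> Idl S}"
  have left: "component (y \<otimes> x) n \<in> Idl S" if "x \<in> J" "y \<in> carrier A" for x y n
    using that(2)
  proof (induction arbitrary: n rule: homog_induct)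
    case (homog m y)
    then show ?case using that(1) by (auto simp: component_mult_homog_left J_def intro: I.I_l_closed)
  qed (use that(1) in \<open>auto simp: J_def component_add l_distr component_of_homog[of \<zero> 0]\<close>)
  have right: "component (x \<otimes> y) n \<in> Idl S" if "x \<in> J" "y \<in> carrier A" for x y n
    using that(2)
  proof (induction arbitrary: n rule: homog_induct)
    case (homog m y)
    then show ?case using that(1) by (auto simp: component_mult_homog_right J_def intro: I.I_r_closed)
  qed (use that(1) in \<open>auto simp: J_def component_add r_distr component_of_homog[of \<zero> 0]\<close>)
  have "ideal J A"
  proof (rule idealI[OF ring_axioms])
    show "subgroup J (add_monoid A)"
    proof (rule add.subgroupI)
      show "J \<noteq> {}" by (auto simp: J_def component_of_homog[of \<zero> 0] intro!: exI[of _ \<zero>])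
      show "\<ominus> a \<in> J" if "a \<in> J" for a
        using that component_smult[of a "-1"] by (auto simp: J_def smult_minus_one)
    qed (auto simp: J_def component_add)
  qed (use left right in \<open>auto simp: J_def\<close>)
  moreover have "S \<subseteq> J"
  proof
    fix s assume s: "s \<in> S"
    then obtain m where "s \<in> homog A m" using hom by blast
    then show "s \<in> J" using s genideal_self[OF S] by (auto simp: J_def component_of_homog)
  qed
  ultimately have "Idl S \<subseteq> J" by (rule genideal_minimal)
  then show ?thesis using x by (auto simp: J_def)
qed

end

section \<open>Strand diagrams\<close>

text \<open>The kind of a diagram with its source \<open>(i, j)\<close> and target \<open>(k, l)\<close>. The strands of a
  straight diagram are \<open>i \<rightarrow> k\<close> and \<open>j \<rightarrow> l\<close>, those of a crossing are \<open>i \<rightarrow> l\<close> and \<open>j \<rightarrow> k\<close>. In the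
  third kind one strand runs from \<open>1\<close> to \<open>n1 + 1\<close> along the arrow \<open>\<beta>\<close>, and the other one from \<open>j\<close>
  to the remaining element of \<open>{k, l}\<close>.\<close>

datatype kind = Straight | Crossing | Beta

type_synonym diagram = "kind \<times> (nat \<times> nat) \<times> (nat \<times> nat)"

fun arrow_diagram :: "nat \<Rightarrow> arrow \<Rightarrow> diagram" where
  "arrow_diagram n (X i j) = (Straight, vertex i j, vertex i (j + 1))"
| "arrow_diagram n (Y i j) = (Straight, vertex i j, vertex (i + 1) j)"
| "arrow_diagram n (U i) = (Beta, vertex 1 i, vertex i (n + 1))"
| "arrow_diagram n (Z i) = (Crossing, vertex i (i + 1), vertex (i + 1) (i + 2))"

text \<open>Products of diagrams with common middle vertex \<open>b\<close> and final vertex \<open>c\<close>, where \<open>q\<close> is the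
  end of \<open>\<beta>\<close>. Since \<open>\<beta>\<alpha> = 0\<close>, a strand that has arrived at \<open>q\<close> through \<open>\<beta>\<close> must stay there.
  Strands that cross twice give zero. In the remaining cases without product, the diagrams are
  never composable, since \<open>\<beta>\<close> starts at \<open>1\<close>.\<close>

fun kind_mult :: "nat \<Rightarrow> kind \<Rightarrow> kind \<Rightarrow> nat \<times> nat \<Rightarrow> nat \<times> nat \<Rightarrow> kind option" where
  "kind_mult q Straight t b c = Some t"
| "kind_mult q Crossing Straight b c = Some Crossing"
| "kind_mult q Crossing _ b c = None"
| "kind_mult q Beta Straight b c = (if fst b = q \<and> fst c = q \<or> snd b = q \<and> snd c = q then Some Beta else None)"
| "kind_mult q Beta Crossing b c = (if snd b = q \<and> fst c = q then Some Beta else None)"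
| "kind_mult q Beta Beta b c = None"

locale square_size =
  fixes n1 n2 :: nat
  assumes n1_pos: "1 \<le> n1" and n1_le: "n1 \<le> n2"
begin

definition valid :: "diagram set" where
  "valid = {(t, (i, j), (k, l)). 1 \<le> i \<and> i < j \<and> k < l \<and> l \<le> n1 + n2 \<and>
     (case t of Straight \<Rightarrow> i \<le> k \<and> j \<le> l | Crossing \<Rightarrow> j \<le> k
      | Beta \<Rightarrow> i = 1 \<and> (k \<le> n1 \<and> l = n1 + 1 \<and> j \<le> k \<or> k = n1 + 1 \<and> j \<le> l))}"

fun dmul :: "diagram \<Rightarrow> diagram \<Rightarrow> diagram option" where
  "dmul (t, a, b) (t', b', c) =
     (if b = b' then map_option (\<lambda>s. (s, a, c)) (kind_mult (n1 + 1) t t' b c) else None)"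

lemma dmul_valid:
  assumes "d \<in> valid" "e \<in> valid" "dmul d e = Some f"
  shows "f \<in> valid"
proof -
  obtain t i j k l where d: "d = (t, (i, j), (k, l))" by (cases d) auto
  obtain t' i' j' k' l' where e: "e = (t', (i', j'), (k', l'))" by (cases e) auto
  show ?thesis
    using assms unfolding d e valid_def
    by (cases t; cases t') (auto split: if_splits)
qed

lemma dmul_assoc:
  assumes "d \<in> valid" "e \<in> valid" "f \<in> valid"
  shows "Option.bind (dmul d e) (\<lambda>g. dmul g f) = Option.bind (dmul e f) (dmul d)"
proof -
  obtain t i j k l where d: "d = (t, (i, j), (k, l))" by (cases d) auto
  obtain t' i' j' k' l' where e: "e = (t', (i', j'), (k', l'))" by (cases e) auto
  obtain t'' i'' j'' k'' l'' where f: "f = (t'', (i'', j''), (k'', l''))" by (cases f) auto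
  show ?thesis
    using assms n1_pos unfolding d e f valid_def
    by (cases t; cases t'; cases t'') auto
qed

abbreviation Q :: "(nat \<times> nat, arrow) pre_digraph" where
  "Q \<equiv> sym_quiver n1 n2"

lemma vertex_less [simp]: "a < b \<Longrightarrow> vertex a b = (a, b)" "b < a \<Longrightarrow> vertex a b = (b, a)"
  by (simp_all add: vertex_def)

lemma verts_iff: "(i, j) \<in> verts Q \<longleftrightarrow> 1 \<le> i \<and> i < j \<and> j \<le> n1 + n2"
  by (auto simp: sym_quiver_def Let_def) (metis vertex_less(1))

lemma arcs_iff:
  "X i j \<in> arcs Q \<longleftrightarrow> 1 \<le> i \<and> i < j \<and> j + 1 \<le> n1 + n2"
  "Y i j \<in> arcs Q \<longleftrightarrow> 1 \<le> i \<and> i + 2 \<le> j \<and> j \<le> n1 + n2"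
  "U i \<in> arcs Q \<longleftrightarrow> 2 \<le> i \<and> i \<le> n1 + n2 \<and> i \<noteq> n1 + 1"
  "Z i \<in> arcs Q \<longleftrightarrow> 1 \<le> i \<and> i + 2 \<le> n1 + n2"
  by (auto simp: sym_quiver_def Let_def)

lemma tail_head [simp]: "tail Q = arrow_source" "head Q = arrow_target n1"
  by (auto simp: sym_quiver_def Let_def)

lemma finite_verts_Q: "finite (verts Q)"
proof (rule finite_subset)
  show "verts Q \<subseteq> {..n1 + n2} \<times> {..n1 + n2}" using verts_iff by auto
qed auto

sublocale wf_digraph Q
proof
  fix a assume a: "a \<in> arcs Q"
  show "tail Q a \<in> verts Q" using a n1_pos n1_le by (cases a) (auto simp: arcs_iff verts_iff)
  show "head Q a \<in> verts Q" using a n1_pos n1_le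
    by (cases a) (auto simp: arcs_iff verts_iff linorder_neq_iff)
qed

lemma arrow_diagram_valid: "a \<in> arcs Q \<Longrightarrow> arrow_diagram n1 a \<in> valid"
  using n1_pos n1_le by (cases a) (auto simp: arcs_iff valid_def linorder_neq_iff)

lemma arrow_diagram_ends: "arrow_diagram n1 a = (t, b, c) \<Longrightarrow> b = arrow_source a \<and> c = arrow_target n1 a"
  by (cases a) auto

text \<open>A path is the stack of the diagrams of its arrows; \<open>None\<close> stands for zero.\<close>

fun eval_path :: "nat \<times> nat \<Rightarrow> arrow list \<Rightarrow> diagram option" where
  "eval_path u [] = Some (Straight, u, u)"
| "eval_path u (a # q) = Option.bind (eval_path (arrow_target n1 a) q) (dmul (arrow_diagram n1 a))"

lemma eval_path_valid:
  "awalk u q v \<Longrightarrow> eval_path u q = Some d \<Longrightarrow> d \<in> valid \<and> fst (snd d) = u \<and> snd (snd d) = v"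
proof (induction q arbitrary: u d)
  case Nil
  then show ?case by (cases u) (auto simp: awalk_Nil_iff valid_def verts_iff)
next
  case (Cons a q)
  then have a: "a \<in> arcs Q" "u = arrow_source a" and q: "awalk (arrow_target n1 a) q v"
    by (auto simp: awalk_Cons_iff)
  from Cons.prems(2) obtain e where e: "eval_path (arrow_target n1 a) q = Some e" "dmul (arrow_diagram n1 a) e = Some d"
    by (auto simp: bind_eq_Some_conv)
  note IH = Cons.IH[OF q e(1)]
  obtain t b c where ad: "arrow_diagram n1 a = (t, b, c)" by (cases "arrow_diagram n1 a")
  have "fst (snd d) = u \<and> snd (snd d) = v"
    using e(2) arrow_diagram_ends[OF ad] IH a(2) by (cases e) (auto simp: ad split: if_splits)
  then show ?case using dmul_valid[OF arrow_diagram_valid[OF a(1)] _ e(2)] IH by auto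
qed

lemma dmul_identity: "(t, a, b) \<in> valid \<Longrightarrow> dmul (Straight, a, a) (t, a, b) = Some (t, a, b)"
    "(t, a, b) \<in> valid \<Longrightarrow> dmul (t, a, b) (Straight, b, b) = Some (t, a, b)"
  by (cases t; auto simp: valid_def)+

lemma eval_path_arrow: "a \<in> arcs Q \<Longrightarrow> eval_path (arrow_source a) [a] = Some (arrow_diagram n1 a)"
proof -
  assume a: "a \<in> arcs Q"
  obtain t b c where ad: "arrow_diagram n1 a = (t, b, c)" by (cases "arrow_diagram n1 a")
  then show ?thesis
    using dmul_identity(2)[of t b c] arrow_diagram_valid[OF a] arrow_diagram_ends[OF ad] by (simp add: ad)
qed

lemma eval_path_append:
  assumes "awalk u q v" "awalk v r w"
  shows "eval_path u (q @ r) = Option.bind (eval_path u q) (\<lambda>d. Option.bind (eval_path v r) (dmul d))"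
  using assms(1)
proof (induction q arbitrary: u)
  case Nil
  then have "u = v" by (auto simp: awalk_Nil_iff)
  then show ?case using eval_path_valid[OF assms(2)] dmul_identity(1)
    by (cases "eval_path v r") auto
next
  case (Cons a q)
  then have a: "a \<in> arcs Q" "u = arrow_source a" and q: "awalk (arrow_target n1 a) q v"
    by (auto simp: awalk_Cons_iff)
  show ?case
  proof (cases "eval_path (arrow_target n1 a) q")
    case None
    then show ?thesis using Cons.IH[OF q] by simp
  next
    case (Some d)
    show ?thesis
    proof (cases "eval_path v r")
      case None
      then show ?thesis using Cons.IH[OF q] Some by (simp add: bind_eq_None_conv)
    next
      case (Some e)
      then show ?thesis
        using Cons.IH[OF q] \<open>eval_path (arrow_target n1 a) q = Some d\<close>
          dmul_assoc[OF arrow_diagram_valid[OF a(1)], of d e] eval_path_valid[OF q] eval_path_valid[OF assms(2)]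
        by simp
    qed
  qed
qed

text \<open>The normal form of a straight diagram moves the right strand before the left one. That of
  a crossing moves the left strand until it stands next to the right one, crosses there, and
  proceeds without crossing. An arrow \<open>\<beta>\<close> comes last.\<close>

definition straight_nf :: "nat \<Rightarrow> nat \<Rightarrow> nat \<Rightarrow> nat \<Rightarrow> arrow list" where
  "straight_nf i j k l = map (X i) [j..<l] @ map (\<lambda>t. Y t l) [i..<k]"

fun normal_form :: "diagram \<Rightarrow> arrow list" where
  "normal_form (Straight, (i, j), (k, l)) = straight_nf i j k l"
| "normal_form (Crossing, (i, j), (k, l)) = map (\<lambda>t. Y t j) [i..<j - 1] @ [Z (j - 1)] @ straight_nf j (j + 1) k l"
| "normal_form (Beta, (i, j), (k, l)) = (let m = (if k = n1 + 1 then l else k) in map (X 1) [j..<m] @ [U m])"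

lemma awalk_snoc: "awalk u q v \<Longrightarrow> a \<in> arcs Q \<Longrightarrow> v = arrow_source a \<Longrightarrow> w = arrow_target n1 a \<Longrightarrow> awalk u (q @ [a]) w"
  using arc_implies_awalk[of a] by (auto intro: awalk_appendI)

lemma awalk_X: "1 \<le> i \<Longrightarrow> i < j \<Longrightarrow> j \<le> l \<Longrightarrow> l \<le> n1 + n2 \<Longrightarrow> awalk (i, j) (map (X i) [j..<l]) (i, l)"
proof (induction l)
  case (Suc l)
  show ?case
  proof (cases "j = Suc l")
    case False
    then have "awalk (i, j) (map (X i) [j..<l] @ [X i l]) (i, Suc l)"
      using Suc by (intro awalk_snoc[OF Suc.IH]) (auto simp: arcs_iff)
    then show ?thesis using False Suc by simp
  qed (use Suc in \<open>auto simp: awalk_Nil_iff verts_iff\<close>)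
qed auto

lemma awalk_Y: "1 \<le> i \<Longrightarrow> i \<le> k \<Longrightarrow> k < l \<Longrightarrow> l \<le> n1 + n2 \<Longrightarrow> awalk (i, l) (map (\<lambda>t. Y t l) [i..<k]) (k, l)"
proof (induction k)
  case (Suc k)
  show ?case
  proof (cases "i = Suc k")
    case False
    then have "awalk (i, l) (map (\<lambda>t. Y t l) [i..<k] @ [Y k l]) (Suc k, l)"
      using Suc by (intro awalk_snoc[OF Suc.IH]) (auto simp: arcs_iff)
    then show ?thesis using False Suc by simp
  qed (use Suc in \<open>auto simp: awalk_Nil_iff verts_iff\<close>)
qed auto

lemma awalk_straight_nf:
  "1 \<le> i \<Longrightarrow> i < j \<Longrightarrow> i \<le> k \<Longrightarrow> j \<le> l \<Longrightarrow> k < l \<Longrightarrow> l \<le> n1 + n2 \<Longrightarrow> awalk (i, j) (straight_nf i j k l) (k, l)"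
  unfolding straight_nf_def by (rule awalk_appendI[OF awalk_X awalk_Y]) auto

lemma awalk_normal_form:
  assumes "d \<in> valid"
  shows "awalk (fst (snd d)) (normal_form d) (snd (snd d))"
proof -
  obtain t i j k l where d: "d = (t, (i, j), (k, l))" by (cases d) auto
  show ?thesis
  proof (cases t)
    case Straight
    then show ?thesis using assms by (auto simp: d valid_def intro!: awalk_straight_nf)
  next
    case Crossing
    then have v: "1 \<le> i" "i < j" "j \<le> k" "k < l" "l \<le> n1 + n2" using assms by (auto simp: d valid_def)
    have "awalk (i, j) (map (\<lambda>t. Y t j) [i..<j - 1]) (j - 1, j)" using v by (intro awalk_Y) auto
    then have "awalk (i, j) (map (\<lambda>t. Y t j) [i..<j - 1] @ [Z (j - 1)]) (j, j + 1)"
      using v by (intro awalk_snoc) (auto simp: arcs_iff)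
    from awalk_appendI[OF this awalk_straight_nf[of j "j + 1" k l]] show ?thesis
      using v by (simp add: d Crossing)
  next
    case Beta
    define m where "m = (if k = n1 + 1 then l else k)"
    have v: "i = 1" "1 < j" "j \<le> m" "m \<le> n1 + n2" "m \<noteq> n1 + 1" "(k, l) = vertex m (n1 + 1)"
      using assms n1_pos n1_le by (auto simp: d valid_def Beta m_def)
    have nf: "normal_form d = map (X 1) [j..<m] @ [U m]"
      using v(1) by (simp add: d Beta m_def Let_def)
    have "awalk (1, j) (map (X 1) [j..<m] @ [U m]) (k, l)"
      using v by (intro awalk_snoc[OF awalk_X]) (auto simp: arcs_iff)
    then show ?thesis using v(1) unfolding nf by (simp add: d)
  qed
qed

lemma eval_X: "1 \<le> i \<Longrightarrow> i < j \<Longrightarrow> j \<le> l \<Longrightarrow> l \<le> n1 + n2 \<Longrightarrow>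
    eval_path (i, j) (map (X i) [j..<l]) = Some (Straight, (i, j), (i, l))"
proof (induction l)
  case (Suc l)
  show ?case
  proof (cases "j = Suc l")
    case False
    have "awalk (i, l) [X i l] (i, Suc l)" using Suc False by (intro awalk_snoc[of _ "[]", simplified]) (auto simp: arcs_iff awalk_Nil_iff verts_iff)
    then have "eval_path (i, j) (map (X i) [j..<l] @ [X i l]) = Some (Straight, (i, j), (i, Suc l))"
      using eval_path_append[OF awalk_X[of i j l], of "[X i l]"] Suc False by simp
    then show ?thesis using False Suc by simp
  qed (use Suc in auto)
qed auto

lemma eval_Y: "1 \<le> i \<Longrightarrow> i \<le> k \<Longrightarrow> k < l \<Longrightarrow> l \<le> n1 + n2 \<Longrightarrow>
    eval_path (i, l) (map (\<lambda>t. Y t l) [i..<k]) = Some (Straight, (i, l), (k, l))"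
proof (induction k)
  case (Suc k)
  show ?case
  proof (cases "i = Suc k")
    case False
    have "awalk (k, l) [Y k l] (Suc k, l)" using Suc False by (intro awalk_snoc[of _ "[]", simplified]) (auto simp: arcs_iff awalk_Nil_iff verts_iff)
    then have "eval_path (i, l) (map (\<lambda>t. Y t l) [i..<k] @ [Y k l]) = Some (Straight, (i, l), (Suc k, l))"
      using eval_path_append[OF awalk_Y[of i k l], of "[Y k l]"] Suc False by simp
    then show ?thesis using False Suc by simp
  qed (use Suc in auto)
qed auto

lemma eval_straight_nf:
  "1 \<le> i \<Longrightarrow> i < j \<Longrightarrow> i \<le> k \<Longrightarrow> j \<le> l \<Longrightarrow> k < l \<Longrightarrow> l \<le> n1 + n2 \<Longrightarrow>
    eval_path (i, j) (straight_nf i j k l) = Some (Straight, (i, j), (k, l))"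
  unfolding straight_nf_def using awalk_X[of i j l] awalk_Y[of i k l]
  by (subst eval_path_append[of _ _ "(i, l)" _ "(k, l)"]) (auto simp: eval_X eval_Y)

lemma eval_normal_form:
  assumes "d \<in> valid"
  shows "eval_path (fst (snd d)) (normal_form d) = Some d"
proof -
  obtain t i j k l where d: "d = (t, (i, j), (k, l))" by (cases d) auto
  show ?thesis
  proof (cases t)
    case Straight
    then show ?thesis using assms by (auto simp: d valid_def intro!: eval_straight_nf)
  next
    case Crossing
    then have v: "1 \<le> i" "i < j" "j \<le> k" "k < l" "l \<le> n1 + n2" using assms by (auto simp: d valid_def)
    have 1: "awalk (i, j) (map (\<lambda>t. Y t j) [i..<j - 1]) (j - 1, j)" using v by (intro awalk_Y) auto
    have 2: "awalk (j - 1, j) [Z (j - 1)] (j, j + 1)"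
      using v by (intro awalk_snoc[of _ "[]", simplified]) (auto simp: arcs_iff awalk_Nil_iff verts_iff)
    have 3: "awalk (j, j + 1) (straight_nf j (j + 1) k l) (k, l)" using v by (intro awalk_straight_nf) auto
    have "eval_path (i, j) (map (\<lambda>t. Y t j) [i..<j - 1] @ [Z (j - 1)] @ straight_nf j (j + 1) k l) = Some d"
      unfolding eval_path_append[OF 1 awalk_appendI[OF 2 3]] eval_path_append[OF 2 3]
      using v by (simp add: eval_Y eval_straight_nf d Crossing)
    then show ?thesis by (simp add: d Crossing)
  next
    case Beta
    define m where "m = (if k = n1 + 1 then l else k)"
    have v: "i = 1" "1 < j" "j \<le> m" "m \<le> n1 + n2" "m \<noteq> n1 + 1" "(k, l) = vertex m (n1 + 1)"
      using assms n1_pos n1_le by (auto simp: d valid_def Beta m_def)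
    have nf: "normal_form d = map (X 1) [j..<m] @ [U m]"
      using v(1) by (simp add: d Beta m_def Let_def)
    have U: "U m \<in> arcs Q" using v by (auto simp: arcs_iff)
    have 1: "awalk (1, m) [U m] (k, l)"
      using arc_implies_awalk[OF U] v by simp
    have "eval_path (1, m) [U m] = Some (Beta, (1, m), (k, l))"
      using eval_path_arrow[OF U] v by simp
    moreover have "awalk (1, j) (map (X 1) [j..<m]) (1, m)" "eval_path (1, j) (map (X 1) [j..<m]) = Some (Straight, (1, j), (1, m))"
      using v by (auto intro!: awalk_X eval_X)
    ultimately have "eval_path (1, j) (map (X 1) [j..<m] @ [U m]) = Some d"
      using eval_path_append[OF _ 1, of "(1, j)"] v(1) by (simp add: d Beta del: eval_path.simps)
    then show ?thesis using v(1) unfolding nf by (simp add: d)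
  qed
qed

end

section \<open>The symmetric square algebra\<close>

locale sym_square = square_size n1 n2 for n1 n2 :: nat +
  fixes deg :: "arrow \<Rightarrow> int" and ty :: "'k::field itself"
  assumes admissible: "admissible_grading ty n1 n2 deg"
begin

lemma admissibleD:
  "\<rho> \<in> sym_relations n1 n2 \<Longrightarrow> \<exists>n. \<rho> \<in> homog (sym_path_dga n1 n2 deg :: ('k, 'k sym_elem) dg_alg) n"
  "a \<in> arcs Q \<Longrightarrow> arrow_dif n1 n2 a \<in> homog (sym_path_dga n1 n2 deg :: ('k, 'k sym_elem) dg_alg) (deg a + 1)"
  "x \<in> sym_ideal n1 n2 deg \<Longrightarrow> dif (sym_path_dga n1 n2 deg :: ('k, 'k sym_elem) dg_alg) x \<in> sym_ideal n1 n2 deg"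
  using admissible unfolding admissible_grading_def Let_def by auto

sublocale dg_quiver Q deg "arrow_dif n1 n2 :: arrow \<Rightarrow> 'k sym_elem"
proof
  show "finite (verts Q)" by (rule finite_verts_Q)
  fix e assume e: "e \<in> arcs Q"
  show "v = tail Q e \<and> awalk (tail Q e) q (head Q e) \<and> sum_list (map deg q) = deg e + 1"
    if k: "(v, q) \<in> Poly_Mapping.keys (arrow_dif n1 n2 e :: 'k sym_elem)" for v q
  proof (cases e)
    case (Z i)
    have "sum_list (map deg q) = deg e + 1"
      using admissibleD(2)[OF e] k by (auto simp: sym_path_dga_def path_dga_def)
    then show ?thesis using k e Z
      by (auto simp: path_of_def awalk_Cons_iff awalk_Nil_iff arcs_iff verts_iff)
  qed (use k in auto)
  show "dif (path_dga Q deg (arrow_dif n1 n2)) (arrow_dif n1 n2 e :: 'k sym_elem) = 0"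
    by (cases e) (auto simp: path_dga_def path_of_def path_scale_eq)
qed

abbreviation I :: "'k sym_elem set" where
  "I \<equiv> sym_ideal n1 n2 deg"

lemma sym_path_dga_eq: "sym_path_dga n1 n2 deg = P"
  by (simp add: sym_path_dga_def)

lemma relations_carrier: "(sym_relations n1 n2 :: 'k sym_elem set) \<subseteq> carrier P"
  using admissibleD(1) homog_subset by (auto simp: sym_path_dga_eq simp del: P_simps)

text \<open>The relations are homogeneous, and the ideal is stable under the differential because the
  grading is admissible.\<close>

lemma dg_ideal_I: "dg_ideal P I"
proof -
  interpret PA: dg_algebra P by (rule P_dg_algebra)
  have eq: "I = Idl\<^bsub>P\<^esub> (sym_relations n1 n2)" by (simp add: sym_ideal_def sym_path_dga_eq)
  show ?thesis
  proof (rule dg_ideal.intro[OF P_dg_algebra _ dg_ideal_axioms.intro])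
    show "ideal I P" unfolding eq by (rule PA.genideal_ideal[OF relations_carrier])
    show "PA.component x n \<in> I" if "x \<in> I" for x n
      using that unfolding eq
      by (rule PA.genideal_graded[OF relations_carrier, rotated]) (use admissibleD(1) in \<open>auto simp: sym_path_dga_eq\<close>)
    show "dif P x \<in> I" if "x \<in> I" for x
      using admissibleD(3)[OF that] by (simp add: sym_path_dga_eq)
  qed
qed

sublocale I: dg_ideal P I by (rule dg_ideal_I)

abbreviation A :: "('k, 'k sym_elem set) dg_alg" where
  "A \<equiv> sym_dga n1 n2 deg"

lemma sym_dga_eq: "A = quot_dga P I"
  by (simp add: sym_dga_def sym_path_dga_eq)

definition coset :: "'k sym_elem \<Rightarrow> 'k sym_elem set" where
  "coset f = I +>\<^bsub>P\<^esub> f"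

abbreviation mon :: "nat \<times> nat \<Rightarrow> arrow list \<Rightarrow> 'k sym_elem" where
  "mon u q \<equiv> Poly_Mapping.single (u, q) 1"

definition path_class :: "nat \<times> nat \<Rightarrow> arrow list \<Rightarrow> 'k sym_elem set" where
  "path_class u q = coset (mon u q)"

lemma minus_P: "x \<in> carrier P \<Longrightarrow> y \<in> carrier P \<Longrightarrow> x \<ominus>\<^bsub>P\<^esub> y = x - y"
proof -
  assume *: "x \<in> carrier P" "y \<in> carrier P"
  then have "\<ominus>\<^bsub>P\<^esub> y = - y" by (intro I.minus_equality) auto
  then show ?thesis by (simp add: I.minus_eq)
qed

lemma coset_eq_iff: "f \<in> carrier P \<Longrightarrow> g \<in> carrier P \<Longrightarrow> coset f = coset g \<longleftrightarrow> f - g \<in> I"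
  by (simp add: coset_def I.coset_eq_iff minus_P del: P_simps(1))

lemma coset_add: "f \<in> carrier P \<Longrightarrow> g \<in> carrier P \<Longrightarrow> coset f \<oplus>\<^bsub>A\<^esub> coset g = coset (f + g)"
  and coset_mult: "f \<in> carrier P \<Longrightarrow> g \<in> carrier P \<Longrightarrow> coset f \<otimes>\<^bsub>A\<^esub> coset g = coset (path_mult Q f g)"
  and coset_smult: "f \<in> carrier P \<Longrightarrow> c \<odot>\<^bsub>A\<^esub> coset f = coset (pm_scale c f)"
  and coset_dif: "f \<in> carrier P \<Longrightarrow> dif A (coset f) = coset (dif P f)"
  and coset_zero: "\<zero>\<^bsub>A\<^esub> = coset 0"
  and coset_carrier: "carrier A = coset ` carrier P"
  and coset_homog: "homog A n = coset ` homog P n"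
  unfolding coset_def sym_dga_eq
  using I.quot_add I.quot_mult I.quot_smult I.quot_dif I.quot_zero I.quot_carrier I.quot_homog by simp_all

lemma A_dg_algebra: "dg_algebra A"
  unfolding sym_dga_eq by (rule I.quot_dg_algebra)

sublocale A: dg_algebra A by (rule A_dg_algebra)

lemma coset_closed [simp]: "f \<in> carrier P \<Longrightarrow> coset f \<in> carrier A"
  by (simp add: coset_carrier del: P_simps(1))

lemma mon_carrier [simp]: "awalk u q v \<Longrightarrow> mon u q \<in> carrier P"
  using awalk_awlast[of u q v] by (simp add: quiver_paths_iff)

lemma path_class_closed [simp]: "awalk u q v \<Longrightarrow> path_class u q \<in> carrier A"
  unfolding path_class_def by (intro coset_closed mon_carrier)

lemma path_class_append:
  assumes "awalk u q v" "awalk v r w"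
  shows "path_class u (q @ r) = path_class u q \<otimes>\<^bsub>A\<^esub> path_class v r"
  unfolding path_class_def coset_mult[OF mon_carrier[OF assms(1)] mon_carrier[OF assms(2)]]
  using awalk_awlast[OF assms(1)] by (simp add: path_mult_single)

lemma path_class_cong_left:
  assumes "path_class u q = path_class u r" "awalk u q v" "awalk u r v" "awalk v s w"
  shows "path_class u (q @ s) = path_class u (r @ s)"
  using assms by (simp add: path_class_append)

lemma path_class_cong_right:
  assumes "path_class v q = path_class v r" "awalk u s v" "awalk v q w" "awalk v r w"
  shows "path_class u (s @ q) = path_class u (s @ r)"
  using assms by (simp add: path_class_append)

lemma path_class_zero_left:
  assumes "path_class u q = \<zero>\<^bsub>A\<^esub>" "awalk u q v" "awalk v s w"
  shows "path_class u (q @ s) = \<zero>\<^bsub>A\<^esub>"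
  using assms by (simp add: path_class_append)

lemma path_class_zero_right:
  assumes "path_class v q = \<zero>\<^bsub>A\<^esub>" "awalk u s v" "awalk v q w"
  shows "path_class u (s @ q) = \<zero>\<^bsub>A\<^esub>"
  using assms by (simp add: path_class_append)

lemma relation_in_ideal: "\<rho> \<in> sym_relations n1 n2 \<Longrightarrow> \<rho> \<in> I"
  unfolding sym_ideal_def sym_path_dga_eq using I.genideal_self[OF relations_carrier] by blast

lemma equality_relation:
  assumes "(q, r) \<in> equality_relations n1 n2" "awalk u q v" "awalk u r v" "q \<noteq> []" "r \<noteq> []"
  shows "path_class u q = path_class u r"
proof -
  have "arrow_source (hd q) = u" "arrow_source (hd r) = u" "set q \<union> set r \<subseteq> arcs Q"
    using assms(2-5) by (cases q; cases r; auto simp: awalk_Cons_iff awalk_def)+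
  then have "mon u q - mon u r \<in> sym_relations n1 n2"
    unfolding sym_relations_def Let_def using assms(1)
    by (intro UnI1 CollectI exI[of _ q] exI[of _ r]) (auto simp: path_of_def)
  then show ?thesis
    unfolding path_class_def coset_eq_iff[OF mon_carrier[OF assms(2)] mon_carrier[OF assms(3)]]
    by (rule relation_in_ideal)
qed

lemma zero_relation:
  assumes "q \<in> zero_relations n1 n2" "awalk u q v" "q \<noteq> []"
  shows "path_class u q = \<zero>\<^bsub>A\<^esub>"
proof -
  have "arrow_source (hd q) = u" "set q \<subseteq> arcs Q"
    using assms(2,3) by (cases q; auto simp: awalk_Cons_iff awalk_def)+
  then have "mon u q \<in> sym_relations n1 n2"
    unfolding sym_relations_def Let_def using assms(1) by (auto simp: path_of_def intro!: exI[of _ q])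
  moreover have "0 \<in> carrier P" by simp
  ultimately show ?thesis
    unfolding path_class_def coset_zero using relation_in_ideal
    by (subst coset_eq_iff[OF mon_carrier[OF assms(2)]]) simp_all
qed

lemmas awalk_small = awalk_Cons_iff awalk_Nil_iff arcs_iff verts_iff

section \<open>Reduction of paths to normal form\<close>

text \<open>Repeated use of the commuting squares \<open>x y = y x\<close>.\<close>

lemma commute_Y_X:
  "1 \<le> i \<Longrightarrow> i \<le> k \<Longrightarrow> k < l \<Longrightarrow> l + 1 \<le> n1 + n2 \<Longrightarrow>
    path_class (i, l) (map (\<lambda>t. Y t l) [i..<k] @ [X k l]) = path_class (i, l) ([X i l] @ map (\<lambda>t. Y t (l + 1)) [i..<k])"
proof (induction k)
  case (Suc k)
  show ?case
  proof (cases "i = Suc k")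
    case False
    then have k: "i \<le> k" using Suc by simp
    have w1: "awalk (i, l) (map (\<lambda>t. Y t l) [i..<k]) (k, l)" using Suc k by (intro awalk_Y) auto
    have w2: "awalk (i, l + 1) (map (\<lambda>t. Y t (l + 1)) [i..<k]) (k, l + 1)" using Suc k by (intro awalk_Y) auto
    have "path_class (k, l) [X k l, Y k (l + 1)] = path_class (k, l) [Y k l, X (Suc k) l]"
    proof (rule equality_relation)
      show "([X k l, Y k (l + 1)], [Y k l, X (Suc k) l]) \<in> equality_relations n1 n2"
        using Suc k by (auto simp: equality_relations_def Let_def)
    qed (use Suc k in \<open>auto simp: awalk_small\<close>)
    then have "path_class (i, l) (map (\<lambda>t. Y t l) [i..<k] @ [Y k l, X (Suc k) l]) =
        path_class (i, l) (map (\<lambda>t. Y t l) [i..<k] @ [X k l, Y k (l + 1)])"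
      using Suc k by (intro path_class_cong_right[OF _ w1, where w = "(Suc k, l + 1)"]) (auto simp: awalk_small)
    also have "\<dots> = path_class (i, l) ((map (\<lambda>t. Y t l) [i..<k] @ [X k l]) @ [Y k (l + 1)])" by simp
    also have "\<dots> = path_class (i, l) (([X i l] @ map (\<lambda>t. Y t (l + 1)) [i..<k]) @ [Y k (l + 1)])"
    proof (rule path_class_cong_left[where v = "(k, l + 1)"])
      show "path_class (i, l) (map (\<lambda>t. Y t l) [i..<k] @ [X k l]) =
          path_class (i, l) ([X i l] @ map (\<lambda>t. Y t (l + 1)) [i..<k])"
        using Suc k by (intro Suc.IH) auto
      show "awalk (i, l) (map (\<lambda>t. Y t l) [i..<k] @ [X k l]) (k, l + 1)"
        using Suc k w1 by (intro awalk_snoc[OF w1]) (auto simp: arcs_iff)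
      show "awalk (i, l) ([X i l] @ map (\<lambda>t. Y t (l + 1)) [i..<k]) (k, l + 1)"
        using Suc k w2 by (auto simp: awalk_small)
      show "awalk (k, l + 1) [Y k (l + 1)] (Suc k, l + 1)"
        using Suc k by (auto simp: awalk_small)
    qed
    finally show ?thesis using k by simp
  qed (use Suc in auto)
qed auto

lemma straight_Y: "1 \<le> i \<Longrightarrow> i \<le> k \<Longrightarrow> straight_nf i j k l @ [Y k l] = straight_nf i j (k + 1) l"
  by (simp add: straight_nf_def)

lemma straight_X:
  assumes "1 \<le> i" "i < j" "i \<le> k" "j \<le> l" "k < l" "l + 1 \<le> n1 + n2"
  shows "path_class (i, j) (straight_nf i j k l @ [X k l]) = path_class (i, j) (straight_nf i j k (l + 1))"
proof -
  have "path_class (i, j) (map (X i) [j..<l] @ (map (\<lambda>t. Y t l) [i..<k] @ [X k l])) =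
      path_class (i, j) (map (X i) [j..<l] @ ([X i l] @ map (\<lambda>t. Y t (l + 1)) [i..<k]))"
  proof (rule path_class_cong_right[OF commute_Y_X])
    show "awalk (i, j) (map (X i) [j..<l]) (i, l)" using assms by (intro awalk_X) auto
    show "awalk (i, l) (map (\<lambda>t. Y t l) [i..<k] @ [X k l]) (k, l + 1)"
      using assms by (intro awalk_snoc[OF awalk_Y]) (auto simp: arcs_iff)
    show "awalk (i, l) ([X i l] @ map (\<lambda>t. Y t (l + 1)) [i..<k]) (k, l + 1)"
      using assms awalk_Y[of i k "l + 1"] by (auto simp: awalk_small)
  qed (use assms in auto)
  then show ?thesis using assms by (simp add: straight_nf_def)
qed

abbreviation crossing_nf :: "nat \<Rightarrow> nat \<Rightarrow> nat \<Rightarrow> nat \<Rightarrow> arrow list" where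
  "crossing_nf i j k l \<equiv> normal_form (Crossing, (i, j), (k, l))"

lemma crossing_prefix:
  assumes "1 \<le> i" "i < j" "j + 1 \<le> n1 + n2"
  shows "awalk (i, j) (map (\<lambda>t. Y t j) [i..<j - 1] @ [Z (j - 1)]) (j, j + 1)"
  using assms by (intro awalk_snoc[OF awalk_Y]) (auto simp: arcs_iff)

lemma crossing_Y: "j \<le> k \<Longrightarrow> 1 \<le> j \<Longrightarrow> crossing_nf i j k l @ [Y k l] = crossing_nf i j (k + 1) l"
  using straight_Y[of j k "j + 1" l] by simp

lemma crossing_X:
  assumes "1 \<le> i" "i < j" "j \<le> k" "k < l" "l + 1 \<le> n1 + n2"
  shows "path_class (i, j) (crossing_nf i j k l @ [X k l]) = path_class (i, j) (crossing_nf i j k (l + 1))"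
proof -
  have "path_class (i, j) ((map (\<lambda>t. Y t j) [i..<j - 1] @ [Z (j - 1)]) @ (straight_nf j (j + 1) k l @ [X k l])) =
      path_class (i, j) ((map (\<lambda>t. Y t j) [i..<j - 1] @ [Z (j - 1)]) @ straight_nf j (j + 1) k (l + 1))"
  proof (rule path_class_cong_right[OF straight_X])
    show "awalk (i, j) (map (\<lambda>t. Y t j) [i..<j - 1] @ [Z (j - 1)]) (j, j + 1)"
      using assms by (intro crossing_prefix) auto
    show "awalk (j, j + 1) (straight_nf j (j + 1) k l @ [X k l]) (k, l + 1)"
      using assms by (intro awalk_snoc[OF awalk_straight_nf]) (auto simp: arcs_iff)
    show "awalk (j, j + 1) (straight_nf j (j + 1) k (l + 1)) (k, l + 1)"
      using assms by (intro awalk_straight_nf) auto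
  qed (use assms in auto)
  then show ?thesis by simp
qed

lemma awalk_crossing_nf:
  "1 \<le> i \<Longrightarrow> i < j \<Longrightarrow> j \<le> k \<Longrightarrow> k < l \<Longrightarrow> l \<le> n1 + n2 \<Longrightarrow> awalk (i, j) (crossing_nf i j k l) (k, l)"
  using awalk_normal_form[of "(Crossing, (i, j), (k, l))"] by (simp add: valid_def)

text \<open>The relation \<open>z x y = x y z\<close> moves the crossing to the left, up to the first place where
  the strands stand next to each other.\<close>

lemma straight_Z:
  assumes "1 \<le> i" "i < j" "i \<le> k" "j \<le> k + 1" "k + 2 \<le> n1 + n2"
  shows "path_class (i, j) (straight_nf i j k (k + 1) @ [Z k]) = path_class (i, j) (crossing_nf i j (k + 1) (k + 2))"
  using assms(3-5)
proof (induction k)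
  case (Suc k)
  show ?case
  proof (cases "j = Suc k + 1")
    case True
    then show ?thesis by (simp add: straight_nf_def)
  next
    case False
    then have k: "j \<le> k + 1" "i \<le> k" using Suc.prems assms(2) by auto
    have wS: "awalk (i, j) (straight_nf i j k (k + 1)) (k, k + 1)"
      using assms Suc.prems k by (intro awalk_straight_nf) auto
    have w2: "awalk (i, j) (straight_nf i j k (k + 1 + 1)) (k, k + 2)"
      using assms Suc.prems k awalk_straight_nf[of i j k "k + 2"] by simp
    have w3: "awalk (i, j) (straight_nf i j k (k + 1) @ [X k (k + 1)]) (k, k + 2)"
      using assms Suc.prems k by (intro awalk_snoc[OF wS]) (auto simp: arcs_iff)
    have tail: "awalk (k, k + 2) [Y k (k + 2), Z (Suc k)] (k + 2, k + 3)"
      using assms Suc.prems k by (auto simp: awalk_small)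
    have "path_class (i, j) (straight_nf i j (Suc k) (Suc k + 1) @ [Z (Suc k)]) =
        path_class (i, j) (straight_nf i j k (k + 1 + 1) @ [Y k (k + 2), Z (Suc k)])"
      using straight_Y[of i k j "k + 2", symmetric] assms k by simp
    also have "\<dots> = path_class (i, j) ((straight_nf i j k (k + 1) @ [X k (k + 1)]) @ [Y k (k + 2), Z (Suc k)])"
      using assms Suc.prems k by (intro path_class_cong_left[OF straight_X[symmetric] w2 w3 tail]) auto
    also have "\<dots> = path_class (i, j) (straight_nf i j k (k + 1) @ [X k (k + 1), Y k (k + 2), Z (Suc k)])" by simp
    also have "\<dots> = path_class (i, j) (straight_nf i j k (k + 1) @ [Z k, X (Suc k) (k + 2), Y (Suc k) (k + 3)])"
    proof (rule path_class_cong_right[OF _ wS])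
      have "path_class (k, k + 1) [Z k, X (k + 1) (k + 2), Y (k + 1) (k + 3)] =
          path_class (k, k + 1) [X k (k + 1), Y k (k + 2), Z (k + 1)]"
      proof (rule equality_relation)
        show "([Z k, X (k + 1) (k + 2), Y (k + 1) (k + 3)], [X k (k + 1), Y k (k + 2), Z (k + 1)]) \<in> equality_relations n1 n2"
          using Suc.prems k assms by (auto simp: equality_relations_def Let_def)
      qed (use Suc.prems k assms in \<open>auto simp: awalk_small\<close>)
      then show "path_class (k, k + 1) [X k (k + 1), Y k (k + 2), Z (Suc k)] =
          path_class (k, k + 1) [Z k, X (Suc k) (k + 2), Y (Suc k) (k + 3)]" by simp
    qed (use Suc.prems k assms in \<open>auto simp: awalk_small\<close>)
    also have "\<dots> = path_class (i, j) ((straight_nf i j k (k + 1) @ [Z k]) @ [X (Suc k) (k + 2), Y (Suc k) (k + 3)])" by simp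
    also have "\<dots> = path_class (i, j) (crossing_nf i j (k + 1) (k + 2) @ [X (Suc k) (k + 2), Y (Suc k) (k + 3)])"
    proof (rule path_class_cong_left[where v = "(k + 1, k + 2)"])
      show "path_class (i, j) (straight_nf i j k (k + 1) @ [Z k]) = path_class (i, j) (crossing_nf i j (k + 1) (k + 2))"
        using Suc.prems k by (intro Suc.IH) auto
      show "awalk (i, j) (straight_nf i j k (k + 1) @ [Z k]) (k + 1, k + 2)"
        using assms Suc.prems k by (intro awalk_snoc[OF wS]) (auto simp: arcs_iff)
      show "awalk (i, j) (crossing_nf i j (k + 1) (k + 2)) (k + 1, k + 2)"
        using assms Suc.prems k by (intro awalk_crossing_nf) auto
      show "awalk (k + 1, k + 2) [X (Suc k) (k + 2), Y (Suc k) (k + 3)] (k + 2, k + 3)"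
        using assms Suc.prems k by (auto simp: awalk_small)
    qed
    also have "\<dots> = path_class (i, j) ((crossing_nf i j (k + 1) (k + 2) @ [X (k + 1) (k + 2)]) @ [Y (Suc k) (k + 3)])" by simp
    also have "\<dots> = path_class (i, j) (crossing_nf i j (k + 1) (k + 2 + 1) @ [Y (Suc k) (k + 3)])"
    proof (rule path_class_cong_left[OF crossing_X, where v = "(k + 1, k + 3)"])
      show "awalk (i, j) (crossing_nf i j (k + 1) (k + 2) @ [X (k + 1) (k + 2)]) (k + 1, k + 3)"
        using assms Suc.prems k by (intro awalk_snoc[OF awalk_crossing_nf]) (auto simp: arcs_iff)
      show "awalk (i, j) (crossing_nf i j (k + 1) (k + 2 + 1)) (k + 1, k + 3)"
        using assms Suc.prems k awalk_crossing_nf[of i j "k + 1" "k + 3"] by (simp add: numeral_3_eq_3 del: normal_form.simps)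
      show "awalk (k + 1, k + 3) [Y (Suc k) (k + 3)] (k + 2, k + 3)"
        using assms Suc.prems k by (auto simp: awalk_small)
    qed (use assms Suc.prems k in auto)
    also have "crossing_nf i j (k + 1) (k + 2 + 1) @ [Y (Suc k) (k + 3)] = crossing_nf i j (Suc k + 1) (Suc k + 2)"
      using crossing_Y[of j "k + 1" i "k + 3"] assms k by (simp add: numeral_3_eq_3 del: normal_form.simps)
    finally show ?thesis .
  qed
qed (use assms in auto)

text \<open>The second crossing moves to the left until it follows the first one, and \<open>z z = 0\<close>.\<close>

lemma crossing_Z:
  assumes "1 \<le> i" "i < j" "j \<le> k" "k + 2 \<le> n1 + n2"
  shows "path_class (i, j) (crossing_nf i j k (k + 1) @ [Z k]) = \<zero>\<^bsub>A\<^esub>"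
proof -
  have w1: "awalk (i, j) (map (\<lambda>t. Y t j) [i..<j - 1]) (j - 1, j)" using assms by (intro awalk_Y) auto
  have w2: "awalk (j, j + 1) (straight_nf j (j + 1) k (k + 1) @ [Z k]) (k + 1, k + 2)"
    using assms by (intro awalk_snoc[OF awalk_straight_nf]) (auto simp: arcs_iff)
  have w3: "awalk (j, j + 1) (crossing_nf j (j + 1) (k + 1) (k + 2)) (k + 1, k + 2)"
    using assms by (intro awalk_crossing_nf) auto
  have w4: "awalk (j + 1, j + 2) (straight_nf (j + 1) (j + 2) (k + 1) (k + 2)) (k + 1, k + 2)"
    using assms by (intro awalk_straight_nf) auto
  have zz: "path_class (j - 1, j) [Z (j - 1), Z j] = \<zero>\<^bsub>A\<^esub>"
  proof (rule zero_relation)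
    show "[Z (j - 1), Z j] \<in> zero_relations n1 n2"
      using assms by (auto simp: zero_relations_def Let_def intro!: exI[of _ "j - 1"])
  qed (use assms in \<open>auto simp: awalk_small\<close>)
  have "path_class (i, j) (crossing_nf i j k (k + 1) @ [Z k]) =
      path_class (i, j) ((map (\<lambda>t. Y t j) [i..<j - 1] @ [Z (j - 1)]) @ (straight_nf j (j + 1) k (k + 1) @ [Z k]))" by simp
  also have "\<dots> = path_class (i, j) ((map (\<lambda>t. Y t j) [i..<j - 1] @ [Z (j - 1)]) @ crossing_nf j (j + 1) (k + 1) (k + 2))"
    using assms by (intro path_class_cong_right[OF straight_Z crossing_prefix w2 w3]) auto
  also have "\<dots> = path_class (i, j) ((map (\<lambda>t. Y t j) [i..<j - 1] @ [Z (j - 1), Z j]) @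
      straight_nf (j + 1) (j + 2) (k + 1) (k + 2))" by simp
  also have "\<dots> = \<zero>\<^bsub>A\<^esub>"
  proof (rule path_class_zero_left[OF path_class_zero_right[OF zz w1] _ w4])
    show *: "awalk (j - 1, j) [Z (j - 1), Z j] (j + 1, j + 2)" using assms by (auto simp: awalk_small)
    show "awalk (i, j) (map (\<lambda>t. Y t j) [i..<j - 1] @ [Z (j - 1), Z j]) (j + 1, j + 2)"
      by (rule awalk_appendI[OF w1 *])
  qed
  finally show ?thesis .
qed

definition diagram_class :: "diagram option \<Rightarrow> 'k sym_elem set" where
  "diagram_class d = (case d of None \<Rightarrow> \<zero>\<^bsub>A\<^esub> | Some d \<Rightarrow> path_class (fst (snd d)) (normal_form d))"

text \<open>Each of the defining relations that begins with an arrow \<open>u\<close> treats one way of continuing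
  a diagram with a \<open>\<beta>\<close>-strand: the strand at \<open>n1 + 1\<close> stays and the other one advances, or the
  product is zero.\<close>

lemma beta_arrow:
  assumes "2 \<le> j" "j \<le> m" "m \<le> n1 + n2" "m \<noteq> n1 + 1" "a \<in> arcs Q" "arrow_source a = vertex m (n1 + 1)"
  shows "path_class (1, j) ((map (X 1) [j..<m] @ [U m]) @ [a]) =
    diagram_class (dmul (Beta, (1, j), vertex m (n1 + 1)) (arrow_diagram n1 a))"
proof -
  have w1: "awalk (1, j) (map (X 1) [j..<m]) (1, m)" using assms by (intro awalk_X) auto
  have Um: "U m \<in> arcs Q" using assms by (simp add: arcs_iff)
  have wa: "awalk (1, m) [U m, a] (arrow_target n1 a)"
    using assms Um head_in_verts[OF assms(5)] by (auto simp: awalk_Cons_iff awalk_Nil_iff)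
  have zero: "path_class (1, j) ((map (X 1) [j..<m] @ [U m]) @ [a]) = \<zero>\<^bsub>A\<^esub>" if "[U m, a] \<in> zero_relations n1 n2"
    using path_class_zero_right[OF zero_relation[OF that wa] w1 wa] by simp
  have eq: "path_class (1, j) ((map (X 1) [j..<m] @ [U m]) @ [a]) = path_class (1, j) (map (X 1) [j..<m'] @ [U m'])"
    if "([U m, a], map (X 1) [m..<m'] @ [U m']) \<in> equality_relations n1 n2" "m < m'"
      "awalk (1, m) (map (X 1) [m..<m'] @ [U m']) (arrow_target n1 a)" for m'
  proof -
    have "path_class (1, j) (map (X 1) [j..<m] @ [U m, a]) =
        path_class (1, j) (map (X 1) [j..<m] @ (map (X 1) [m..<m'] @ [U m']))"
      by (rule path_class_cong_right[OF equality_relation[OF that(1) wa that(3)] w1 wa that(3)]) auto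
    also have "map (X 1) [j..<m] @ (map (X 1) [m..<m'] @ [U m']) = map (X 1) [j..<m'] @ [U m']"
      using upt_add_eq_append[of j m "m' - m"] assms(2) that(2) by (simp flip: map_append)
    finally show ?thesis by simp
  qed
  have wX: "awalk (1, m) (map (X 1) [m..<m'] @ [U m']) (vertex m' (n1 + 1))"
    if "m < m'" "m' \<le> n1 + n2" "m' \<noteq> n1 + 1" for m'
    using that assms by (intro awalk_snoc[OF awalk_X]) (auto simp: arcs_iff)
  show ?thesis
  proof (cases "m < n1 + 1")
    case True
    show ?thesis
    proof (cases a)
      case (X i' j')
      then have "i' = m" "j' = n1 + 1" using assms True by (auto simp: arcs_iff)
      then show ?thesis using zero assms True X
        by (auto simp: diagram_class_def zero_relations_def Let_def)
    next
      case (Y i' j')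
      then have a: "i' = m" "j' = n1 + 1" "m + 1 < n1 + 1" using assms True by (auto simp: arcs_iff)
      have "path_class (1, j) ((map (X 1) [j..<m] @ [U m]) @ [a]) = path_class (1, j) (map (X 1) [j..<m + 1] @ [U (m + 1)])"
        using wX[of "m + 1"] a assms by (intro eq) (auto simp: Y equality_relations_def Let_def)
      then show ?thesis using a assms by (simp add: Y diagram_class_def)
    next
      case (U i')
      then show ?thesis using assms True by (auto simp: arcs_iff vertex_def min_def max_def split: if_splits)
    next
      case (Z i')
      then have a: "i' = m" "m = n1" using assms True by auto
      have "path_class (1, j) ((map (X 1) [j..<m] @ [U m]) @ [a]) = path_class (1, j) (map (X 1) [j..<m + 2] @ [U (m + 2)])"
        using wX[of "m + 2"] a assms n1_pos by (intro eq) (auto simp: Z equality_relations_def Let_def arcs_iff)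
      then show ?thesis using a assms by (simp add: Z diagram_class_def)
    qed
  next
    case False
    then have m: "n1 + 1 < m" using assms by simp
    show ?thesis
    proof (cases a)
      case (X i' j')
      then have a: "i' = n1 + 1" "j' = m" using assms m by (auto simp: arcs_iff)
      have "path_class (1, j) ((map (X 1) [j..<m] @ [U m]) @ [a]) = path_class (1, j) (map (X 1) [j..<m + 1] @ [U (m + 1)])"
        using wX[of "m + 1"] a assms m by (intro eq) (auto simp: X equality_relations_def Let_def arcs_iff)
      then show ?thesis using a assms m by (simp add: X diagram_class_def)
    next
      case (Y i' j')
      then have a: "i' = n1 + 1" "j' = m" "n1 + 3 \<le> m" using assms m by (auto simp: arcs_iff)
      have "[U m, a] \<in> zero_relations n1 n2"
        using a assms by (auto simp: Y zero_relations_def Let_def intro!: exI[of _ "m - n1"])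
      then show ?thesis using zero a assms m by (auto simp: Y diagram_class_def)
    next
      case (U i')
      then show ?thesis using assms m n1_pos by (auto simp: arcs_iff vertex_def min_def max_def split: if_splits)
    next
      case (Z i')
      then have a: "i' = n1 + 1" "m = n1 + 2" using assms m by auto
      have "[U m, a] \<in> zero_relations n1 n2"
        using a by (auto simp: Z zero_relations_def Let_def)
      then show ?thesis using zero a assms m by (auto simp: Z diagram_class_def)
    qed
  qed
qed

text \<open>The step of the reduction to normal forms. The product of a straight diagram or a crossing
  with an arrow is treated by the lemmas on commuting the arrow past the normal form, the product
  of a diagram with a \<open>\<beta>\<close>-strand by \<open>beta_arrow\<close>.\<close>

lemma normal_form_arrow:
  assumes "d \<in> valid" "a \<in> arcs Q" "arrow_source a = snd (snd d)"
  shows "path_class (fst (snd d)) (normal_form d @ [a]) = diagram_class (dmul d (arrow_diagram n1 a))"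
proof -
  obtain t i j k l where d: "d = (t, (i, j), (k, l))" by (cases d) auto
  show ?thesis
  proof (cases t)
    case Straight
    then have v: "1 \<le> i" "i < j" "i \<le> k" "j \<le> l" "k < l" "l \<le> n1 + n2" using assms(1) by (auto simp: d valid_def)
    show ?thesis
    proof (cases a)
      case (X i' j')
      then have "i' = k" "j' = l" using assms by (auto simp: d arcs_iff)
      then show ?thesis using straight_X[of i j k l] v assms by (simp add: d Straight X diagram_class_def arcs_iff)
    next
      case (Y i' j')
      then have "i' = k" "j' = l" using assms by (auto simp: d arcs_iff)
      then show ?thesis using straight_Y[of i k j l] v assms by (simp add: d Straight Y diagram_class_def arcs_iff)
    next
      case (U m)
      then have a: "k = 1" "l = m" "i = 1" using assms v by (auto simp: d arcs_iff)
      then have "m < n1 + 1 \<or> n1 + 1 < m" using assms by (auto simp: U arcs_iff)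
      then show ?thesis using a v by (auto simp: d Straight U diagram_class_def straight_nf_def)
    next
      case (Z m)
      then have "k = m" "l = m + 1" using assms by (auto simp: d arcs_iff)
      then show ?thesis using straight_Z[of i j k] v assms by (simp add: d Straight Z diagram_class_def arcs_iff del: normal_form.simps(2))
    qed
  next
    case Crossing
    then have v: "1 \<le> i" "i < j" "j \<le> k" "k < l" "l \<le> n1 + n2" using assms(1) by (auto simp: d valid_def)
    show ?thesis
    proof (cases a)
      case (X i' j')
      then have "i' = k" "j' = l" using assms by (auto simp: d arcs_iff)
      then show ?thesis using crossing_X[of i j k l] v assms
        by (simp add: d Crossing X diagram_class_def arcs_iff del: normal_form.simps)
    next
      case (Y i' j')
      then have "i' = k" "j' = l" using assms by (auto simp: d arcs_iff)
      then show ?thesis using crossing_Y[of j k i l] v assms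
        by (simp add: d Crossing Y diagram_class_def arcs_iff del: normal_form.simps)
    next
      case (U m)
      then show ?thesis using assms v by (auto simp: d arcs_iff)
    next
      case (Z m)
      then have "k = m" "l = m + 1" using assms by (auto simp: d arcs_iff)
      then show ?thesis using crossing_Z[of i j k] v assms
        by (simp add: d Crossing Z diagram_class_def arcs_iff del: normal_form.simps)
    qed
  next
    case Beta
    define m where "m = (if k = n1 + 1 then l else k)"
    have v: "i = 1" "2 \<le> j" "j \<le> m" "m \<le> n1 + n2" "m \<noteq> n1 + 1" "(k, l) = vertex m (n1 + 1)"
      using assms(1) n1_pos n1_le by (auto simp: d valid_def Beta m_def)
    have nf: "normal_form d = map (X 1) [j..<m] @ [U m]"
      using v(1) by (simp add: d Beta m_def Let_def)
    show ?thesis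
      using beta_arrow[of j m a] v assms unfolding nf by (simp add: d Beta)
  qed
qed

text \<open>By induction along the path: its class is that of a normal form, multiplied by the last
  arrow.\<close>

theorem path_class_eval: "awalk u q v \<Longrightarrow> path_class u q = diagram_class (eval_path u q)"
proof (induction q arbitrary: v rule: rev_induct)
  case Nil
  then obtain i j where "u = (i, j)" "1 \<le> i" "i < j" by (cases u) (auto simp: awalk_Nil_iff verts_iff)
  then show ?case by (simp add: diagram_class_def straight_nf_def)
next
  case (snoc a q)
  define w where "w = pre_digraph.awlast Q u q"
  have q: "awalk u q w" and a: "awalk w [a] v" using snoc.prems by (auto simp: w_def)
  then have aa: "a \<in> arcs Q" "arrow_source a = w" by (auto simp: awalk_Cons_iff)
  have e: "eval_path u (q @ [a]) = Option.bind (eval_path u q) (\<lambda>d. dmul d (arrow_diagram n1 a))"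
    using eval_path_append[OF q a] eval_path_arrow[OF aa(1)] aa(2) by simp
  have pc: "path_class u (q @ [a]) = path_class u q \<otimes>\<^bsub>A\<^esub> path_class w [a]"
    by (rule path_class_append[OF q a])
  show ?case
  proof (cases "eval_path u q")
    case None
    then show ?thesis using pc snoc.IH[OF q] a e by (simp add: diagram_class_def)
  next
    case (Some d)
    note d = eval_path_valid[OF q Some]
    have nf: "awalk u (normal_form d) w" using awalk_normal_form[of d] d by simp
    have "path_class u (q @ [a]) = path_class u (normal_form d) \<otimes>\<^bsub>A\<^esub> path_class w [a]"
      using pc snoc.IH[OF q] Some d by (simp add: diagram_class_def)
    also have "\<dots> = path_class u (normal_form d @ [a])"
      by (rule path_class_append[OF nf a, symmetric])
    also have "\<dots> = diagram_class (dmul d (arrow_diagram n1 a))"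
      using normal_form_arrow[of d a] d aa by simp
    finally show ?thesis using e Some by simp
  qed
qed

end

section \<open>The basis of strand diagrams\<close>

context sym_square
begin

definition diagram_sum :: "'k sym_elem \<Rightarrow> diagram \<Rightarrow>\<^sub>0 'k" where
  "diagram_sum = lin_ext (\<lambda>a. case eval_path (fst a) (snd a) of None \<Rightarrow> 0 | Some d \<Rightarrow> Poly_Mapping.single d 1)"

definition diagram_mult :: "(diagram \<Rightarrow>\<^sub>0 'k) \<Rightarrow> (diagram \<Rightarrow>\<^sub>0 'k) \<Rightarrow> diagram \<Rightarrow>\<^sub>0 'k" where
  "diagram_mult F G = lin_ext (\<lambda>d. lin_ext (\<lambda>e.
     case dmul d e of None \<Rightarrow> 0 | Some f \<Rightarrow> Poly_Mapping.single f 1) G) F"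

lemma diagram_mult_add:
  "diagram_mult (F + G) H = diagram_mult F H + diagram_mult G H"
  "diagram_mult H (F + G) = diagram_mult H F + diagram_mult H G"
  by (simp_all add: diagram_mult_def lin_ext_add lin_ext_add_fun)

lemma diagram_mult_zero [simp]: "diagram_mult 0 H = 0" "diagram_mult H 0 = 0"
  by (simp_all add: diagram_mult_def) (simp add: lin_ext_def)

lemma diagram_mult_single:
  "diagram_mult (Poly_Mapping.single d a) (Poly_Mapping.single e b) =
    (case dmul d e of None \<Rightarrow> 0 | Some f \<Rightarrow> Poly_Mapping.single f (a * b))"
  by (simp add: diagram_mult_def split: option.split)

lemma diagram_sum_linear:
  "diagram_sum (f + g) = diagram_sum f + diagram_sum g" "diagram_sum (pm_scale c f) = pm_scale c (diagram_sum f)"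
  "diagram_sum 0 = 0" "diagram_sum (f - g) = diagram_sum f - diagram_sum g"
  "diagram_sum (- f) = - diagram_sum f"
  by (simp_all add: diagram_sum_def lin_ext_add lin_ext_scale lin_ext_minus lin_ext_uminus)

lemma diagram_sum_single:
  "diagram_sum (Poly_Mapping.single (u, q) c) =
    (case eval_path u q of None \<Rightarrow> 0 | Some d \<Rightarrow> Poly_Mapping.single d c)"
  by (simp add: diagram_sum_def split: option.split)

lemma diagram_sum_valid: "f \<in> carrier P \<Longrightarrow> Poly_Mapping.keys (diagram_sum f) \<subseteq> valid"
  unfolding diagram_sum_def
proof (rule keys_lin_ext)
  fix a assume "a \<in> quiver_paths Q"
  then have "awalk (fst a) (snd a) (pre_digraph.awlast Q (fst a) (snd a))"
    by (cases a) (simp add: quiver_paths_iff)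
  then show "Poly_Mapping.keys (case eval_path (fst a) (snd a) of None \<Rightarrow> 0
      | Some d \<Rightarrow> Poly_Mapping.single d (1 :: 'k)) \<subseteq> valid"
    using eval_path_valid by (auto split: option.split)
qed simp

lemma diagram_sum_mult:
  assumes "f \<in> carrier P" "g \<in> carrier P"
  shows "diagram_sum (path_mult Q f g) = diagram_mult (diagram_sum f) (diagram_sum g)"
proof -
  have f: "Poly_Mapping.keys f \<subseteq> quiver_paths Q" and g: "Poly_Mapping.keys g \<subseteq> quiver_paths Q"
    using assms by auto
  from f show ?thesis
  proof (induction f rule: pm_induct)
    case (single k c)
    obtain u q where k: "k = (u, q)" by (cases k)
    define v where "v = pre_digraph.awlast Q u q"
    have q: "awalk u q v" using single by (simp add: k quiver_paths_iff v_def)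
    from g show ?case
    proof (induction g rule: pm_induct)
      case (single l d)
      obtain v' r where l: "l = (v', r)" by (cases l)
      define w where "w = pre_digraph.awlast Q v' r"
      have r: "awalk v' r w" using single by (simp add: l quiver_paths_iff w_def)
      show ?case
      proof (cases "v = v'")
        case True
        then show ?thesis
          using eval_path_append[OF q, of r w] r awalk_awlast[OF q]
          by (auto simp: k l path_mult_single diagram_sum_single diagram_mult_single split: option.split)
      next
        case False
        have "dmul a b = None" if "eval_path u q = Some a" "eval_path v' r = Some b" for a b
          using eval_path_valid[OF q that(1)] eval_path_valid[OF r that(2)] False by (cases a; cases b) auto
        then show ?thesis
          using False awalk_awlast[OF q]
          by (auto simp: k l path_mult_single diagram_sum_single diagram_mult_single diagram_sum_linear split: option.split)
      qed
    qed (auto simp: path_mult_add_right diagram_sum_linear diagram_mult_add)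
  qed (auto simp: path_mult_add_left diagram_sum_linear diagram_mult_add)
qed

lemma relations_vanish: "\<rho> \<in> sym_relations n1 n2 \<Longrightarrow> diagram_sum \<rho> = 0"
proof -
  assume r: "\<rho> \<in> sym_relations n1 n2"
  consider q r where "\<rho> = path_of Q q - path_of Q r" "(q, r) \<in> equality_relations n1 n2" "set q \<union> set r \<subseteq> arcs Q"
    | q where "\<rho> = path_of Q q" "q \<in> zero_relations n1 n2" "set q \<subseteq> arcs Q"
    using r unfolding sym_relations_def Let_def by blast
  then show ?thesis
  proof cases
    case (1 q r)
    have "eval_path (arrow_source (hd q)) q = eval_path (arrow_source (hd r)) r"
      using 1(2,3) n1_pos n1_le unfolding equality_relations_def Let_def
      by (auto simp: arcs_iff)
    then show ?thesis
      by (simp add: 1(1) path_of_def diagram_sum_linear diagram_sum_single)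
  next
    case (2 q)
    have "eval_path (arrow_source (hd q)) q = None"
      using 2(2,3) n1_pos n1_le unfolding zero_relations_def Let_def
      by (auto simp: arcs_iff)
    then show ?thesis
      by (simp add: 2(1) path_of_def diagram_sum_single)
  qed
qed

text \<open>The elements whose diagrams sum up to zero form an ideal that contains the relations.\<close>

lemma ideal_vanishes: "x \<in> I \<Longrightarrow> diagram_sum x = 0"
proof -
  let ?J = "{f \<in> carrier P. diagram_sum f = 0}"
  have "ideal ?J P"
  proof (rule idealI[OF P_ring])
    show "subgroup ?J (add_monoid P)"
    proof (rule I.add.subgroupI)
      show "\<ominus>\<^bsub>P\<^esub> a \<in> ?J" if "a \<in> ?J" for a
      proof -
        have "\<ominus>\<^bsub>P\<^esub> a = 0 - a"
          using minus_P[of 0 a] that I.minus_eq[of 0 a] I.l_zero[of "\<ominus>\<^bsub>P\<^esub> a"] by auto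
        then show ?thesis using that by (auto simp: diagram_sum_linear)
      qed
    qed (auto simp: diagram_sum_linear intro!: exI[of _ 0] dest!: subsetD[OF keys_add])
  qed (use P_mult_closed in \<open>auto simp: diagram_sum_mult simp del: P_simps(1)\<close>)
  moreover have "sym_relations n1 n2 \<subseteq> ?J"
    using relations_carrier relations_vanish by auto
  ultimately have "I \<subseteq> ?J"
    unfolding sym_ideal_def sym_path_dga_eq by (rule I.genideal_minimal)
  then show "x \<in> I \<Longrightarrow> diagram_sum x = 0" by blast
qed

definition realization :: "(diagram \<Rightarrow>\<^sub>0 'k) \<Rightarrow> 'k sym_elem" where
  "realization = lin_ext (\<lambda>d. mon (fst (snd d)) (normal_form d))"

lemma realization_carrier: "Poly_Mapping.keys F \<subseteq> valid \<Longrightarrow> realization F \<in> carrier P"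
  unfolding realization_def P_simps mem_Collect_eq
proof (erule keys_lin_ext)
  fix d assume "d \<in> valid"
  from mon_carrier[OF awalk_normal_form[OF this]]
  show "Poly_Mapping.keys (mon (fst (snd d)) (normal_form d)) \<subseteq> quiver_paths Q" by simp
qed

lemma diagram_sum_realization: "Poly_Mapping.keys F \<subseteq> valid \<Longrightarrow> diagram_sum (realization F) = F"
  by (induction F rule: pm_induct)
    (auto simp: realization_def lin_ext_add diagram_sum_linear diagram_sum_single eval_normal_form)

text \<open>Together with \<open>ideal_vanishes\<close> this shows that the diagrams form a basis of the quotient.\<close>

lemma coset_realization: "f \<in> carrier P \<Longrightarrow> coset (realization (diagram_sum f)) = coset f"
proof -
  assume "f \<in> carrier P"
  then have "Poly_Mapping.keys f \<subseteq> quiver_paths Q" by simp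
  then show ?thesis
  proof (induction f rule: pm_induct)
    case (single k c)
    obtain u q where k: "k = (u, q)" by (cases k)
    define v where "v = pre_digraph.awlast Q u q"
    have q: "awalk u q v" using single by (simp add: k quiver_paths_iff v_def)
    have s: "Poly_Mapping.single (u, q) c = pm_scale c (mon u q)" by simp
    have "coset (mon u q) = coset (realization (diagram_sum (mon u q)))"
      using path_class_eval[OF q]
      by (auto simp: path_class_def diagram_class_def diagram_sum_single realization_def coset_zero
          split: option.split)
    moreover have "realization (diagram_sum (mon u q)) \<in> carrier P"
      by (rule realization_carrier[OF diagram_sum_valid[OF mon_carrier[OF q]]])
    ultimately show ?case
      unfolding k s diagram_sum_linear
      using coset_smult[OF mon_carrier[OF q], of c] coset_smult[of "realization (diagram_sum (mon u q))" c]
      by (simp add: realization_def lin_ext_scale del: pm_scale_simps(5))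
  next
    case (add f g)
    then have fg: "f \<in> carrier P" "g \<in> carrier P" by auto
    have "coset (f + g) = coset f \<oplus>\<^bsub>A\<^esub> coset g" using fg by (rule coset_add[symmetric])
    also have "\<dots> = coset (realization (diagram_sum f)) \<oplus>\<^bsub>A\<^esub> coset (realization (diagram_sum g))"
      using add by simp
    also have "\<dots> = coset (realization (diagram_sum f) + realization (diagram_sum g))"
      by (intro coset_add realization_carrier diagram_sum_valid fg)
    finally show ?case by (simp add: diagram_sum_linear realization_def lin_ext_add)
  qed (simp add: diagram_sum_linear realization_def)
qed

lemma diagram_sum_cong: "f \<in> carrier P \<Longrightarrow> g \<in> carrier P \<Longrightarrow> coset f = coset g \<Longrightarrow> diagram_sum f = diagram_sum g"
  using ideal_vanishes[of "f - g"] by (simp add: coset_eq_iff diagram_sum_linear del: P_simps(1))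

text \<open>The coordinates of a coset in the basis of diagrams; by \<open>coords_coset\<close> any representative
  gives the same result.\<close>

definition coords :: "'k sym_elem set \<Rightarrow> diagram \<Rightarrow>\<^sub>0 'k" where
  "coords S = diagram_sum (SOME f. f \<in> carrier P \<and> coset f = S)"

lemma coords_coset: "f \<in> carrier P \<Longrightarrow> coords (coset f) = diagram_sum f"
proof -
  assume f: "f \<in> carrier P"
  let ?g = "SOME g. g \<in> carrier P \<and> coset g = coset f"
  have "?g \<in> carrier P \<and> coset ?g = coset f" by (rule someI[of _ f]) (use f in simp)
  then show ?thesis unfolding coords_def using diagram_sum_cong f by blast
qed

lemma carrierE: "S \<in> carrier A \<Longrightarrow> (\<And>f. f \<in> carrier P \<Longrightarrow> S = coset f \<Longrightarrow> thesis) \<Longrightarrow> thesis"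
  by (auto simp: coset_carrier)

lemma coords_valid: "S \<in> carrier A \<Longrightarrow> Poly_Mapping.keys (coords S) \<subseteq> valid"
  by (erule carrierE) (simp add: coords_coset diagram_sum_valid del: P_simps(1))

lemma coords_inject: "S \<in> carrier A \<Longrightarrow> T \<in> carrier A \<Longrightarrow> coords S = coords T \<Longrightarrow> S = T"
  by (elim carrierE) (metis coords_coset coset_realization)

lemma coords_add: "S \<in> carrier A \<Longrightarrow> T \<in> carrier A \<Longrightarrow> coords (S \<oplus>\<^bsub>A\<^esub> T) = coords S + coords T"
proof (elim carrierE)
  fix f g assume fg: "f \<in> carrier P" "g \<in> carrier P" and ST: "S = coset f" "T = coset g"
  then have "f + g \<in> carrier P" by (auto intro!: keys_add_subset del: subsetI)
  then show ?thesis using fg by (simp add: ST coset_add coords_coset diagram_sum_linear del: P_simps(1))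
qed

lemma coords_smult: "S \<in> carrier A \<Longrightarrow> coords (c \<odot>\<^bsub>A\<^esub> S) = pm_scale c (coords S)"
proof (elim carrierE)
  fix f assume f: "f \<in> carrier P" and S: "S = coset f"
  then have "pm_scale c f \<in> carrier P" by (auto intro!: keys_scale_subset del: subsetI)
  then show ?thesis using f by (simp add: S coset_smult coords_coset diagram_sum_linear del: P_simps(1))
qed

lemma coords_mult: "S \<in> carrier A \<Longrightarrow> T \<in> carrier A \<Longrightarrow> coords (S \<otimes>\<^bsub>A\<^esub> T) = diagram_mult (coords S) (coords T)"
  by (elim carrierE) (simp add: coset_mult coords_coset P_mult_closed diagram_sum_mult del: P_simps(1))

lemma coords_zero [simp]: "coords \<zero>\<^bsub>A\<^esub> = 0"
  by (simp add: coset_zero coords_coset diagram_sum_linear)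

lemma coords_minus: "S \<in> carrier A \<Longrightarrow> coords (\<ominus>\<^bsub>A\<^esub> S) = - coords S"
  using coords_smult[of S "-1"] by (simp add: A.smult_minus_one pm_scale_uminus)

lemma coords_path_class:
  "awalk u q v \<Longrightarrow> coords (path_class u q) = (case eval_path u q of None \<Rightarrow> 0 | Some d \<Rightarrow> Poly_Mapping.single d 1)"
  unfolding path_class_def using coords_coset[OF mon_carrier] by (simp add: diagram_sum_single)

lemma path_class_homog: "awalk u q v \<Longrightarrow> path_class u q \<in> homog A (sum_list (map deg q))"
  unfolding path_class_def coset_homog using mon_carrier[of u q v] by (auto simp: P_homog)

text \<open>Both paths represent the same nonzero class, which has only one degree.\<close>

lemma deg_eval_path:
  assumes "awalk u q v" "awalk u r w" "eval_path u q = Some d" "eval_path u r = Some d"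
  shows "sum_list (map deg q) = sum_list (map deg r)"
proof (rule ccontr)
  assume neq: "\<not> ?thesis"
  have "path_class u q = path_class u r"
    using path_class_eval[OF assms(1)] path_class_eval[OF assms(2)] assms(3,4) by simp
  then have "path_class u q = \<zero>\<^bsub>A\<^esub>"
    using A.component_of_homog[OF path_class_homog[OF assms(1)], of "sum_list (map deg q)"]
      A.component_of_homog[OF path_class_homog[OF assms(2)], of "sum_list (map deg q)"] neq by simp
  then have "Poly_Mapping.single d (1 :: 'k) = 0"
    using coords_path_class[OF assms(1)] assms(3) by simp
  then have "Poly_Mapping.lookup (Poly_Mapping.single d (1 :: 'k)) d = 0" by (simp only: lookup_zero)
  then show False by simp
qed

section \<open>Crossings, their resolution and the contraction\<close>

lemma path_dif_zero: "(\<And>a i. a \<in> set q \<Longrightarrow> a \<noteq> Z i) \<Longrightarrow> path_dif Q deg (arrow_dif n1 n2 :: arrow \<Rightarrow> 'k sym_elem) q = 0"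
proof (induction q)
  case (Cons a q)
  then have "arrow_dif n1 n2 a = (0 :: 'k sym_elem)" by (cases a) auto
  then show ?case using Cons by (simp add: path_scale_eq)
qed simp

text \<open>The sign that the Leibniz rule produces when the differential passes the arrows in front
  of the crossing in a normal form.\<close>

definition crossing_sign :: "nat \<times> nat \<Rightarrow> 'k" where
  "crossing_sign u = (-1) powi sum_list (map deg (map (\<lambda>t. Y t (snd u)) [fst u..<snd u - 1]))"

lemma crossing_sign_square [simp]: "crossing_sign u * crossing_sign u = 1"
  by (simp add: crossing_sign_def power_int_mult_distrib[symmetric])

lemma crossing_sign_nonzero [simp]: "crossing_sign u \<noteq> 0"
  by (metis crossing_sign_square mult_zero_left zero_neq_one)

text \<open>The only arrow of the normal form with nonzero differential is the crossing \<open>z\<close>. Its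
  differential \<open>x y\<close> lets the strands pass without crossing, so the resulting path has the
  straight diagram with the same ends.\<close>

lemma crossing_resolution:
  assumes "1 \<le> i" "i < j" "j \<le> k" "k < l" "l \<le> n1 + n2"
  defines "q \<equiv> map (\<lambda>t. Y t j) [i..<j - 1] @ [X (j - 1) j, Y (j - 1) (j + 1)] @ straight_nf j (j + 1) k l"
  shows "awalk (i, j) q (k, l)" "eval_path (i, j) q = Some (Straight, (i, j), (k, l))"
    "sum_list (map deg q) = sum_list (map deg (crossing_nf i j k l)) + 1"
    "path_dif Q deg (arrow_dif n1 n2) (crossing_nf i j k l) = pm_scale (crossing_sign (i, j)) (mon (i, j) q)"
proof -
  let ?l = "map (\<lambda>t. Y t j) [i..<j - 1]" and ?r = "straight_nf j (j + 1) k l"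
  have w1: "awalk (i, j) ?l (j - 1, j)" using assms(1-5) by (intro awalk_Y) auto
  have w2: "awalk (j - 1, j) [X (j - 1) j, Y (j - 1) (j + 1)] (j, j + 1)" using assms(1-5) by (auto simp: awalk_small)
  have w3: "awalk (j, j + 1) ?r (k, l)" using assms(1-5) by (intro awalk_straight_nf) auto
  have w4: "awalk (j - 1, j) [Z (j - 1)] (j, j + 1)" using assms(1-5) by (auto simp: awalk_small)
  show "awalk (i, j) q (k, l)" unfolding q_def by (intro awalk_appendI[OF w1] awalk_appendI[OF w2 w3])
  have e2: "eval_path (j - 1, j) [X (j - 1) j, Y (j - 1) (j + 1)] = Some (Straight, (j - 1, j), (j, j + 1))"
    using assms(1-5) by auto
  have e1: "eval_path (i, j) ?l = Some (Straight, (i, j), (j - 1, j))" using assms(1-5) by (intro eval_Y) auto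
  have e3: "eval_path (j, j + 1) ?r = Some (Straight, (j, j + 1), (k, l))" using assms(1-5) by (intro eval_straight_nf) auto
  show "eval_path (i, j) q = Some (Straight, (i, j), (k, l))"
    unfolding q_def eval_path_append[OF w1 awalk_appendI[OF w2 w3]] eval_path_append[OF w2 w3] e1 e2 e3 by simp
  have Z: "Z (j - 1) \<in> arcs Q" using w4 by (simp add: awalk_Cons_iff)
  have dZ: "arrow_dif n1 n2 (Z (j - 1)) = mon (j - 1, j) [X (j - 1) j, Y (j - 1) (j + 1)]"
    using assms(1-5) by (simp add: path_of_def)
  show "sum_list (map deg q) = sum_list (map deg (crossing_nf i j k l)) + 1"
    using \<delta>_keys[OF Z, unfolded dZ] by (simp add: q_def)
  have z1: "path_dif Q deg (arrow_dif n1 n2 :: arrow \<Rightarrow> 'k sym_elem) ?l = 0"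
    and z2: "path_dif Q deg (arrow_dif n1 n2 :: arrow \<Rightarrow> 'k sym_elem) ?r = 0"
    by (rule path_dif_zero; auto simp: straight_nf_def)+
  have "path_dif Q deg (arrow_dif n1 n2) ([Z (j - 1)] @ ?r) =
      path_mult Q (arrow_dif n1 n2 (Z (j - 1))) (mon (j, j + 1) ?r)"
    using z2 assms(1-5) by (simp add: path_scale_eq del: arrow_dif.simps)
  also have "\<dots> = mon (j - 1, j) ([X (j - 1) j, Y (j - 1) (j + 1)] @ ?r)"
    unfolding dZ using awalk_awlast[OF w2] by (simp add: path_mult_single)
  finally have z3: "path_dif Q deg (arrow_dif n1 n2) ([Z (j - 1)] @ ?r) =
      mon (j - 1, j) ([X (j - 1) j, Y (j - 1) (j + 1)] @ ?r)" .
  have "path_dif Q deg (arrow_dif n1 n2) (?l @ ([Z (j - 1)] @ ?r)) =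
      pm_scale (crossing_sign (i, j)) (path_mult Q (mon (i, j) ?l) (mon (j - 1, j) ([X (j - 1) j, Y (j - 1) (j + 1)] @ ?r)))"
    unfolding path_dif_append[OF w1 awalk_appendI[OF w4 w3]] z1 z3 by (simp add: crossing_sign_def)
  also have "path_mult Q (mon (i, j) ?l) (mon (j - 1, j) ([X (j - 1) j, Y (j - 1) (j + 1)] @ ?r)) = mon (i, j) q"
    using awalk_awlast[OF w1] by (simp add: path_mult_single q_def)
  finally show "path_dif Q deg (arrow_dif n1 n2) (crossing_nf i j k l) = pm_scale (crossing_sign (i, j)) (mon (i, j) q)"
    by simp
qed

text \<open>The differential in coordinates (\<open>coords_dif\<close>).\<close>

definition resolve :: "(diagram \<Rightarrow>\<^sub>0 'k) \<Rightarrow> diagram \<Rightarrow>\<^sub>0 'k" where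
  "resolve = lin_ext (\<lambda>(t, u, v). if t = Crossing then Poly_Mapping.single (Straight, u, v) (crossing_sign u) else 0)"

text \<open>The contraction in coordinates. A straight diagram can be crossed precisely if a crossing
  with the same ends exists, and the sign makes \<open>cross\<close> inverse to \<open>resolve\<close> between the two.\<close>

definition cross :: "(diagram \<Rightarrow>\<^sub>0 'k) \<Rightarrow> diagram \<Rightarrow>\<^sub>0 'k" where
  "cross = lin_ext (\<lambda>(t, u, v). if t = Straight \<and> (Crossing, u, v) \<in> valid
     then Poly_Mapping.single (Crossing, u, v) (crossing_sign u) else 0)"

lemma resolve_linear [simp]:
  "resolve 0 = 0" "resolve (F + G) = resolve F + resolve G" "resolve (pm_scale c F) = pm_scale c (resolve F)"
  "resolve (Poly_Mapping.single (t, u, v) c) = (if t = Crossing then Poly_Mapping.single (Straight, u, v) (c * crossing_sign u) else 0)"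
  by (simp_all add: resolve_def lin_ext_add lin_ext_scale)

lemma cross_linear [simp]:
  "cross 0 = 0" "cross (F + G) = cross F + cross G" "cross (pm_scale c F) = pm_scale c (cross F)"
  "cross (Poly_Mapping.single (t, u, v) c) = (if t = Straight \<and> (Crossing, u, v) \<in> valid
     then Poly_Mapping.single (Crossing, u, v) (c * crossing_sign u) else 0)"
  by (simp_all add: cross_def lin_ext_add lin_ext_scale)

lemma valid_cross: "Poly_Mapping.keys F \<subseteq> valid \<Longrightarrow> Poly_Mapping.keys (cross F) \<subseteq> valid"
  unfolding cross_def by (erule keys_lin_ext) (auto split: if_splits)

lemma coords_dif:
  assumes "S \<in> carrier A"
  shows "coords (dif A S) = resolve (coords S)"
proof -
  obtain f where f: "f \<in> carrier P" "S = coset f" using assms by (rule carrierE)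
  let ?F = "diagram_sum f"
  have valid: "Poly_Mapping.keys ?F \<subseteq> valid" by (rule diagram_sum_valid[OF f(1)])
  have rc: "realization ?F \<in> carrier P" by (rule realization_carrier[OF valid])
  have "coset (dif P f) = coset (dif P (realization ?F))"
    using coset_dif[OF f(1)] coset_dif[OF rc] coset_realization[OF f(1)] by simp
  then have 1: "diagram_sum (dif P f) = diagram_sum (dif P (realization ?F))"
    by (intro diagram_sum_cong P_dif_closed f(1) rc)
  have 2: "diagram_sum (dif P (realization F)) = resolve F" if "Poly_Mapping.keys F \<subseteq> valid" for F
    using that
  proof (induction F rule: pm_induct)
    case (single d c)
    obtain t i j k l where d: "d = (t, (i, j), (k, l))" by (cases d) auto
    have "dif P (realization (Poly_Mapping.single d c)) = pm_scale c (path_dif Q deg (arrow_dif n1 n2) (normal_form d))"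
      by (simp add: realization_def)
    moreover have "diagram_sum (path_dif Q deg (arrow_dif n1 n2) (normal_form d)) = resolve (Poly_Mapping.single d 1)"
    proof (cases "t = Crossing")
      case True
      then have v: "1 \<le> i" "i < j" "j \<le> k" "k < l" "l \<le> n1 + n2" using single by (auto simp: d valid_def)
      show ?thesis
        unfolding d True crossing_resolution(4)[OF v] diagram_sum_linear diagram_sum_single crossing_resolution(2)[OF v]
        by simp
    next
      case False
      then have "path_dif Q deg (arrow_dif n1 n2 :: arrow \<Rightarrow> 'k sym_elem) (normal_form d) = 0"
        by (intro path_dif_zero; cases t) (auto simp: d straight_nf_def Let_def)
      then show ?thesis using False by (simp add: d diagram_sum_linear)
    qed
    ultimately have "diagram_sum (dif P (realization (Poly_Mapping.single d c))) = pm_scale c (resolve (Poly_Mapping.single d 1))"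
      by (simp add: diagram_sum_linear)
    then show ?case by (cases d) simp
  next
    case (add F G)
    then show ?case by (simp add: realization_def lin_ext_add P_dif diagram_sum_linear)
  qed (simp add: realization_def diagram_sum_linear)
  show ?thesis
    unfolding f(2) coset_dif[OF f(1)] coords_coset[OF f(1)] coords_coset[OF P_dif_closed[OF f(1)]] 1 2[OF valid] ..
qed

lemma cross_cross: "cross (cross F) = 0"
proof (induction F rule: pm_induct_all)
  case (single d c)
  then show ?case by (cases d) auto
qed auto

lemma cross_resolve_cross: "cross (resolve (cross F)) = cross F"
proof (induction F rule: pm_induct_all)
  case (single d c)
  then show ?case by (cases d) (auto simp: mult.assoc)
qed auto

lemma resolve_cross_resolve: "Poly_Mapping.keys F \<subseteq> valid \<Longrightarrow> resolve (cross (resolve F)) = resolve F"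
proof (induction F rule: pm_induct)
  case (single d c)
  then show ?case by (cases d) (auto simp: mult.assoc)
qed auto

text \<open>A crossing followed by a straight diagram is a crossing, and every other product with a
  crossing on the left is zero.\<close>

lemma cross_mult_right:
  assumes "Poly_Mapping.keys F \<subseteq> valid" "Poly_Mapping.keys G \<subseteq> valid"
  shows "cross (resolve (diagram_mult (cross F) G)) = diagram_mult (cross F) G"
  using assms(1)
proof (induction F rule: pm_induct)
  case (single d c)
  from assms(2) show ?case
  proof (induction G rule: pm_induct)
    case (single e b)
    obtain t u v where d: "d = (t, u, v)" by (cases d)
    obtain t' v' w where e: "e = (t', v', w)" by (cases e)
    show ?case
    proof (cases "t = Straight \<and> (Crossing, u, v) \<in> valid \<and> v = v' \<and> t' = Straight")
      case True
      then have "(Crossing, u, w) \<in> valid"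
        using dmul_valid[of "(Crossing, u, v)" "(Straight, v, w)" "(Crossing, u, w)"] single by (auto simp: e)
      then show ?thesis using True by (simp add: d e diagram_mult_single mult.assoc)
    next
      case False
      then show ?thesis by (cases t') (auto simp: d e diagram_mult_single)
    qed
  qed (auto simp: diagram_mult_add)
qed (auto simp: diagram_mult_add)

text \<open>A product that ends with a crossing is never straight.\<close>

lemma cross_mult_left: "cross (diagram_mult F (cross G)) = 0"
proof (induction F rule: pm_induct_all)
  case (single d c)
  show ?case
  proof (induction G rule: pm_induct_all)
    case (single e b)
    obtain t u v where d: "d = (t, u, v)" by (cases d)
    obtain t' v' w where e: "e = (t', v', w)" by (cases e)
    show ?case by (cases t) (auto simp: d e diagram_mult_single)
  qed (auto simp: diagram_mult_add)
qed (auto simp: diagram_mult_add)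

lemma cross_mult_cross: "diagram_mult (cross F) (cross G) = 0"
proof (induction F rule: pm_induct_all)
  case (single d c)
  show ?case
  proof (induction G rule: pm_induct_all)
    case (single e b)
    obtain t u v where d: "d = (t, u, v)" by (cases d)
    obtain t' v' w where e: "e = (t', v', w)" by (cases e)
    show ?case by (auto simp: d e diagram_mult_single)
  qed (auto simp: diagram_mult_add)
qed (auto simp: diagram_mult_add)

text \<open>For \<open>n1 = 1\<close> the target of a diagram with a \<open>\<beta>\<close>-strand is \<open>(2, l)\<close>, so its \<open>\<beta>\<close>-strand is
  on the left and would have to move in a crossing. Only the products of a straight diagram with a
  crossing remain.\<close>

lemma cross_two_sided:
  assumes "n1 = 1" "Poly_Mapping.keys F \<subseteq> valid" "Poly_Mapping.keys G \<subseteq> valid"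
  shows "cross (resolve (diagram_mult F (cross G))) = diagram_mult F (cross G)"
  using assms(2)
proof (induction F rule: pm_induct)
  case (single d c)
  from assms(3) show ?case
  proof (induction G rule: pm_induct)
    case (single e b)
    obtain t u v where d: "d = (t, u, v)" by (cases d)
    obtain t' v' w where e: "e = (t', v', w)" by (cases e)
    have beta: "snd v \<noteq> Suc n1 \<or> t \<noteq> Beta"
    proof -
      obtain i j k l where "u = (i, j)" "v = (k, l)" by (cases u; cases v)
      with \<open>d \<in> valid\<close> show ?thesis unfolding d valid_def using assms(1) by auto
    qed
    show ?case
    proof (cases "t = Straight \<and> t' = Straight \<and> (Crossing, v', w) \<in> valid \<and> v = v'")
      case True
      then have "(Crossing, u, w) \<in> valid"
        using dmul_valid[of d "(Crossing, v, w)" "(Crossing, u, w)"] \<open>d \<in> valid\<close> by (simp add: d)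
      then show ?thesis using True by (simp add: d e diagram_mult_single mult.assoc)
    next
      case False
      then show ?thesis using beta by (cases t) (auto simp: d e diagram_mult_single)
    qed
  qed (auto simp: diagram_mult_add)
qed (auto simp: diagram_mult_add)

definition homotopy :: "'k sym_elem set \<Rightarrow> 'k sym_elem set" where
  "homotopy S = coset (realization (cross (coords S)))"

lemma realization_cross_carrier: "S \<in> carrier A \<Longrightarrow> realization (cross (coords S)) \<in> carrier P"
  by (intro realization_carrier valid_cross coords_valid)

lemma homotopy_closed: "S \<in> carrier A \<Longrightarrow> homotopy S \<in> carrier A"
  unfolding homotopy_def by (intro coset_closed realization_cross_carrier)

lemma coords_homotopy: "S \<in> carrier A \<Longrightarrow> coords (homotopy S) = cross (coords S)"
  unfolding homotopy_def
  by (subst coords_coset[OF realization_cross_carrier])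
    (auto intro!: diagram_sum_realization valid_cross coords_valid del: subsetI)

text \<open>Every diagram has a degree, and that of a straight diagram exceeds the degree of the
  crossing with the same ends by one.\<close>

lemma homotopy_homog:
  assumes "S \<in> homog A n"
  shows "homotopy S \<in> homog A (n - 1)"
proof -
  define V where "V = (\<lambda>m. {d \<in> valid. sum_list (map deg (normal_form d)) = m})"
  obtain f where f: "f \<in> homog P n" "S = coset f" using assms by (auto simp: coset_homog)
  have fc: "f \<in> carrier P" using f homog_subset by blast
  have 1: "Poly_Mapping.keys (diagram_sum f) \<subseteq> V n"
    using f(1) unfolding P_homog mem_Collect_eq diagram_sum_def
  proof (rule keys_lin_ext)
    fix a assume "a \<in> {(u, p). (u, p) \<in> quiver_paths Q \<and> sum_list (map deg p) = n}"
    then obtain u q where uq: "a = (u, q)" "awalk u q (pre_digraph.awlast Q u q)" "sum_list (map deg q) = n"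
      by (cases a) (simp add: quiver_paths_iff)
    define v where "v = pre_digraph.awlast Q u q"
    note a = uq[folded v_def]
    have "d \<in> V n" if d: "eval_path u q = Some d" for d
    proof -
      note v = eval_path_valid[OF a(2) d]
      have "sum_list (map deg q) = sum_list (map deg (normal_form d))"
        using deg_eval_path[OF a(2) _ d, of "normal_form d" v] awalk_normal_form[of d] eval_normal_form[of d] v by auto
      then show ?thesis using a(3) v by (simp add: V_def)
    qed
    then show "Poly_Mapping.keys (case eval_path (fst a) (snd a) of None \<Rightarrow> 0 | Some d \<Rightarrow> Poly_Mapping.single d (1 :: 'k)) \<subseteq> V n"
      by (auto simp: a(1) split: option.split)
  qed
  have 2: "Poly_Mapping.keys (cross (diagram_sum f)) \<subseteq> V (n - 1)"
    unfolding cross_def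
  proof (rule keys_lin_ext[OF 1])
    fix d assume d: "d \<in> V n"
    obtain t i j k l where d': "d = (t, (i, j), (k, l))" by (cases d) auto
    show "Poly_Mapping.keys (case d of (t, u, v) \<Rightarrow> if t = Straight \<and> (Crossing, u, v) \<in> valid
        then Poly_Mapping.single (Crossing, u, v) (crossing_sign u) else 0) \<subseteq> V (n - 1)"
    proof (cases "t = Straight \<and> (Crossing, (i, j), (k, l)) \<in> valid")
      case True
      then have v: "1 \<le> i" "i < j" "j \<le> k" "k < l" "l \<le> n1 + n2" by (auto simp: valid_def)
      note res = crossing_resolution[OF v]
      have dv: "(Straight, (i, j), (k, l)) \<in> valid" using d True by (simp add: V_def d')
      have "sum_list (map deg (normal_form (Straight, (i, j), (k, l)))) = n" using d True by (simp add: V_def d')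
      moreover have "sum_list (map deg (normal_form (Straight, (i, j), (k, l)))) = sum_list (map deg (crossing_nf i j k l)) + 1"
        using deg_eval_path[OF res(1) _ res(2), of "normal_form (Straight, (i, j), (k, l))" "(k, l)"]
          awalk_normal_form[OF dv] eval_normal_form[OF dv] res(3) by simp
      ultimately have "sum_list (map deg (crossing_nf i j k l)) = n - 1" by linarith
      then show ?thesis using True by (simp add: d' V_def del: normal_form.simps)
    qed (auto simp: d')
  qed
  have "realization (cross (diagram_sum f)) \<in> homog P (n - 1)"
    unfolding P_homog mem_Collect_eq realization_def
  proof (rule keys_lin_ext[OF 2])
    fix d assume "d \<in> V (n - 1)"
    then show "Poly_Mapping.keys (mon (fst (snd d)) (normal_form d)) \<subseteq>
        {(u, p). (u, p) \<in> quiver_paths Q \<and> sum_list (map deg p) = n - 1}"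
      using mon_carrier[OF awalk_normal_form[of d]] by (auto simp: V_def)
  qed
  then show ?thesis
    unfolding homotopy_def f(2) coords_coset[OF fc] by (auto simp: coset_homog)
qed

theorem contracted_A: "contracted_dga A homotopy"
proof (rule contracted_dga.intro[OF A_dg_algebra contracted_dga_axioms.intro])
  note [simp] = homotopy_closed coords_homotopy coords_add coords_smult coords_mult coords_dif
  show "homotopy S \<in> homog A (n - 1)" if "S \<in> homog A n" for S n using that by (rule homotopy_homog)
  show "homotopy (S \<oplus>\<^bsub>A\<^esub> T) = homotopy S \<oplus>\<^bsub>A\<^esub> homotopy T" if "S \<in> carrier A" "T \<in> carrier A" for S T
    by (rule coords_inject) (use that in auto)
  show "homotopy (c \<odot>\<^bsub>A\<^esub> S) = c \<odot>\<^bsub>A\<^esub> homotopy S" if "S \<in> carrier A" for S c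
    by (rule coords_inject) (use that in auto)
  show "homotopy (homotopy S) = \<zero>\<^bsub>A\<^esub>" if "S \<in> carrier A" for S
    by (rule coords_inject) (use that in \<open>auto simp: cross_cross\<close>)
  show "homotopy (dif A (homotopy S)) = homotopy S" if "S \<in> carrier A" for S
    by (rule coords_inject) (use that in \<open>auto simp: cross_resolve_cross\<close>)
  show "dif A (homotopy (dif A S)) = dif A S" if "S \<in> carrier A" for S
    by (rule coords_inject) (use that in \<open>auto simp: resolve_cross_resolve coords_valid\<close>)
  show "homotopy (dif A (homotopy S \<otimes>\<^bsub>A\<^esub> T)) = homotopy S \<otimes>\<^bsub>A\<^esub> T" if "S \<in> carrier A" "T \<in> carrier A" for S T
    by (rule coords_inject) (use that in \<open>auto simp: cross_mult_right coords_valid\<close>)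
  show "homotopy (S \<otimes>\<^bsub>A\<^esub> homotopy T) = \<zero>\<^bsub>A\<^esub>" if "S \<in> carrier A" "T \<in> carrier A" for S T
    by (rule coords_inject) (use that in \<open>auto simp: cross_mult_left\<close>)
  show "homotopy S \<otimes>\<^bsub>A\<^esub> homotopy T = \<zero>\<^bsub>A\<^esub>" if "S \<in> carrier A" "T \<in> carrier A" for S T
    by (rule coords_inject) (use that in \<open>auto simp: cross_mult_cross\<close>)
qed (rule homotopy_closed)

section \<open>Formality and a nonzero Massey product\<close>

theorem formal_if_n1_eq_1:
  assumes "n1 = 1"
  shows "formal_in TYPE('k sym_elem set) A"
proof -
  interpret contracted_dga A homotopy by (rule contracted_A)
  have "pi (S \<otimes>\<^bsub>A\<^esub> homotopy T) = \<zero>\<^bsub>A\<^esub>" if "S \<in> carrier A" "T \<in> carrier A" for S T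
  proof -
    have "homotopy (dif A (S \<otimes>\<^bsub>A\<^esub> homotopy T)) = S \<otimes>\<^bsub>A\<^esub> homotopy T"
      by (rule coords_inject)
        (use that cross_two_sided[OF assms coords_valid coords_valid] in
          \<open>auto simp: homotopy_closed coords_homotopy coords_mult coords_dif\<close>)
    then show ?thesis using that by (simp add: pi_of_left_mult_h A.minus_eq A.r_neg)
  qed
  then show ?thesis by (rule formal_inI[OF formal_if_two_sided])
qed

lemma lookup_resolve_straight:
  "Poly_Mapping.lookup (resolve F) (Straight, u, v) = crossing_sign u * Poly_Mapping.lookup F (Crossing, u, v)"
proof (induction F rule: pm_induct_all)
  case (single d c)
  then show ?case by (cases d) (auto simp: lookup_single when_def)
qed (auto simp: lookup_add algebra_simps)

lemma lookup_resolve_beta: "Poly_Mapping.lookup (resolve F) (Beta, u, v) = 0"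
proof (induction F rule: pm_induct_all)
  case (single d c)
  then show ?case by (cases d) (auto simp: lookup_single when_def)
qed (auto simp: lookup_add)

context
  assumes n1: "1 < n1"
begin

text \<open>The diagram in question arises from the first factor in only one way, namely by crossing
  the two strands.\<close>

lemma lookup_beta_mult:
  assumes "Poly_Mapping.keys F \<subseteq> valid"
  shows "Poly_Mapping.lookup (diagram_mult (Poly_Mapping.single (Beta, (1, n1), (n1, n1 + 1)) b) F)
      (Beta, (1, n1), (n1 + 1, n1 + 2)) = b * Poly_Mapping.lookup F (Crossing, (n1, n1 + 1), (n1 + 1, n1 + 2))"
  using assms
proof (induction F rule: pm_induct)
  case (single d c)
  obtain t i j k l where d: "d = (t, (i, j), (k, l))" by (cases d) auto
  show ?case by (cases t) (auto simp: d diagram_mult_single lookup_single when_def)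
qed (auto simp: diagram_mult_add lookup_add algebra_simps)

text \<open>In the diagram in question a strand arrives at \<open>n1 + 1\<close> through \<open>\<beta>\<close>, but the last factor
  starts at \<open>(n1, n1 + 2)\<close>.\<close>

lemma lookup_mult_y:
  assumes "Poly_Mapping.keys F \<subseteq> valid"
  shows "Poly_Mapping.lookup (diagram_mult F (Poly_Mapping.single (Straight, (n1, n1 + 2), (n1 + 1, n1 + 2)) 1))
      (Beta, (1, n1), (n1 + 1, n1 + 2)) = 0"
  using assms
proof (induction F rule: pm_induct)
  case (single d c)
  obtain t i j k l where d: "d = (t, (i, j), (k, l))" by (cases d) auto
  show ?case by (cases t) (auto simp: d diagram_mult_single lookup_single when_def)
qed (auto simp: diagram_mult_add lookup_add)

text \<open>Since \<open>u x = 0\<close> and \<open>x y = d z\<close>, the Massey product of \<open>u\<close>, \<open>x\<close>, \<open>y\<close> is represented by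
  \<open>u z\<close>, up to sign. Its diagram has coefficient zero in the indeterminacy: cocycles contain no
  crossing, right multiples of \<open>y\<close> do not contain the diagram, and coboundaries contain only
  straight diagrams.\<close>

theorem nonzero_massey_product: "\<not> A.massey_vanishing"
proof
  assume vanish: "A.massey_vanishing"
  define u where "u = path_class (1, n1) [U n1]"
  define x where "x = path_class (n1, n1 + 1) [X n1 (n1 + 1)]"
  define y where "y = path_class (n1, n1 + 2) [Y n1 (n1 + 2)]"
  define z where "z = path_class (n1, n1 + 1) [Z n1]"
  note classes = u_def x_def y_def z_def
  have wu: "awalk (1, n1) [U n1] (n1, n1 + 1)" and wx: "awalk (n1, n1 + 1) [X n1 (n1 + 1)] (n1, n1 + 2)"
    and wy: "awalk (n1, n1 + 2) [Y n1 (n1 + 2)] (n1 + 1, n1 + 2)" and wz: "awalk (n1, n1 + 1) [Z n1] (n1 + 1, n1 + 2)"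
    using n1 n1_le by (auto simp: awalk_small)
  note walks = wu wx wy wz
  have car: "u \<in> carrier A" "x \<in> carrier A" "y \<in> carrier A" "z \<in> carrier A"
    unfolding classes using walks by (auto intro: path_class_closed)
  have cu: "coords u = Poly_Mapping.single (Beta, (1, n1), (n1, n1 + 1)) 1"
    and cx: "coords x = Poly_Mapping.single (Straight, (n1, n1 + 1), (n1, n1 + 2)) 1"
    and cy: "coords y = Poly_Mapping.single (Straight, (n1, n1 + 2), (n1 + 1, n1 + 2)) 1"
    and cz: "coords z = Poly_Mapping.single (Crossing, (n1, n1 + 1), (n1 + 1, n1 + 2)) 1"
    using coords_path_class[OF wu] coords_path_class[OF wx] coords_path_class[OF wy] coords_path_class[OF wz] n1
    by (simp_all add: classes)
  have cyc: "u \<in> cocycles A (dif A)" "x \<in> cocycles A (dif A)" "y \<in> cocycles A (dif A)"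
  proof -
    have "dif A u = \<zero>\<^bsub>A\<^esub>" "dif A x = \<zero>\<^bsub>A\<^esub>" "dif A y = \<zero>\<^bsub>A\<^esub>"
      using car by (intro coords_inject; simp add: coords_dif cu cx cy)+
    then show "u \<in> cocycles A (dif A)" "x \<in> cocycles A (dif A)" "y \<in> cocycles A (dif A)"
      unfolding A.cocycles_iff using car by blast+
  qed
  have ux: "dif A \<zero>\<^bsub>A\<^esub> = u \<otimes>\<^bsub>A\<^esub> x"
    using car by (intro coords_inject) (auto simp: coords_mult cu cx diagram_mult_single)
  have xy: "dif A (crossing_sign (n1, n1 + 1) \<odot>\<^bsub>A\<^esub> z) = x \<otimes>\<^bsub>A\<^esub> y"
    using car by (intro coords_inject) (auto simp: coords_mult coords_dif coords_smult cx cy cz diagram_mult_single)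
  let ?w = "crossing_sign (n1, n1 + 1) \<odot>\<^bsub>A\<^esub> z" and ?c = "(-1) powi deg (U n1) :: 'k"
  have w: "?w \<in> carrier A" using car by simp
  have eps: "A.eps u = ?c \<odot>\<^bsub>A\<^esub> u"
    using A.eps_of_homog[OF path_class_homog[OF wu]] by (simp add: u_def)
  \<comment> \<open>The defining system consists of zero and a multiple of \<open>z\<close>.\<close>
  obtain s t r where s: "s \<in> cocycles A (dif A)" and t: "t \<in> cocycles A (dif A)" and r: "r \<in> carrier A"
    and eq: "\<zero>\<^bsub>A\<^esub> \<otimes>\<^bsub>A\<^esub> y \<ominus>\<^bsub>A\<^esub> A.eps u \<otimes>\<^bsub>A\<^esub> ?w = A.eps u \<otimes>\<^bsub>A\<^esub> s \<oplus>\<^bsub>A\<^esub> t \<otimes>\<^bsub>A\<^esub> y \<oplus>\<^bsub>A\<^esub> dif A r"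
    using vanish[unfolded A.massey_vanishing_def, rule_format, OF cyc _ w ux xy] by auto
  have st: "s \<in> carrier A" "t \<in> carrier A" "dif A s = \<zero>\<^bsub>A\<^esub>" using s t by (auto simp: A.cocycles_iff)
  let ?D = "(Beta, (1, n1), (n1 + 1, n1 + 2))"
  \<comment> \<open>Resolution is injective on the span of the crossings, so no crossing occurs in a cocycle.\<close>
  have "resolve (coords s) = 0" using coords_dif[OF st(1)] st(3) by simp
  then have s0: "Poly_Mapping.lookup (coords s) (Crossing, (n1, n1 + 1), (n1 + 1, n1 + 2)) = 0"
    using lookup_resolve_straight[of "coords s" "(n1, n1 + 1)" "(n1 + 1, n1 + 2)"] by simp
  have "Poly_Mapping.lookup (coords (A.eps u \<otimes>\<^bsub>A\<^esub> s \<oplus>\<^bsub>A\<^esub> t \<otimes>\<^bsub>A\<^esub> y \<oplus>\<^bsub>A\<^esub> dif A r)) ?D = 0"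
    using car st r lookup_beta_mult[OF coords_valid[OF st(1)], of ?c] lookup_mult_y[OF coords_valid[OF st(2)]] s0
    by (simp add: eps coords_add coords_mult coords_smult coords_dif cu cy lookup_add lookup_resolve_beta)
  moreover have "Poly_Mapping.lookup (coords (\<zero>\<^bsub>A\<^esub> \<otimes>\<^bsub>A\<^esub> y \<ominus>\<^bsub>A\<^esub> A.eps u \<otimes>\<^bsub>A\<^esub> ?w)) ?D =
      - (?c * crossing_sign (n1, n1 + 1))"
    using car n1 by (simp add: A.minus_eq eps coords_minus coords_mult coords_smult cu cz diagram_mult_single lookup_single)
  ultimately show False unfolding eq by simp
qed

end

end

theorem theorem1p1:
  fixes n\<^sub>1 n\<^sub>2 :: nat and deg :: "arrow \<Rightarrow> int"
    and A :: "('k::{alg_closed_field, field_char_0}, 'k sym_elem set) dg_alg"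
  assumes "1 \<le> n\<^sub>1" and "n\<^sub>1 \<le> n\<^sub>2"
    and "admissible_grading TYPE('k) n\<^sub>1 n\<^sub>2 deg"
    and A: "A = sym_dga n\<^sub>1 n\<^sub>2 deg"
  shows "(n\<^sub>1 = 1 \<longrightarrow> formal_in TYPE('k sym_elem set) A) \<and>
         (n\<^sub>1 > 1 \<longrightarrow>
            \<not> formal_in TYPE('u) A \<and>
            (\<exists>m. minimal_model A m \<and>
               (\<forall>Xs. set Xs \<subseteq> carrier (cohomology A) \<and> length Xs > 3 \<longrightarrow> m Xs = \<zero>\<^bsub>cohomology A\<^esub>)))"
proof -
  interpret sym: sym_square n\<^sub>1 n\<^sub>2 deg "TYPE('k)"
    by unfold_locales (use assms in auto)
  interpret contracted_dga A sym.homotopy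
    unfolding A by (rule sym.contracted_A)
  have "formal_in TYPE('k sym_elem set) A" if "n\<^sub>1 = 1"
    unfolding A using that by (rule sym.formal_if_n1_eq_1)
  moreover have "\<not> formal_in TYPE('u) A" if "n\<^sub>1 > 1"
    using sym.nonzero_massey_product[OF that] formal_massey_vanishing unfolding A by blast
  moreover have "minimal_model A transferred_ops" by (rule minimal_model_transferred)
  moreover have "\<forall>Xs. set Xs \<subseteq> carrier (cohomology A) \<and> length Xs > 3 \<longrightarrow> transferred_ops Xs = \<zero>\<^bsub>cohomology A\<^esub>"
    using transferred_ops_long by blast
  ultimately show ?thesis by blast
qed

end
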